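(* Let $M$ be a $4$-dimensional compact connected oriented spin manifold with flat boundary $\partial M$, whose metric near the boundary has the form $g^M=\frac{1}{\varphi(x_n)}g^{\partial M}+\psi(x_n)dx_n^2$ (with $n=4$, $\varphi,\psi>0$, $\varphi(0)=\psi(0)=1$), and suppose $\psi'(0)=\varphi'(0)$. Let $D$ be the Dirac operator on $\widehat M$. Then $$\int_{\partial M}\mathrm{res}_{1,1}(D^{-1},D^{-1})=\frac{\pi}{6}\Omega_3 I_{\mathrm{Gr,b}},\qquad \int_{\partial M}\mathrm{res}_{2,1}(D^{-1},D^{-1})=-\frac{\pi}{3}\Omega_3 I_{\mathrm{Gr,b}}.$$
   Context: $x_n\ge0$ is a collar coordinate with $\partial M=\{x_n=0\}$; $x'$ are local coordinates on $\partial M$. $\widehat M\supset M$ is the extension of $M$ (with metric and spin structure) across the boundary by a collar. $D$ is the Dirac operator on the spinor bundle $S(TM)$ (Clifford action with $c(\xi)^2=-|\xi|^2$), $D^{-1}$ its inverse (parametrix) as a pseudodifferential operator, $\sigma_l(A)$ the homogeneous order-$l$ part of the symbol of $A$, and $\Omega_n=\frac{2\pi^{n/2}}{\Gamma(n/2)}$. For a rational function $h$ of $\xi_n$ decaying at infinity with no real poles, $\pi^+_{\xi_n}h(\xi_n)=\frac{1}{2\pi i}\lim_{u\to0^-}\int_{\Gamma^+}\frac{h(\eta_n)}{\xi_n+iu-\eta_n}d\eta_n$, $\Gamma^+$ a closed contour in the upper half plane surrounding the poles of $h$ there. For pseudodifferential operators $P,P'$ with the transmission property on $\widehat M$, define locally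 on $\partial M$ (symbols evaluated at $x_n=0$) $$\mathrm{res}_{1,1}(P,P'):=-\frac12\int_{|\xi'|=1}\int_{-\infty}^{+\infty}\mathrm{trace}[\partial_{x_n}\pi^+_{\xi_n}\sigma_{-1}(P)\times\partial^2_{\xi_n}\sigma_{-1}(P')]d\xi_n\sigma(\xi')dx',$$ $$\mathrm{res}_{2,1}(P,P'):=-i\int_{|\xi'|=1}\int_{-\infty}^{+\infty}\mathrm{trace}[\pi^+_{\xi_n}\sigma_{-2}(P)\times\partial_{\xi_n}\sigma_{-1}(P')]d\xi_n\sigma(\xi')dx',$$ where $\sigma(\xi')$ is the canonical measure on the unit sphere. Since $\partial M$ is flat, local coordinates on $\partial M$ are chosen so that $\{dx_i\}$ is oriented orthonormal, $g^{\partial M}_{i,j}=\delta_{i,j}$; $\mathrm{res}_{1,1}(D^{-1},D^{-1})$ and $\mathrm{res}_{2,1}(D^{-1},D^{-1})$ are computed in these coordinates and give global forms on $\partial M$. The boundary part of the Einstein–Hilbert action is $I_{\mathrm{Gr,b}}=2\int_{\partial M}K\,\mathrm{dvol}_{\partial M}$, where $K=\sum_{1\le i,j\le n-1}K_{i,j}g^{i,j}_{\partial M}$ and $K_{i,j}=-\Gamma^n_{i,j}$ is the second fundamental form ($\Gamma$ the Christoffel symbols of $g^M$). *)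

theory Defs
  imports "HOL-Complex_Analysis.Complex_Analysis"
begin

section \<open>Smooth functions on open subsets of Euclidean spaces\<close>

primrec Ck_on :: "nat \<Rightarrow> 'a::real_normed_vector set \<Rightarrow> ('a \<Rightarrow> 'b::real_normed_vector) \<Rightarrow> bool" where
  "Ck_on 0 S f \<longleftrightarrow> continuous_on S f"
| "Ck_on (Suc k) S f \<longleftrightarrow>
     (\<forall>x\<in>S. f differentiable (at x)) \<and> (\<forall>v. Ck_on k S (\<lambda>x. frechet_derivative f (at x) v))"

definition smooth_on :: "'a::real_normed_vector set \<Rightarrow> ('a \<Rightarrow> 'b::real_normed_vector) \<Rightarrow> bool" where
  "smooth_on S f \<longleftrightarrow> (\<forall>k. Ck_on k S f)"

primrec iter_deriv ::
  "'a::real_normed_vector list \<Rightarrow> ('a \<Rightarrow> 'b::real_normed_vector) \<Rightarrow> 'a \<Rightarrow> 'b" where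
  "iter_deriv [] f = f"
| "iter_deriv (v # vs) f = iter_deriv vs (\<lambda>x. frechet_derivative f (at x) v)"

definition partial :: "4 \<Rightarrow> (real^4 \<Rightarrow> 'b::real_normed_vector) \<Rightarrow> real^4 \<Rightarrow> 'b" where
  "partial i f x = frechet_derivative f (at x) (axis i 1)"


section \<open>Splitting \<open>x = (x', x\<^sub>n)\<close> for \<open>n = 4\<close>\<close>

text \<open>The last index is written \<open>4\<close>; in the type \<^typ>\<open>4\<close> this is the same element as \<open>0\<close>.\<close>

definition inc :: "3 \<Rightarrow> 4" where
  "inc i = (if i = 1 then 1 else if i = 2 then 2 else 3)"

definition tang :: "real^4 \<Rightarrow> real^3" where
  "tang x = (\<chi> i. x $ inc i)"

definition join :: "real^3 \<Rightarrow> real \<Rightarrow> real^4" where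
  "join y t = (\<Sum>i\<in>UNIV. (y $ i) *\<^sub>R axis (inc i) 1) + t *\<^sub>R axis 4 1"


section \<open>Oriented smooth manifolds of dimension 4\<close>

record 'm chart =
  cdom :: "'m set"
  cmap :: "'m \<Rightarrow> real^4"

definition cimg :: "'m chart \<Rightarrow> (real^4) set" where
  "cimg \<kappa> = cmap \<kappa> ` cdom \<kappa>"

definition cinv :: "'m chart \<Rightarrow> real^4 \<Rightarrow> 'm" where
  "cinv \<kappa> = inv_into (cdom \<kappa>) (cmap \<kappa>)"

definition is_chart :: "'m::topological_space chart \<Rightarrow> bool" where
  "is_chart \<kappa> \<longleftrightarrow> open (cdom \<kappa>) \<and> open (cimg \<kappa>) \<and>
     homeomorphism (cdom \<kappa>) (cimg \<kappa>) (cmap \<kappa>) (cinv \<kappa>)"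

definition trans_map :: "'m chart \<Rightarrow> 'm chart \<Rightarrow> real^4 \<Rightarrow> real^4" where
  "trans_map \<kappa> \<kappa>' = cmap \<kappa>' \<circ> cinv \<kappa>"

definition trans_jac :: "'m chart \<Rightarrow> 'm chart \<Rightarrow> 'm \<Rightarrow> real^4^4" where
  "trans_jac \<kappa> \<kappa>' q = jacobian (trans_map \<kappa> \<kappa>') (at (cmap \<kappa> q))"

definition or_compatible :: "'m chart \<Rightarrow> 'm chart \<Rightarrow> bool" where
  "or_compatible \<kappa> \<kappa>' \<longleftrightarrow>
     smooth_on (cmap \<kappa> ` (cdom \<kappa> \<inter> cdom \<kappa>')) (trans_map \<kappa> \<kappa>') \<and>
     (\<forall>q\<in>cdom \<kappa> \<inter> cdom \<kappa>'. det (trans_jac \<kappa> \<kappa>' q) > 0)"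

definition oriented_atlas :: "'m::topological_space chart set \<Rightarrow> bool" where
  "oriented_atlas \<A> \<longleftrightarrow>
     (\<Union>\<kappa>\<in>\<A>. cdom \<kappa>) = UNIV \<and>
     (\<forall>\<kappa>\<in>\<A>. is_chart \<kappa>) \<and>
     (\<forall>\<kappa>\<in>\<A>. \<forall>\<kappa>'\<in>\<A>. or_compatible \<kappa> \<kappa>') \<and>
     (\<forall>\<kappa>. is_chart \<kappa> \<and> (\<forall>\<kappa>'\<in>\<A>. or_compatible \<kappa> \<kappa>' \<and> or_compatible \<kappa>' \<kappa>) \<longrightarrow> \<kappa> \<in> \<A>)"


section \<open>Riemannian spin manifolds\<close>

text \<open>
  The Clifford module is \<open>\<complex>\<^sup>4\<close>, with generators \<open>c 1, \<dots>, c 4\<close>; since \<open>4 = 2\<^bsup>n/2\<^esup>\<close> it is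
  the (irreducible) spinor module.
\<close>

definition clifford_gens :: "(4 \<Rightarrow> complex^4^4) \<Rightarrow> bool" where
  "clifford_gens c \<longleftrightarrow>
     (\<forall>i j. c i ** c j + c j ** c i = (if i = j then mat (- 2) else 0))"

definition cl_vec :: "(4 \<Rightarrow> complex^4^4) \<Rightarrow> real^4 \<Rightarrow> complex^4^4" where
  "cl_vec c v = (\<Sum>i\<in>UNIV. (v $ i) *\<^sub>R c i)"

text \<open>\<open>Spin(4)\<close>: products of an even number of unit vectors in the Clifford algebra.\<close>

inductive_set spin_group :: "(4 \<Rightarrow> complex^4^4) \<Rightarrow> (complex^4^4) set"
  for c :: "4 \<Rightarrow> complex^4^4" where
  spin_one: "mat 1 \<in> spin_group c"
| spin_mult: "\<lbrakk>A \<in> spin_group c; norm u = 1; norm v = 1\<rbrakk>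
     \<Longrightarrow> A ** cl_vec c u ** cl_vec c v \<in> spin_group c"

text \<open>
  The fibre of the spinor bundle over every point is identified, as a bare vector space, with
  \<open>\<complex>\<^sup>4\<close>, so that sections are plain functions; the bundle structure is carried by the
  trivialisations. A spin frame consists of a chart, an oriented orthonormal frame field
  (the columns of \<open>frame a x\<close> are the components in the chart of \<open>e\<^sub>1, \<dots>, e\<^sub>4\<close> at the point
  with coordinates \<open>x\<close>), and a trivialisation of the spinor bundle induced by a lift of that
  frame field to the spin bundle.
\<close>

record 'm spin_frame =
  fchart :: "'m chart"
  frame :: "real^4 \<Rightarrow> real^4^4"
  triv :: "'m \<Rightarrow> complex^4^4"

abbreviation "fdom a \<equiv> cdom (fchart a)"
abbreviation "fmap a \<equiv> cmap (fchart a)"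
abbreviation "fimg a \<equiv> cimg (fchart a)"
abbreviation "finv a \<equiv> cinv (fchart a)"

text \<open>\<open>metric X \<kappa> x\<close> is the matrix \<open>(g\<^sub>i\<^sub>j(x))\<close> in the coordinates of \<open>\<kappa>\<close>.\<close>

record 'm spin_mfd =
  atlas :: "'m chart set"
  metric :: "'m chart \<Rightarrow> real^4 \<Rightarrow> real^4^4"
  cliff :: "4 \<Rightarrow> complex^4^4"
  spin_frames :: "'m spin_frame set"

definition riemannian_metric :: "'m spin_mfd \<Rightarrow> bool" where
  "riemannian_metric X \<longleftrightarrow>
     (\<forall>\<kappa>\<in>atlas X. smooth_on (cimg \<kappa>) (metric X \<kappa>) \<and>
        (\<forall>x\<in>cimg \<kappa>. transpose (metric X \<kappa> x) = metric X \<kappa> x \<and>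
           (\<forall>v. v \<noteq> 0 \<longrightarrow> v \<bullet> (metric X \<kappa> x *v v) > 0))) \<and>
     (\<forall>\<kappa>\<in>atlas X. \<forall>\<kappa>'\<in>atlas X. \<forall>q\<in>cdom \<kappa> \<inter> cdom \<kappa>'.
        metric X \<kappa> (cmap \<kappa> q) =
          transpose (trans_jac \<kappa> \<kappa>' q) ** metric X \<kappa>' (cmap \<kappa>' q) ** trans_jac \<kappa> \<kappa>' q)"

definition on_frame :: "'m spin_mfd \<Rightarrow> 'm chart \<Rightarrow> (real^4 \<Rightarrow> real^4^4) \<Rightarrow> bool" where
  "on_frame X \<kappa> E \<longleftrightarrow> smooth_on (cimg \<kappa>) E \<and>
     (\<forall>x\<in>cimg \<kappa>. transpose (E x) ** metric X \<kappa> x ** E x = mat 1 \<and> det (E x) > 0)"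

text \<open>The \<open>SO(4)\<close>-valued transition function \<open>h\<close> with \<open>e\<^sup>b\<^sub>j = \<Sum>\<^sub>k h\<^sub>k\<^sub>j e\<^sup>a\<^sub>k\<close>.\<close>

definition frame_trans :: "'m spin_frame \<Rightarrow> 'm spin_frame \<Rightarrow> 'm \<Rightarrow> real^4^4" where
  "frame_trans a b q =
     matrix_inv (frame a (fmap a q)) ** (trans_jac (fchart b) (fchart a) q ** frame b (fmap b q))"

definition triv_trans :: "'m spin_frame \<Rightarrow> 'm spin_frame \<Rightarrow> 'm \<Rightarrow> complex^4^4" where
  "triv_trans a b q = matrix_inv (triv a q) ** triv b q"

text \<open>
  The spin structure: the transition functions of the spin frames are smooth \<open>Spin(4)\<close>-valued
  lifts of those of the orthonormal frames, and since the spin bundle covers the oriented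
  orthonormal frame bundle, every oriented orthonormal frame field lifts locally.
\<close>

definition spin_structure :: "'m::topological_space spin_mfd \<Rightarrow> bool" where
  "spin_structure X \<longleftrightarrow>
     (\<forall>a\<in>spin_frames X. fchart a \<in> atlas X \<and> on_frame X (fchart a) (frame a) \<and>
        (\<forall>q\<in>fdom a. invertible (triv a q))) \<and>
     (\<forall>a\<in>spin_frames X. \<forall>b\<in>spin_frames X.
        smooth_on (fmap a ` (fdom a \<inter> fdom b)) (\<lambda>x. triv_trans a b (finv a x)) \<and>
        (\<forall>q\<in>fdom a \<inter> fdom b. triv_trans a b q \<in> spin_group (cliff X) \<and>
           (\<forall>v. triv_trans a b q ** cl_vec (cliff X) v =
                cl_vec (cliff X) (frame_trans a b q *v v) ** triv_trans a b q))) \<and>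
     (\<forall>\<kappa>\<in>atlas X. \<forall>E. on_frame X \<kappa> E \<longrightarrow> (\<forall>q\<in>cdom \<kappa>.
        \<exists>a\<in>spin_frames X. q \<in> fdom a \<and> fdom a \<subseteq> cdom \<kappa> \<and>
          (\<forall>q'\<in>fdom a. fmap a q' = cmap \<kappa> q') \<and> (\<forall>x\<in>fimg a. frame a x = E x)))"

definition riemannian_spin_mfd ::
  "'m::{t2_space,second_countable_topology} spin_mfd \<Rightarrow> bool" where
  "riemannian_spin_mfd X \<longleftrightarrow> oriented_atlas (atlas X) \<and> riemannian_metric X \<and>
     clifford_gens (cliff X) \<and> spin_structure X"

definition christoffel :: "'m spin_mfd \<Rightarrow> 'm chart \<Rightarrow> real^4 \<Rightarrow> 4 \<Rightarrow> 4 \<Rightarrow> 4 \<Rightarrow> real" where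
  "christoffel X \<kappa> x k i j =
     (\<Sum>l\<in>UNIV. matrix_inv (metric X \<kappa> x) $ k $ l / 2 *
        (partial i (\<lambda>y. metric X \<kappa> y $ j $ l) x + partial j (\<lambda>y. metric X \<kappa> y $ i $ l) x
          - partial l (\<lambda>y. metric X \<kappa> y $ i $ j) x))"


section \<open>Spinor fields and the Dirac operator\<close>

definition local_rep :: "'m spin_frame \<Rightarrow> ('m \<Rightarrow> complex^4) \<Rightarrow> real^4 \<Rightarrow> complex^4" where
  "local_rep a s x = matrix_inv (triv a (finv a x)) *v s (finv a x)"

definition glob_sec :: "'m spin_frame \<Rightarrow> (real^4 \<Rightarrow> complex^4) \<Rightarrow> 'm \<Rightarrow> complex^4" where
  "glob_sec a u q = (if q \<in> fdom a then triv a q *v u (fmap a q) else 0)"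

definition smooth_section :: "'m spin_mfd \<Rightarrow> ('m \<Rightarrow> complex^4) \<Rightarrow> bool" where
  "smooth_section X s \<longleftrightarrow> (\<forall>a\<in>spin_frames X. smooth_on (fimg a) (local_rep a s))"

definition smooth_section_c ::
  "'m::topological_space spin_mfd \<Rightarrow> 'm set \<Rightarrow> ('m \<Rightarrow> complex^4) \<Rightarrow> bool" where
  "smooth_section_c X U s \<longleftrightarrow> smooth_section X s \<and>
     (\<exists>K. compact K \<and> K \<subseteq> U \<and> (\<forall>q. q \<notin> K \<longrightarrow> s q = 0))"

text \<open>\<open>\<langle>\<nabla>\<^bsub>e\<^sub>j\<^esub> e\<^sub>l, e\<^sub>m\<rangle>\<close> for the Levi-Civita connection.\<close>

definition conn_form :: "'m spin_mfd \<Rightarrow> 'm spin_frame \<Rightarrow> real^4 \<Rightarrow> 4 \<Rightarrow> 4 \<Rightarrow> 4 \<Rightarrow> real" where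
  "conn_form X a x j l m =
     (\<Sum>p\<in>UNIV. \<Sum>q\<in>UNIV. metric X (fchart a) x $ p $ q * frame a x $ q $ m *
        (\<Sum>k\<in>UNIV. frame a x $ k $ j *
           (partial k (\<lambda>y. frame a y $ p $ l) x +
            (\<Sum>r\<in>UNIV. christoffel X (fchart a) x p k r * frame a x $ r $ l))))"

text \<open>
  Spin connection \<open>\<nabla>\<^bsub>e\<^sub>j\<^esub> u = e\<^sub>j(u) + (1/4) \<Sum>\<^bsub>l,m\<^esub> \<langle>\<nabla>\<^bsub>e\<^sub>j\<^esub> e\<^sub>l, e\<^sub>m\<rangle> c(e\<^sub>l) c(e\<^sub>m) u\<close>; this sign makes it
  compatible with Clifford multiplication for \<open>c(v)\<^sup>2 = - |v|\<^sup>2\<close>.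
\<close>

definition spin_conn ::
  "'m spin_mfd \<Rightarrow> 'm spin_frame \<Rightarrow> 4 \<Rightarrow> (real^4 \<Rightarrow> complex^4) \<Rightarrow> real^4 \<Rightarrow> complex^4" where
  "spin_conn X a j u x =
     (\<Sum>k\<in>UNIV. (frame a x $ k $ j) *\<^sub>R partial k u x) +
     (\<Sum>l\<in>UNIV. \<Sum>m\<in>UNIV.
        (conn_form X a x j l m / 4) *\<^sub>R ((cliff X l ** cliff X m) *v u x))"

definition dirac_operator ::
  "'m spin_mfd \<Rightarrow> (('m \<Rightarrow> complex^4) \<Rightarrow> ('m \<Rightarrow> complex^4)) \<Rightarrow> bool" where
  "dirac_operator X D \<longleftrightarrow>
     (\<forall>s. smooth_section X s \<longrightarrow> (\<forall>a\<in>spin_frames X. \<forall>x\<in>fimg a.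
        local_rep a (D s) x = (\<Sum>j\<in>UNIV. cliff X j *v spin_conn X a j (local_rep a s) x)))"


section \<open>Classical pseudodifferential operators\<close>

text \<open>
  \<open>symbol_class V d\<close> is \<open>S\<^sup>d(V)\<close> without the smoothness requirement near \<open>\<xi> = 0\<close>.
\<close>

definition symbol_class ::
  "(real^4) set \<Rightarrow> int \<Rightarrow> (real^4 \<Rightarrow> real^4 \<Rightarrow> complex^4^4) \<Rightarrow> bool" where
  "symbol_class V d r \<longleftrightarrow>
     (\<forall>K vs ws. compact K \<and> K \<subseteq> V \<longrightarrow> (\<exists>C. \<forall>x\<in>K. \<forall>\<xi>. norm \<xi> \<ge> 1 \<longrightarrow>
        norm (iter_deriv (map (\<lambda>v. (v, 0)) vs @ map (Pair 0) ws) (\<lambda>(y, \<eta>). r y \<eta>) (x, \<xi>))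
          \<le> C * norm \<xi> powi (d - int (length ws))))"

text \<open>\<open>\<sigma> l\<close> is the part of \<open>p\<close> that is homogeneous of degree \<open>l\<close>; \<open>m\<close> is (a bound for) the order.\<close>

definition classical_symbol :: "(real^4) set \<Rightarrow> int \<Rightarrow> (real^4 \<Rightarrow> real^4 \<Rightarrow> complex^4^4) \<Rightarrow>
    (int \<Rightarrow> real^4 \<Rightarrow> real^4 \<Rightarrow> complex^4^4) \<Rightarrow> bool" where
  "classical_symbol V m p \<sigma> \<longleftrightarrow>
     smooth_on (V \<times> UNIV) (\<lambda>(x, \<xi>). p x \<xi>) \<and>
     (\<forall>l. smooth_on (V \<times> (- {0})) (\<lambda>(x, \<xi>). \<sigma> l x \<xi>) \<and>
        (\<forall>x\<in>V. \<forall>\<xi>. \<xi> \<noteq> 0 \<longrightarrow> (\<forall>t>0. \<sigma> l x (t *\<^sub>R \<xi>) = (t powi l) *\<^sub>R \<sigma> l x \<xi>))) \<and>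
     (\<forall>l>m. \<forall>x\<in>V. \<forall>\<xi>. \<xi> \<noteq> 0 \<longrightarrow> \<sigma> l x \<xi> = 0) \<and>
     (\<forall>N. symbol_class V (N - 1) (\<lambda>x \<xi>. p x \<xi> - (\<Sum>l=N..m. \<sigma> l x \<xi>)))"

definition cutoff :: "(real^4) set \<Rightarrow> (real^4 \<Rightarrow> complex) \<Rightarrow> bool" where
  "cutoff V f \<longleftrightarrow> smooth_on UNIV f \<and> (\<exists>K. compact K \<and> K \<subseteq> V \<and> (\<forall>x. x \<notin> K \<longrightarrow> f x = 0))"

text \<open>
  \<open>e\<^bsup>-i\<langle>x,\<xi>\<rangle>\<^esup> P(f e\<^bsup>i\<langle>\<cdot>,\<xi>\<rangle>\<^esup>)(x)\<close> in the trivialisation \<open>a\<close>; column \<open>k\<close> is obtained from the \<open>k\<close>-th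
  constant spinor. If \<open>P\<close> is linear and continuous, Fourier inversion gives
  \<open>P(fu)(x) = (2\<pi>)\<^bsup>-4\<^esup> \<integral> e\<^bsup>i\<langle>x,\<xi>\<rangle>\<^esup> loc_symbol a P f x \<xi> (\<F>u)(\<xi>) d\<xi>\<close>,
  so this is the symbol of \<open>P \<circ> f\<close> in the usual sense.
\<close>

definition loc_symbol :: "'m spin_frame \<Rightarrow> (('m \<Rightarrow> complex^4) \<Rightarrow> ('m \<Rightarrow> complex^4)) \<Rightarrow>
    (real^4 \<Rightarrow> complex) \<Rightarrow> real^4 \<Rightarrow> real^4 \<Rightarrow> complex^4^4" where
  "loc_symbol a P f x \<xi> = (\<chi> i k. exp (- \<i> * of_real (x \<bullet> \<xi>)) *
     local_rep a (P (glob_sec a (\<lambda>y. (f y * exp (\<i> * of_real (y \<bullet> \<xi>))) *s axis k 1))) x $ i)"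

text \<open>\<open>R\<close>, from sections supported in \<open>U\<close> to sections over \<open>W\<close>, is given by a smooth kernel.\<close>

definition smooth_kernel ::
  "'m::topological_space spin_mfd \<Rightarrow> (('m \<Rightarrow> complex^4) \<Rightarrow> ('m \<Rightarrow> complex^4)) \<Rightarrow>
    'm spin_frame \<Rightarrow> 'm set \<Rightarrow> 'm spin_frame \<Rightarrow> 'm set \<Rightarrow> bool" where
  "smooth_kernel X R a U b W \<longleftrightarrow>
     (\<exists>k :: real^4 \<Rightarrow> real^4 \<Rightarrow> complex^4^4.
        smooth_on ((fmap b ` W) \<times> (fmap a ` U)) (\<lambda>(x, y). k x y) \<and>
        (\<forall>s. smooth_section_c X U s \<longrightarrow> (\<forall>x\<in>fmap b ` W.
           local_rep b (R s) x = (LINT y:fmap a ` U|lborel. k x y *v local_rep a s y))))"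

definition smoothing ::
  "'m::topological_space spin_mfd \<Rightarrow> (('m \<Rightarrow> complex^4) \<Rightarrow> ('m \<Rightarrow> complex^4)) \<Rightarrow> bool" where
  "smoothing X R \<longleftrightarrow>
     (\<forall>a\<in>spin_frames X. \<forall>b\<in>spin_frames X. smooth_kernel X R a (fdom a) b (fdom b))"

definition pseudolocal ::
  "'m::topological_space spin_mfd \<Rightarrow> (('m \<Rightarrow> complex^4) \<Rightarrow> ('m \<Rightarrow> complex^4)) \<Rightarrow> bool" where
  "pseudolocal X P \<longleftrightarrow>
     (\<forall>a\<in>spin_frames X. \<forall>b\<in>spin_frames X. \<forall>U W. open U \<and> open W \<and> U \<subseteq> fdom a \<and> W \<subseteq> fdom b \<and>
        U \<inter> W = {} \<longrightarrow> smooth_kernel X P a U b W)"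

definition linear_op ::
  "'m::topological_space spin_mfd \<Rightarrow> (('m \<Rightarrow> complex^4) \<Rightarrow> ('m \<Rightarrow> complex^4)) \<Rightarrow> bool" where
  "linear_op X P \<longleftrightarrow>
     (\<forall>s t z. smooth_section_c X UNIV s \<and> smooth_section_c X UNIV t \<longrightarrow>
        P (\<lambda>q. z *s s q + t q) = (\<lambda>q. z *s P s q + P t q)) \<and>
     (\<forall>s. smooth_section_c X UNIV s \<longrightarrow> smooth_section X (P s))"

definition continuous_op ::
  "'m::topological_space spin_mfd \<Rightarrow> (('m \<Rightarrow> complex^4) \<Rightarrow> ('m \<Rightarrow> complex^4)) \<Rightarrow> bool" where
  "continuous_op X P \<longleftrightarrow>
     (\<forall>a\<in>spin_frames X. \<forall>K u. compact K \<and> K \<subseteq> fimg a \<and>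
        (\<forall>n. smooth_on UNIV (u n) \<and> (\<forall>x. x \<notin> K \<longrightarrow> u n x = 0)) \<and>
        (\<forall>vs. uniform_limit UNIV (\<lambda>n. iter_deriv vs (u n)) (\<lambda>_. 0) sequentially) \<longrightarrow>
        (\<forall>b\<in>spin_frames X. \<forall>L vs. compact L \<and> L \<subseteq> fimg b \<longrightarrow>
           uniform_limit L (\<lambda>n. iter_deriv vs (local_rep b (P (glob_sec a (u n))))) (\<lambda>_. 0)
             sequentially))"

definition pseudodifferential ::
  "'m::topological_space spin_mfd \<Rightarrow> int \<Rightarrow> (('m \<Rightarrow> complex^4) \<Rightarrow> ('m \<Rightarrow> complex^4)) \<Rightarrow> bool" where
  "pseudodifferential X m P \<longleftrightarrow> linear_op X P \<and> continuous_op X P \<and> pseudolocal X P \<and>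
     (\<forall>a\<in>spin_frames X. \<forall>f. cutoff (fimg a) f \<longrightarrow>
        (\<exists>\<sigma>. classical_symbol (fimg a) m (loc_symbol a P f) \<sigma>))"

text \<open>
  \<open>hsymbol a P l\<close> is \<open>\<sigma>\<^sub>l(P)\<close> in the coordinates and trivialisation of \<open>a\<close>. It does not depend on
  the cutoff function, and it is unique for \<open>x\<close> in the coordinate range and \<open>\<xi> \<noteq> 0\<close>.
\<close>

definition hsymbol :: "'m spin_frame \<Rightarrow> (('m \<Rightarrow> complex^4) \<Rightarrow> ('m \<Rightarrow> complex^4)) \<Rightarrow>
    int \<Rightarrow> real^4 \<Rightarrow> real^4 \<Rightarrow> complex^4^4" where
  "hsymbol a P = (SOME \<sigma>. \<forall>f W. cutoff (fimg a) f \<and> open W \<and> W \<subseteq> fimg a \<and> (\<forall>x\<in>W. f x = 1) \<longrightarrow>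
     (\<exists>m. classical_symbol W m (loc_symbol a P f) \<sigma>))"

definition parametrix ::
  "'m::topological_space spin_mfd \<Rightarrow> (('m \<Rightarrow> complex^4) \<Rightarrow> ('m \<Rightarrow> complex^4)) \<Rightarrow>
    (('m \<Rightarrow> complex^4) \<Rightarrow> ('m \<Rightarrow> complex^4)) \<Rightarrow> bool" where
  "parametrix X D P \<longleftrightarrow> pseudodifferential X (- 1) P \<and>
     smoothing X (\<lambda>s q. D (P s) q - s q) \<and> smoothing X (\<lambda>s q. P (D s) q - s q)"


section \<open>Boundary and collar\<close>

text \<open>
  The type \<^typ>\<open>'m\<close> is the extension of \<open>M\<close> across its boundary by a collar; \<open>body\<close> is \<open>M\<close>
  and \<open>\<partial>M\<close> is its frontier. \<open>(retr, height)\<close> identifies \<open>nbhd\<close> with \<open>\<partial>M \<times> (lo, hi)\<close>;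
  \<open>height\<close> is \<open>x\<^sub>n\<close>, and the part with \<open>height < 0\<close> is the collar added to \<open>M\<close>.
\<close>

record 'm collar =
  body :: "'m set"
  nbhd :: "'m set"
  retr :: "'m \<Rightarrow> 'm"
  height :: "'m \<Rightarrow> real"
  lo :: real
  hi :: real

definition bdry :: "'m::topological_space collar \<Rightarrow> 'm set" where
  "bdry B = frontier (body B)"

text \<open>Charts \<open>(x', x\<^sub>n)\<close> with \<open>x'\<close> local coordinates on \<open>\<partial>M\<close>, extended to be constant in \<open>x\<^sub>n\<close>.\<close>

definition product_chart :: "'m spin_mfd \<Rightarrow> 'm collar \<Rightarrow> 'm chart \<Rightarrow> bool" where
  "product_chart X B \<kappa> \<longleftrightarrow> \<kappa> \<in> atlas X \<and> cdom \<kappa> \<subseteq> nbhd B \<and>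
     (\<exists>y. \<forall>q\<in>cdom \<kappa>. cmap \<kappa> q = join (y (retr B q)) (height B q))"

definition tube_chart :: "'m spin_mfd \<Rightarrow> 'm collar \<Rightarrow> 'm chart \<Rightarrow> bool" where
  "tube_chart X B \<kappa> \<longleftrightarrow> product_chart X B \<kappa> \<and> cdom \<kappa> = {q \<in> nbhd B. retr B q \<in> cdom \<kappa>}"

definition manifold_with_collar ::
  "'m::{t2_space,second_countable_topology} spin_mfd \<Rightarrow> 'm collar \<Rightarrow> bool" where
  "manifold_with_collar X B \<longleftrightarrow>
     compact (body B) \<and> connected (body B) \<and>
     open (nbhd B) \<and> bdry B \<subseteq> nbhd B \<and> body B \<union> nbhd B = UNIV \<and>
     lo B < 0 \<and> 0 < hi B \<and>
     (\<exists>j. homeomorphism (nbhd B) (bdry B \<times> {lo B<..<hi B}) (\<lambda>q. (retr B q, height B q)) j) \<and>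
     (\<forall>p\<in>bdry B. retr B p = p \<and> height B p = 0) \<and>
     body B \<inter> nbhd B = {q \<in> nbhd B. height B q \<ge> 0} \<and>
     (\<forall>p\<in>bdry B. \<exists>\<kappa>. tube_chart X B \<kappa> \<and> p \<in> cdom \<kappa>)"

definition bdry_metric :: "'m spin_mfd \<Rightarrow> 'm chart \<Rightarrow> real^3 \<Rightarrow> real^3^3" where
  "bdry_metric X \<kappa> y = (\<chi> i j. metric X \<kappa> (join y 0) $ inc i $ inc j)"

text \<open>\<open>g = (1/\<phi>(x\<^sub>n)) g\<^bsup>\<partial>M\<^esup> + \<psi>(x\<^sub>n) dx\<^sub>n\<^sup>2\<close> on \<open>nbhd\<close>.\<close>

definition collar_metric ::
  "'m spin_mfd \<Rightarrow> 'm collar \<Rightarrow> (real \<Rightarrow> real) \<Rightarrow> (real \<Rightarrow> real) \<Rightarrow> bool" where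
  "collar_metric X B \<phi> \<psi> \<longleftrightarrow>
     smooth_on {lo B<..<hi B} \<phi> \<and> smooth_on {lo B<..<hi B} \<psi> \<and>
     (\<forall>t\<in>{lo B<..<hi B}. \<phi> t > 0 \<and> \<psi> t > 0) \<and> \<phi> 0 = 1 \<and> \<psi> 0 = 1 \<and>
     (\<forall>\<kappa>. product_chart X B \<kappa> \<longrightarrow> (\<forall>q\<in>cdom \<kappa>. retr B q \<in> cdom \<kappa> \<longrightarrow>
        (let x = cmap \<kappa> q; g = metric X \<kappa> x in
          (\<forall>i j. g $ inc i $ inc j = 1 / \<phi> (height B q) * bdry_metric X \<kappa> (tang x) $ i $ j) \<and>
          (\<forall>i. g $ inc i $ 4 = 0 \<and> g $ 4 $ inc i = 0) \<and>
          g $ 4 $ 4 = \<psi> (height B q))))"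

definition flat_chart :: "'m::topological_space spin_mfd \<Rightarrow> 'm collar \<Rightarrow> 'm chart \<Rightarrow> bool" where
  "flat_chart X B \<kappa> \<longleftrightarrow> product_chart X B \<kappa> \<and>
     (\<forall>p\<in>cdom \<kappa> \<inter> bdry B. bdry_metric X \<kappa> (tang (cmap \<kappa> p)) = mat 1)"

text \<open>\<open>\<partial>M\<close> is flat: locally isometric to Euclidean space.\<close>

definition flat_boundary :: "'m::topological_space spin_mfd \<Rightarrow> 'm collar \<Rightarrow> bool" where
  "flat_boundary X B \<longleftrightarrow>
     (\<forall>p\<in>bdry B. \<exists>\<kappa>. tube_chart X B \<kappa> \<and> flat_chart X B \<kappa> \<and> p \<in> cdom \<kappa>)"

text \<open>\<open>\<mu>\<close> is the Riemannian volume measure of \<open>\<partial>M\<close>.\<close>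

definition bdry_volume ::
  "'m::topological_space spin_mfd \<Rightarrow> 'm collar \<Rightarrow> 'm measure \<Rightarrow> bool" where
  "bdry_volume X B \<mu> \<longleftrightarrow>
     space \<mu> = bdry B \<and> sets \<mu> = sets (restrict_space borel (bdry B)) \<and>
     (\<forall>\<kappa> A. product_chart X B \<kappa> \<and> A \<in> sets \<mu> \<and> A \<subseteq> cdom \<kappa> \<longrightarrow>
        emeasure \<mu> A = (\<integral>\<^sup>+y. ennreal (sqrt (det (bdry_metric X \<kappa> y))) *
          indicator ((\<lambda>p. tang (cmap \<kappa> p)) ` A) y \<partial>lborel))"

definition second_fund :: "'m spin_mfd \<Rightarrow> 'm chart \<Rightarrow> real^3 \<Rightarrow> 3 \<Rightarrow> 3 \<Rightarrow> real" where
  "second_fund X \<kappa> y i j = - christoffel X \<kappa> (join y 0) 4 (inc i) (inc j)"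

text \<open>\<open>K\<close> is a function on \<open>\<partial>M\<close>: the formula has the same value in all charts around the point.\<close>

definition extrinsic_curv :: "'m spin_mfd \<Rightarrow> 'm collar \<Rightarrow> 'm \<Rightarrow> real" where
  "extrinsic_curv X B p = (THE k. \<forall>\<kappa>. product_chart X B \<kappa> \<and> p \<in> cdom \<kappa> \<longrightarrow>
     (let y = tang (cmap \<kappa> p) in
       k = (\<Sum>i\<in>UNIV. \<Sum>j\<in>UNIV. second_fund X \<kappa> y i j * matrix_inv (bdry_metric X \<kappa> y) $ i $ j)))"

definition I_Gr_b :: "'m spin_mfd \<Rightarrow> 'm collar \<Rightarrow> 'm measure \<Rightarrow> real" where
  "I_Gr_b X B \<mu> = 2 * (LINT p|\<mu>. extrinsic_curv X B p)"


section \<open>The residue forms\<close>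

definition rational_repr :: "complex poly \<Rightarrow> complex poly \<Rightarrow> (real \<Rightarrow> complex) \<Rightarrow> bool" where
  "rational_repr p q h \<longleftrightarrow> degree p < degree q \<and>
     (\<forall>x. poly q (of_real x) \<noteq> 0 \<and> h x = poly p (of_real x) / poly q (of_real x))"

definition upper_contour :: "complex poly \<Rightarrow> (real \<Rightarrow> complex) \<Rightarrow> bool" where
  "upper_contour q \<Gamma> \<longleftrightarrow> valid_path \<Gamma> \<and> pathfinish \<Gamma> = pathstart \<Gamma> \<and>
     path_image \<Gamma> \<subseteq> {z. Im z > 0} \<and>
     (\<forall>z. poly q z = 0 \<and> Im z > 0 \<longrightarrow> z \<notin> path_image \<Gamma> \<and> winding_number \<Gamma> z = 1)"

definition pi_plus :: "(real \<Rightarrow> complex) \<Rightarrow> real \<Rightarrow> complex" where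
  "pi_plus h \<xi> = (THE w. \<exists>p q \<Gamma>. rational_repr p q h \<and> upper_contour q \<Gamma> \<and>
     ((\<lambda>u. 1 / (2 * of_real pi * \<i>) * contour_integral \<Gamma>
         (\<lambda>\<eta>. (poly p \<eta> / poly q \<eta>) / (of_real \<xi> + \<i> * of_real u - \<eta>))) \<longlongrightarrow> w) (at_left 0))"

definition pi_plus_mat :: "(real \<Rightarrow> complex^4^4) \<Rightarrow> real \<Rightarrow> complex^4^4" where
  "pi_plus_mat h \<xi> = (\<chi> i j. pi_plus (\<lambda>\<eta>. h \<eta> $ i $ j) \<xi>)"

definition vderiv :: "(real \<Rightarrow> 'b::real_normed_vector) \<Rightarrow> real \<Rightarrow> 'b" where
  "vderiv f t = vector_derivative f (at t)"

text \<open>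
  Canonical measure on the unit sphere: the measure of a set is \<open>DIM('a)\<close> times the volume of the
  cone over it in the unit ball.
\<close>

definition sphere_measure :: "'a::euclidean_space measure" where
  "sphere_measure = distr (density lborel (\<lambda>x. of_nat DIM('a) * indicator (ball 0 1) x)) borel
     (\<lambda>x. x /\<^sub>R norm x)"

text \<open>
  Densities of the residue forms with respect to \<open>dx'\<close> at the boundary point with coordinates
  \<open>x\<close>, where \<open>x $ 4 = 0\<close>.
\<close>

definition res11_density :: "'m spin_frame \<Rightarrow> (('m \<Rightarrow> complex^4) \<Rightarrow> ('m \<Rightarrow> complex^4)) \<Rightarrow>
    (('m \<Rightarrow> complex^4) \<Rightarrow> ('m \<Rightarrow> complex^4)) \<Rightarrow> real^4 \<Rightarrow> complex" where
  "res11_density a P P' x = - (1 / 2) * (LINT \<xi>'|sphere_measure. LINT t|lborel.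
     trace (vderiv (\<lambda>r. pi_plus_mat (\<lambda>\<eta>. hsymbol a P (- 1) (x + r *\<^sub>R axis 4 1) (join \<xi>' \<eta>)) t) 0 **
            vderiv (vderiv (\<lambda>\<eta>. hsymbol a P' (- 1) x (join \<xi>' \<eta>))) t))"

definition res21_density :: "'m spin_frame \<Rightarrow> (('m \<Rightarrow> complex^4) \<Rightarrow> ('m \<Rightarrow> complex^4)) \<Rightarrow>
    (('m \<Rightarrow> complex^4) \<Rightarrow> ('m \<Rightarrow> complex^4)) \<Rightarrow> real^4 \<Rightarrow> complex" where
  "res21_density a P P' x = - \<i> * (LINT \<xi>'|sphere_measure. LINT t|lborel.
     trace (pi_plus_mat (\<lambda>\<eta>. hsymbol a P (- 2) x (join \<xi>' \<eta>)) t **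
            vderiv (\<lambda>\<eta>. hsymbol a P' (- 1) x (join \<xi>' \<eta>)) t))"

text \<open>
  The local data in which the residue forms are computed: coordinates in which \<open>dx\<^sub>1, dx\<^sub>2, dx\<^sub>3\<close> are
  oriented orthonormal on \<open>\<partial>M\<close>, and the spinor trivialisation coming from the normalised coordinate
  frame \<open>e\<^sub>i = g\<^sub>i\<^sub>i\<^bsup>-1/2\<^esup> \<partial>\<^sub>i\<close> (so that \<open>c(e\<^sub>i)\<close> is constant). The orientation of \<open>\<partial>M\<close> is the one
  for which \<open>(x', x\<^sub>n)\<close> is oriented on \<open>M\<close>.
\<close>

definition flat_frame :: "'m::topological_space spin_mfd \<Rightarrow> 'm collar \<Rightarrow> 'm spin_frame \<Rightarrow> bool" where
  "flat_frame X B a \<longleftrightarrow> a \<in> spin_frames X \<and> flat_chart X B (fchart a) \<and>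
     (\<forall>x\<in>fimg a. frame a x =
        (\<chi> i j. if i = j then 1 / sqrt (metric X (fchart a) x $ i $ i) else 0))"

text \<open>
  The residue forms as functions on \<open>\<partial>M\<close>: the coefficient of \<open>dx' = dvol\<^bsub>\<partial>M\<^esub>\<close>, which is the same
  for all admissible local data.
\<close>

definition res11 :: "'m::topological_space spin_mfd \<Rightarrow> 'm collar \<Rightarrow>
    (('m \<Rightarrow> complex^4) \<Rightarrow> ('m \<Rightarrow> complex^4)) \<Rightarrow>
    (('m \<Rightarrow> complex^4) \<Rightarrow> ('m \<Rightarrow> complex^4)) \<Rightarrow> 'm \<Rightarrow> complex" where
  "res11 X B P P' p =
     (THE w. \<forall>a. flat_frame X B a \<and> p \<in> fdom a \<longrightarrow> w = res11_density a P P' (fmap a p))"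

definition res21 :: "'m::topological_space spin_mfd \<Rightarrow> 'm collar \<Rightarrow>
    (('m \<Rightarrow> complex^4) \<Rightarrow> ('m \<Rightarrow> complex^4)) \<Rightarrow>
    (('m \<Rightarrow> complex^4) \<Rightarrow> ('m \<Rightarrow> complex^4)) \<Rightarrow> 'm \<Rightarrow> complex" where
  "res21 X B P P' p =
     (THE w. \<forall>a. flat_frame X B a \<and> p \<in> fdom a \<longrightarrow> w = res21_density a P P' (fmap a p))"

definition Omega :: "nat \<Rightarrow> real" where
  "Omega n = 2 * pi powr (real n / 2) / Gamma (real n / 2)"

end

theory Submission
  imports Defs
begin

text \<open>
  Let \<open>p\<close> be the symbol of \<open>D\<^sup>-\<^sup>1\<close> cut off by \<open>f\<close> in a spin frame. Since \<open>D\<close> acts on the left,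
  \<open>D D\<^sup>-\<^sup>1 = 1 + R\<close> with \<open>R\<close> smoothing gives, where \<open>f = 1\<close>, the exact equation
  \<open>\<i> A(x,\<xi>) p + L p = 1 + r(x,\<xi>)\<close> with \<open>A\<close> the principal part of \<open>D\<close>, \<open>L\<close> the operator \<open>D\<close> itself
  acting in \<open>x\<close>, and \<open>r\<close> rapidly decreasing in \<open>\<xi>\<close> because it is a Fourier integral of a smooth kernel.
  Comparing powers along rays yields \<open>\<i> A \<sigma>\<^bsub>l-1\<^esub> + L \<sigma>\<^sub>l = \<delta>\<^bsub>l0\<^esub>\<close>, which determines all \<open>\<sigma>\<^sub>l\<close>.

  In a flat frame the metric near \<open>\<partial>M\<close> is \<open>diag(1/\<phi>, 1/\<phi>, 1/\<phi>, \<psi>)\<close>. With \<open>a = \<phi>'(0) = \<psi>'(0)\<close> the zeroth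
  order part of \<open>D\<close> on \<open>\<partial>M\<close> is \<open>- (3/4) a c(dx\<^sub>n)\<close>, and the integrals over \<open>\<xi>\<^sub>n\<close> reduce by partial fractions
  to \<open>\<integral> d\<xi>\<^sub>n / (\<xi>\<^sub>n\<^sup>2 + |\<xi>'|\<^sup>2)\<close>. The residue forms are the constant multiples \<open>- (\<pi>/2) a \<Omega>\<^sub>3\<close> and \<open>\<pi> a \<Omega>\<^sub>3\<close>
  of the volume form, while \<open>K = - (3/2) a\<close>.
\<close>

section \<open>Calculus of \<open>C\<^sup>k\<close> functions\<close>

text \<open>The definitions choose: \<open>hsymbol\<close> by \<open>SOME\<close>; \<pi>+, K and the
  residue forms by \<open>THE\<close>. So every value needs an existence as well as a uniqueness
  argument. A formula for the symbol is needed on a whole neighbourhood of a boundary point, because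
  each step of the recursion differentiates in x. With D on the left this stays elementary: D is a
  differential operator, its action on e^(i<x,\<xi>>) p is the product rule, and no composition
  formula for pseudodifferential operators enters. Uniqueness also settles existence: for each
  cutoff some expansion exists by assumption, and it must be the solution of the recursion, in which
  the cutoff does not occur. The condition \<phi>'(0) = \<psi>'(0) leaves one parameter: the
  amplitude of \<sigma>_(-1) changes at the rate \<psi>'(0)/2, its poles at the relative rate
  (\<phi>'(0) + \<psi>'(0))/2, and the zeroth order term of D sees \<phi>'(0).\<close>

declare Ck_on.simps(2) [simp del]

lemma Ck_on_Suc_derivative: "Ck_on (Suc k) S f \<Longrightarrow> Ck_on k S (\<lambda>x. frechet_derivative f (at x) v)"
  by (simp add: Ck_on.simps(2))

lemma Ck_on_has_derivative:
  "Ck_on (Suc k) S f \<Longrightarrow> x \<in> S \<Longrightarrow> (f has_derivative frechet_derivative f (at x)) (at x)"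
  by (simp add: Ck_on.simps(2) frechet_derivative_works)

text \<open>\<open>frechet_derivative\<close> is chosen from the maps related to f by
  \<open>has_derivative\<close>. On an open set the two relations coincide, so the choices coincide,
  even at points where neither function is differentiable.\<close>

lemma frechet_derivative_cong:
  assumes "open S" "x \<in> S" "\<And>y. y \<in> S \<Longrightarrow> f y = g y"
  shows "frechet_derivative f (at x) = frechet_derivative g (at x)"
    and "f differentiable (at x) \<longleftrightarrow> g differentiable (at x)"
proof -
  have "(f has_derivative D) (at x) = (g has_derivative D) (at x)" for D
    using assms by (metis has_derivative_transform_within_open)
  then show "frechet_derivative f (at x) = frechet_derivative g (at x)"
    and "f differentiable (at x) \<longleftrightarrow> g differentiable (at x)"
    by (auto simp: frechet_derivative_def differentiable_def)
qed

lemma Ck_on_cong: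
  assumes "open S" "\<And>x. x \<in> S \<Longrightarrow> f x = g x"
  shows "Ck_on k S f \<longleftrightarrow> Ck_on k S g"
  using assms(2)
proof (induction k arbitrary: f g)
  case 0
  then show ?case by (simp cong: continuous_on_cong)
next
  case (Suc k)
  have "Ck_on k S (\<lambda>x. frechet_derivative f (at x) v) \<longleftrightarrow>
        Ck_on k S (\<lambda>x. frechet_derivative g (at x) v)" for v
    by (rule Suc.IH) (simp add: frechet_derivative_cong(1)[OF assms(1) _ Suc.prems])
  moreover have "f differentiable (at x) \<longleftrightarrow> g differentiable (at x)" if "x \<in> S" for x
    by (rule frechet_derivative_cong(2)[OF assms(1) that Suc.prems])
  ultimately show ?case by (simp add: Ck_on.simps(2))
qed

lemma Ck_on_subset: "Ck_on k S f \<Longrightarrow> T \<subseteq> S \<Longrightarrow> Ck_on k T f"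
  by (induction k arbitrary: f) (auto simp: Ck_on.simps(2) intro: continuous_on_subset)

lemma Ck_on_imp_continuous_on: "Ck_on k S f \<Longrightarrow> continuous_on S f"
  by (cases k)
    (auto simp: Ck_on.simps(2) continuous_at_imp_continuous_on differentiable_imp_continuous_within)

lemma Ck_on_lower: "Ck_on (Suc k) S f \<Longrightarrow> Ck_on k S f"
proof (induction k arbitrary: f)
  case 0
  then show ?case using Ck_on_imp_continuous_on by auto
qed (simp add: Ck_on.simps(2))

text \<open>The working introduction rule: a derivative in closed form may replace the chosen
  \<open>frechet_derivative\<close>, since the two agree on the open set S.\<close>

lemma Ck_on_SucI:
  assumes "open S" "\<And>x. x \<in> S \<Longrightarrow> (f has_derivative f' x) (at x)"
    and "\<And>v. Ck_on k S (\<lambda>x. f' x v)"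
  shows "Ck_on (Suc k) S f"
proof -
  have "frechet_derivative f (at x) = f' x" if "x \<in> S" for x
    using assms(2)[OF that] frechet_derivative_at by metis
  then have "Ck_on k S (\<lambda>x. frechet_derivative f (at x) v)" for v
    using assms(3)[of v]
    by (subst Ck_on_cong[OF assms(1), of _ "\<lambda>x. f' x v"]) simp_all
  then show ?thesis using assms(2) by (auto simp: Ck_on.simps(2) differentiable_def)
qed

lemma Ck_on_const: "Ck_on k S (\<lambda>x. c)"
  by (induction k arbitrary: c) (simp_all add: Ck_on.simps(2))

lemma Ck_on_add:
  assumes "open S" "Ck_on k S f" "Ck_on k S g"
  shows "Ck_on k S (\<lambda>x. f x + g x)"
  using assms(2,3)
proof (induction k arbitrary: f g)
  case 0
  then show ?case by (simp add: continuous_on_add)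
next
  case (Suc k)
  show ?case
    by (rule Ck_on_SucI[OF assms(1), where f' = "\<lambda>x v. frechet_derivative f (at x) v +
          frechet_derivative g (at x) v"])
      (use Suc in \<open>auto intro!: has_derivative_add Ck_on_has_derivative Ck_on_Suc_derivative\<close>)
qed

lemma Ck_on_sum:
  assumes "open S" "\<And>i. i \<in> I \<Longrightarrow> Ck_on k S (f i)"
  shows "Ck_on k S (\<lambda>x. \<Sum>i\<in>I. f i x)"
proof (cases "finite I")
  case True
  then show ?thesis using assms(2)
    by (induction I) (auto simp: Ck_on_const intro!: Ck_on_add assms(1))
qed (simp add: Ck_on_const)

lemma (in bounded_linear) Ck_on_bounded_linear:
  assumes "open S" "Ck_on k S g"
  shows "Ck_on k S (\<lambda>x. f (g x))"
  using assms(2)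
proof (induction k arbitrary: g)
  case 0
  then show ?case by (simp add: continuous_on)
next
  case (Suc k)
  show ?case
    by (rule Ck_on_SucI[OF assms(1), where f' = "\<lambda>x v. f (frechet_derivative g (at x) v)"])
      (use Suc in \<open>auto intro!: has_derivative Ck_on_has_derivative Ck_on_Suc_derivative\<close>)
qed

text \<open>The induction generalises over both factors: the product rule yields two products, in
  each of which one factor is differentiated and the other is lowered by
  \<open>Ck_on_lower\<close>.\<close>

lemma (in bounded_bilinear) Ck_on_bilinear:
  assumes "open S" "Ck_on k S f" "Ck_on k S g"
  shows "Ck_on k S (\<lambda>x. prod (f x) (g x))"
  using assms(2,3)
proof (induction k arbitrary: f g)
  case 0
  then show ?case by (simp add: continuous_on)
next
  case (Suc k)
  show ?case
  proof (rule Ck_on_SucI[OF assms(1), where f' = "\<lambda>x v. prod (f x) (frechet_derivative g (at x) v)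
          + prod (frechet_derivative f (at x) v) (g x)"])
    show "((\<lambda>x. prod (f x) (g x)) has_derivative (\<lambda>v. prod (f x) (frechet_derivative g (at x) v)
          + prod (frechet_derivative f (at x) v) (g x))) (at x)" if "x \<in> S" for x
      using Suc.prems that by (intro FDERIV Ck_on_has_derivative)
    show "Ck_on k S (\<lambda>x. prod (f x) (frechet_derivative g (at x) v)
          + prod (frechet_derivative f (at x) v) (g x))" for v
      by (intro Ck_on_add assms(1) Suc.IH) (use Suc.prems in \<open>auto intro: Ck_on_lower Ck_on_Suc_derivative\<close>)
  qed
qed

lemma Ck_on_compose:
  fixes g :: "'b::euclidean_space \<Rightarrow> 'c::real_normed_vector"
  assumes "open S" "open T" "f ` S \<subseteq> T" "Ck_on k S f" "Ck_on k T g"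
  shows "Ck_on k S (\<lambda>x. g (f x))"
  using assms(4,5)
proof (induction k arbitrary: g)
  case 0
  then show ?case using assms(3) by (auto intro: continuous_on_compose2)
next
  case (Suc k)
  \<comment> \<open>\<open>Ck_on\<close> speaks of derivatives of g in fixed directions, whereas the
    chain rule differentiates g in the direction D f(x) v, which varies with x. Expanding that
    direction in the basis leaves fixed directions with variable coefficients.\<close>
  let ?D = "\<lambda>x v. \<Sum>b\<in>Basis. (frechet_derivative f (at x) v \<bullet> b) *\<^sub>R frechet_derivative g (at (f x)) b"
  show ?case
  proof (rule Ck_on_SucI[OF assms(1), where f' = ?D])
    fix x assume x: "x \<in> S"
    then have g: "(g has_derivative frechet_derivative g (at (f x))) (at (f x))"
      and f: "(f has_derivative frechet_derivative f (at x)) (at x)"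
      using Suc.prems assms(3) by (auto intro!: Ck_on_has_derivative)
    interpret G: bounded_linear "frechet_derivative g (at (f x))"
      using g has_derivative_bounded_linear by blast
    have "frechet_derivative g (at (f x)) (frechet_derivative f (at x) v) = ?D x v" for v
      by (subst (1) euclidean_representation[symmetric]) (simp add: G.sum G.scaleR)
    then show "((\<lambda>x. g (f x)) has_derivative ?D x) (at x)"
      using has_derivative_compose[OF f g] by simp
  next
    fix v
    have f: "Ck_on k S f" using Suc.prems(1) Ck_on_lower by blast
    show "Ck_on k S (\<lambda>x. ?D x v)"
      by (intro Ck_on_sum assms(1) bounded_bilinear.Ck_on_bilinear[OF bounded_bilinear_scaleR]
          bounded_linear.Ck_on_bounded_linear[OF bounded_linear_inner_left] Suc.IH f)
        (use Suc.prems in \<open>auto intro: Ck_on_Suc_derivative\<close>)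
  qed
qed

lemma Ck_on_local:
  assumes "\<And>x. x \<in> S \<Longrightarrow> \<exists>T. open T \<and> x \<in> T \<and> Ck_on k T f"
  shows "Ck_on k S f"
  using assms
proof (induction k arbitrary: f)
  case 0
  then show ?case
    by (metis Ck_on.simps(1) continuous_at_imp_continuous_on continuous_on_eq_continuous_at)
next
  case (Suc k)
  show ?case
    unfolding Ck_on.simps(2)
  proof (intro conjI ballI allI)
    show "f differentiable (at x)" if "x \<in> S" for x
      using Suc.prems[OF that] by (auto simp: Ck_on.simps(2))
    show "Ck_on k S (\<lambda>x. frechet_derivative f (at x) v)" for v
    proof (rule Suc.IH)
      show "\<exists>T. open T \<and> x \<in> T \<and> Ck_on k T (\<lambda>x. frechet_derivative f (at x) v)" if "x \<in> S" for x
        using Suc.prems[OF that] Ck_on_Suc_derivative by metis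
    qed
  qed
qed

lemma Ck_on_real_derivative:
  assumes "open S" "\<And>x. x \<in> S \<Longrightarrow> (f has_real_derivative f' x) (at x)" "Ck_on k S f'"
  shows "Ck_on (Suc k) S f"
proof (rule Ck_on_SucI[OF assms(1), where f' = "\<lambda>x v. f' x * v"])
  show "(f has_derivative (\<lambda>v. f' x * v)) (at x)" if "x \<in> S" for x
    using assms(2)[OF that] by (simp add: has_field_derivative_def)
  show "Ck_on k S (\<lambda>x. f' x * v)" for v
    by (intro bounded_linear.Ck_on_bounded_linear[OF bounded_linear_mult_left] assms)
qed

lemma iter_deriv_cong:
  assumes "open S" "x \<in> S" "\<And>x. x \<in> S \<Longrightarrow> f x = g x"
  shows "iter_deriv vs f x = iter_deriv vs g x"
  using assms(2,3)
proof (induction vs arbitrary: f g x)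
  case (Cons v vs)
  show ?case
    by (simp, rule Cons.IH)
      (use Cons.prems frechet_derivative_cong(1)[OF assms(1), of _ f g] in auto)
qed simp

section \<open>Smooth maps: closure properties inherited from every finite order\<close>

lemma smooth_on_cong: "open S \<Longrightarrow> (\<And>x. x \<in> S \<Longrightarrow> f x = g x) \<Longrightarrow> smooth_on S f \<longleftrightarrow> smooth_on S g"
  unfolding smooth_on_def using Ck_on_cong[of S f g] by blast

lemma smooth_on_subset: "smooth_on S f \<Longrightarrow> T \<subseteq> S \<Longrightarrow> smooth_on T f"
  unfolding smooth_on_def using Ck_on_subset by metis

lemma smooth_on_const: "smooth_on S (\<lambda>x. c)"
  by (simp add: smooth_on_def Ck_on_const)

lemma smooth_on_add:
  "open S \<Longrightarrow> smooth_on S f \<Longrightarrow> smooth_on S g \<Longrightarrow> smooth_on S (\<lambda>x. f x + g x)"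
  by (simp add: smooth_on_def Ck_on_add)

lemma smooth_on_sum:
  "open S \<Longrightarrow> (\<And>i. i \<in> I \<Longrightarrow> smooth_on S (f i)) \<Longrightarrow> smooth_on S (\<lambda>x. \<Sum>i\<in>I. f i x)"
  by (simp add: smooth_on_def Ck_on_sum)

lemma (in bounded_linear) smooth_on_bounded_linear:
  "open S \<Longrightarrow> smooth_on S g \<Longrightarrow> smooth_on S (\<lambda>x. f (g x))"
  by (simp add: smooth_on_def Ck_on_bounded_linear)

lemma (in bounded_bilinear) smooth_on_bilinear:
  "open S \<Longrightarrow> smooth_on S f \<Longrightarrow> smooth_on S g \<Longrightarrow> smooth_on S (\<lambda>x. prod (f x) (g x))"
  by (simp add: smooth_on_def Ck_on_bilinear)

lemma smooth_on_compose:
  fixes g :: "'b::euclidean_space \<Rightarrow> 'c::real_normed_vector"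
  assumes "open S" "open T" "f ` S \<subseteq> T" "smooth_on S f" "smooth_on T g"
  shows "smooth_on S (\<lambda>x. g (f x))"
  using assms by (auto simp: smooth_on_def intro: Ck_on_compose[where T = T])

lemma smooth_on_local:
  assumes "\<And>x. x \<in> S \<Longrightarrow> \<exists>T. open T \<and> x \<in> T \<and> smooth_on T f"
  shows "smooth_on S f"
  unfolding smooth_on_def
proof
  show "Ck_on k S f" for k
    by (rule Ck_on_local) (use assms in \<open>auto simp: smooth_on_def\<close>)
qed

lemma smooth_on_id: "open S \<Longrightarrow> smooth_on S (\<lambda>x. x)"
  unfolding smooth_on_def
proof
  fix k assume S: "open S"
  show "Ck_on k S (\<lambda>x. x)"
    by (cases k) (auto intro!: Ck_on_SucI[OF S, where f' = "\<lambda>x v. v"] Ck_on_const)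
qed

lemma smooth_on_differentiable: "smooth_on S f \<Longrightarrow> x \<in> S \<Longrightarrow> f differentiable (at x)"
  unfolding smooth_on_def by (metis Ck_on.simps(2))

lemma smooth_on_continuous_on: "smooth_on S f \<Longrightarrow> continuous_on S f"
  using Ck_on_imp_continuous_on unfolding smooth_on_def by blast

lemma smooth_on_frechet_derivative:
  "smooth_on S f \<Longrightarrow> smooth_on S (\<lambda>x. frechet_derivative f (at x) v)"
  unfolding smooth_on_def using Ck_on.simps(2) by blast

section \<open>Explicit smooth functions: powers and oscillating exponentials\<close>

lemma smooth_on_powr: "smooth_on {0<..} (\<lambda>t::real. t powr s)"
proof -
  \<comment> \<open>The factor c keeps the family closed under differentiation, as the induction
    requires.\<close>
  have "Ck_on k {0<..} (\<lambda>t::real. c * t powr s)" for k c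
  proof (induction k arbitrary: c s)
    case 0
    then show ?case by (auto intro!: continuous_intros)
  next
    case (Suc k)
    show ?case
      by (rule Ck_on_real_derivative[where f' = "\<lambda>t. (c * s) * t powr (s - 1)"])
        (auto intro!: derivative_eq_intros Suc)
  qed
  from this[of _ 1] show ?thesis by (simp add: smooth_on_def)
qed

lemma has_derivative_cis:
  "((\<lambda>y::'a::euclidean_space. exp (\<i> * of_real (y \<bullet> \<xi>))) has_derivative
    (\<lambda>v. \<i> * of_real (v \<bullet> \<xi>) * exp (\<i> * of_real (y \<bullet> \<xi>)))) (at y)"
proof -
  have 1: "((\<lambda>y. \<i> * of_real (y \<bullet> \<xi>)) has_derivative (\<lambda>v. \<i> * of_real (v \<bullet> \<xi>))) (at y)"
    by (auto intro!: derivative_eq_intros)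
  have 2: "(exp has_derivative (\<lambda>h. exp w * h)) (at w)" for w :: complex
    using DERIV_exp[of w] by (simp add: has_field_derivative_def)
  show ?thesis using has_derivative_compose[OF 1 2] by (simp add: mult_ac)
qed

lemma smooth_on_cis: "smooth_on UNIV (\<lambda>y::'a::euclidean_space. exp (\<i> * of_real (y \<bullet> \<xi>)))"
proof -
  have "Ck_on k UNIV (\<lambda>y::'a. c * exp (\<i> * of_real (y \<bullet> \<xi>)))" for k c
  proof (induction k arbitrary: c)
    case 0
    then show ?case by (auto intro!: continuous_intros)
  next
    case (Suc k)
    show ?case
    proof (rule Ck_on_SucI[where f' = "\<lambda>y v. (c * \<i> * of_real (v \<bullet> \<xi>)) * exp (\<i> * of_real (y \<bullet> \<xi>))"])
      show "((\<lambda>y. c * exp (\<i> * of_real (y \<bullet> \<xi>))) has_derivative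
          (\<lambda>v. (c * \<i> * of_real (v \<bullet> \<xi>)) * exp (\<i> * of_real (y \<bullet> \<xi>)))) (at y)" for y
        using has_derivative_mult_right[OF has_derivative_cis, of c] by (simp add: mult_ac)
    qed (auto simp: Suc)
  qed
  from this[of _ 1] show ?thesis by (simp add: smooth_on_def)
qed

section \<open>Smooth cutoff functions\<close>

text \<open>The functions p(1/t) exp(-1/t), extended by 0 to t \<le> 0. They form a family closed
  under differentiation, which contains the standard function flat at 0 as
  \<open>flat_poly 1\<close>.\<close>

definition flat_poly :: "real poly \<Rightarrow> real \<Rightarrow> real" where
  "flat_poly p t = (if t > 0 then poly p (1 / t) * exp (- (1 / t)) else 0)"

lemma flat_poly_tendsto_0: "((\<lambda>t. poly p (1 / t) * exp (- (1 / t))) \<longlongrightarrow> 0) (at_right (0::real))"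
proof -
  have "((\<lambda>t. poly p t * exp (- t)) \<longlongrightarrow> 0) at_top"
  proof (induction p)
    case (pCons c p)
    have pw: "((\<lambda>t::real. t ^ n * exp (- t)) \<longlongrightarrow> 0) at_top" for n
      using tendsto_power_div_exp_0[of n] by (simp add: exp_minus divide_inverse)
    have *: "((\<lambda>t. coeff p i * (t ^ Suc i * exp (- t))) \<longlongrightarrow> 0) at_top" for i
      using tendsto_mult[OF tendsto_const pw[of "Suc i"], of "coeff p i"] by simp
    have "((\<lambda>t. c * (t ^ 0 * exp (- t)) + (\<Sum>i\<le>degree p. coeff p i * (t ^ Suc i * exp (- t)))) \<longlongrightarrow>
        c * 0 + (\<Sum>i\<le>degree p. 0)) at_top"
      by (intro tendsto_add tendsto_sum tendsto_mult tendsto_const pw *)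
    moreover have "poly (pCons c p) t * exp (- t) =
        c * (t ^ 0 * exp (- t)) + (\<Sum>i\<le>degree p. coeff p i * (t ^ Suc i * exp (- t)))" for t
      by (simp add: poly_altdef[of p] sum_distrib_left sum_distrib_right algebra_simps)
    ultimately show ?case by simp
  qed simp
  from filterlim_compose[OF this filterlim_inverse_at_top_right]
  show ?thesis by (simp add: divide_inverse)
qed

text \<open>For t > 0 the derivative of p(1/t) exp(-1/t) is (p - p')(1/t) exp(-1/t) / t^2, again of
  the same kind; only t = 0 needs a limit.\<close>

lemma flat_poly_has_derivative:
  "(flat_poly p has_real_derivative flat_poly (monom 1 2 * (p - pderiv p)) t) (at t)"
proof -
  consider "t > 0" | "t < 0" | "t = 0" by linarith
  then show ?thesis
  proof cases
    case 1
    have "((\<lambda>t. poly p (1 / t) * exp (- (1 / t))) has_real_derivative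
        flat_poly (monom 1 2 * (p - pderiv p)) t) (at t)"
      using 1 by (auto intro!: derivative_eq_intros simp: flat_poly_def poly_monom power2_eq_square
          field_simps)
    then show ?thesis
      by (rule has_field_derivative_transform_within_open[of _ _ _ "{0<..}"])
        (use 1 in \<open>auto simp: flat_poly_def\<close>)
  next
    case 2
    have "((\<lambda>t. 0) has_real_derivative 0) (at t)" by simp
    then show ?thesis using 2
      by (intro has_field_derivative_transform_within_open[of "\<lambda>t. 0" _ t "{..<0}" "flat_poly p"])
        (auto simp: flat_poly_def)
  next
    case 3
    have "((\<lambda>h. flat_poly p h / h) \<longlongrightarrow> 0) (at 0)"
    proof -
      \<comment> \<open>Division by h multiplies the polynomial in 1/h by its variable, so the
        difference quotient at 0 is covered by \<open>flat_poly_tendsto_0\<close> for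
        \<open>pCons 0 p\<close>.\<close>
      have "((\<lambda>t. poly (pCons 0 p) (1 / t) * exp (- (1 / t))) \<longlongrightarrow> 0) (at_right (0::real))"
        by (rule flat_poly_tendsto_0)
      then have "((\<lambda>h. flat_poly p h / h) \<longlongrightarrow> 0) (at_right 0)"
        by (rule Lim_transform_eventually)
          (auto simp: flat_poly_def eventually_at_filter)
      moreover have "((\<lambda>h. flat_poly p h / h) \<longlongrightarrow> 0) (at_left 0)"
        by (rule Lim_transform_eventually[OF tendsto_const])
          (auto simp: flat_poly_def eventually_at_filter)
      ultimately show ?thesis by (simp add: filterlim_split_at)
    qed
    then show ?thesis using 3 by (simp add: has_field_derivative_iff flat_poly_def)
  qed
qed

lemma smooth_on_flat_poly: "smooth_on UNIV (flat_poly p)"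
proof -
  have "Ck_on k UNIV (flat_poly p)" for k
  proof (induction k arbitrary: p)
    case 0
    show ?case
      using flat_poly_has_derivative by (auto intro!: DERIV_continuous_on)
  next
    case (Suc k)
    show ?case
      by (rule Ck_on_real_derivative[OF open_UNIV flat_poly_has_derivative Suc])
  qed
  then show ?thesis by (simp add: smooth_on_def)
qed

text \<open>The usual quotient h(d - s) / (h(d - s) + h(s - d/2)), where s is the squared distance
  to x0 and h = \<open>flat_poly 1\<close>: it is 1 where s < d/2, because the second summand
  vanishes there, and 0 where s \<ge> d.\<close>

lemma cutoff_exists:
  assumes "open V" "x0 \<in> V"
  obtains f W where "cutoff V f" "open W" "x0 \<in> W" "W \<subseteq> V" "\<forall>x\<in>W. f x = 1"
proof -
  obtain e where e: "e > 0" "cball x0 e \<subseteq> V"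
    using assms open_contains_cball by blast
  define s where "s x = (x - x0) \<bullet> (x - x0)" for x
  define h where "h = flat_poly 1"
  have h_pos: "h t > 0 \<longleftrightarrow> t > 0" and h0: "h t \<ge> 0" and h_zero: "h t = 0 \<longleftrightarrow> t \<le> 0" for t
    by (auto simp: h_def flat_poly_def)
  define d where "d = e\<^sup>2"
  have d: "d > 0" using e by (simp add: d_def)
  \<comment> \<open>\<open>powr (- 1)\<close> in place of a division makes smoothness a case of
    \<open>smooth_on_powr\<close>; the base is positive by \<open>den\<close>.\<close>
  define f where "f x = complex_of_real (h (d - s x) * (h (d - s x) + h (s x - d / 2)) powr (- 1))" for x
  have den: "h (d - s x) + h (s x - d / 2) > 0" for x
    using h_pos[of "d - s x"] h_pos[of "s x - d / 2"] h0[of "d - s x"] h0[of "s x - d / 2"] d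
    by (cases "s x < d") (auto intro: add_pos_nonneg add_nonneg_pos)
  have s: "smooth_on UNIV s"
    unfolding s_def diff_conv_add_uminus
    by (intro bounded_bilinear.smooth_on_bilinear[OF bounded_bilinear_inner] smooth_on_add
        smooth_on_id smooth_on_const open_UNIV)
  have hs: "smooth_on UNIV (\<lambda>x. h (d - s x))"
  proof -
    have "smooth_on UNIV (\<lambda>x. d + (- 1) * s x)"
      by (intro smooth_on_add smooth_on_const open_UNIV s
          bounded_linear.smooth_on_bounded_linear[OF bounded_linear_mult_right])
    then have "smooth_on UNIV (\<lambda>x. d - s x)" by simp
    then show ?thesis unfolding h_def
      by (intro smooth_on_compose[OF open_UNIV open_UNIV _ _ smooth_on_flat_poly]) auto
  qed
  have hs': "smooth_on UNIV (\<lambda>x. h (s x - d / 2))"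
    unfolding h_def diff_conv_add_uminus
    by (intro smooth_on_compose[OF open_UNIV open_UNIV _ _ smooth_on_flat_poly] smooth_on_add
        smooth_on_const open_UNIV s) auto
  have "smooth_on UNIV (\<lambda>x. (h (d - s x) + h (s x - d / 2)) powr (- 1))"
    by (rule smooth_on_compose[OF open_UNIV _ _ _ smooth_on_powr])
      (use den in \<open>auto intro!: smooth_on_add hs hs'\<close>)
  then have f: "smooth_on UNIV f"
    unfolding f_def
    by (intro bounded_linear.smooth_on_bounded_linear[OF bounded_linear_of_real] open_UNIV
        bounded_bilinear.smooth_on_bilinear[OF bounded_bilinear_mult] hs)
  have sd: "s x = (dist x0 x)\<^sup>2" for x
    by (simp add: s_def dist_norm power2_norm_eq_inner[symmetric] norm_minus_commute)
  have "f x = 0" if "x \<notin> cball x0 e" for x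
  proof -
    have "d \<le> s x" using that e by (simp add: sd d_def power_mono)
    then show ?thesis using h_zero[of "d - s x"] by (simp add: f_def)
  qed
  then have c1: "cutoff V f" 
    unfolding cutoff_def by (intro conjI f exI[of _ "cball x0 e"] compact_cball e allI impI) simp
  have c2: "f x = 1" if "s x < d / 2" for x
  proof -
    have "h (s x - d / 2) = 0" using that h_zero by simp
    then show ?thesis using den[of x] by (simp add: f_def powr_minus)
  qed
  have c3: "open {x. s x < d / 2}"
    using smooth_on_continuous_on[OF s] by (intro open_Collect_less continuous_intros) auto
  have c4: "{x. s x < d / 2} \<subseteq> cball x0 e"
  proof
    fix x assume "x \<in> {x. s x < d / 2}"
    then have "(dist x0 x)\<^sup>2 < d / 2" by (simp add: sd)
    then have "(dist x0 x)\<^sup>2 \<le> e\<^sup>2" using d unfolding d_def by linarith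
    then have "dist x0 x \<le> e" by (rule power2_le_imp_le) (use e in simp)
    then show "x \<in> cball x0 e" by simp
  qed
  have c5: "x0 \<in> {x. s x < d / 2}" using d by (simp add: s_def)
  show ?thesis
    by (rule that[OF c1 c3 c5 order_trans[OF c4 e(2)]]) (simp add: c2)
qed

section \<open>Rapid decay of Fourier integrals\<close>

lemma frechet_derivative_outside_support:
  assumes "closed K" "\<And>x. x \<notin> K \<Longrightarrow> g x = 0" "x \<notin> K"
  shows "frechet_derivative g (at x) v = 0"
  using frechet_derivative_cong(1)[of "- K" x g "\<lambda>_. 0"] assms by (simp add: open_Compl)

lemma integrable_compact_support:
  fixes g :: "'a::euclidean_space \<Rightarrow> 'b::{banach, second_countable_topology}"
  assumes "continuous_on UNIV g" "compact K" "\<And>x. x \<notin> K \<Longrightarrow> g x = 0"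
  shows "integrable lborel g"
proof -
  have "integrable lborel (\<lambda>x. indicator K x *\<^sub>R g x)"
    using assms by (intro borel_integrable_compact) (auto intro: continuous_on_subset)
  moreover have "(\<lambda>x. indicator K x *\<^sub>R g x) = g"
    using assms(3) by (auto simp: fun_eq_iff indicator_def)
  ultimately show ?thesis by simp
qed

lemma bounded_compact_support:
  fixes g :: "'a::metric_space \<Rightarrow> 'b::real_normed_vector"
  assumes "continuous_on UNIV g" "compact K" "\<And>x. x \<notin> K \<Longrightarrow> g x = 0"
  obtains C where "C \<ge> 0" "\<And>x. norm (g x) \<le> C"
proof -
  have "bounded (g ` K)"
    using assms by (intro compact_imp_bounded compact_continuous_image) (auto intro: continuous_on_subset)
  then obtain C where C: "\<forall>y\<in>g ` K. norm y \<le> C" by (auto simp: bounded_iff)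
  then have "norm (g x) \<le> max C 0" for x
    using assms(3)[of x] C by (cases "x \<in> K") (auto simp: le_max_iff_disj)
  then show ?thesis using that[of "max C 0"] by simp
qed

lemma lborel_integral_translation:
  fixes g :: "'a::euclidean_space \<Rightarrow> 'b::{banach, second_countable_topology}"
  assumes "g \<in> borel_measurable borel"
  shows "(LINT y|lborel. g (c + y)) = (LINT y|lborel. g y)"
proof -
  have "(LINT y|lborel. g y) = (LINT y|distr lborel borel ((+) c). g y)"
    by (simp add: lborel_distr_plus)
  also have "\<dots> = (LINT y|lborel. g (c + y))"
    by (rule integral_distr) (use assms in auto)
  finally show ?thesis by simp
qed

text \<open>Translation invariance makes the integral of every difference quotient in direction v
  zero; dominated convergence passes to the limit.\<close>

lemma integral_derivative_compact_support:
  fixes g :: "'a::euclidean_space \<Rightarrow> complex"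
  assumes g: "smooth_on UNIV g" and K: "compact K" "\<And>x. x \<notin> K \<Longrightarrow> g x = 0"
  shows "(LINT y|lborel. frechet_derivative g (at y) v) = 0"
proof -
  define d where "d y = frechet_derivative g (at y) v" for y
  have dg: "(g has_derivative frechet_derivative g (at y)) (at y)" for y
    using smooth_on_differentiable[OF g] frechet_derivative_works by blast
  have cont: "continuous_on UNIV g" "continuous_on UNIV d"
    using smooth_on_continuous_on[OF g] smooth_on_continuous_on[OF smooth_on_frechet_derivative[OF g]]
    by (auto simp: d_def[abs_def])
  have dK: "d x = 0" if "x \<notin> K" for x
    unfolding d_def using frechet_derivative_outside_support[of K g] K that compact_imp_closed by blast
  obtain C where C: "C \<ge> 0" "\<And>x. norm (d x) \<le> C"
    using bounded_compact_support[OF cont(2) K(1) dK] by blast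
  define e where "e n = 1 / real (Suc n)" for n
  have e: "0 < e n" "e n \<le> 1" for n by (auto simp: e_def)
  have deriv_line: "((\<lambda>s. g (y + s *\<^sub>R v)) has_vector_derivative d (y + s *\<^sub>R v)) (at s)" for y s
  proof -
    have "((\<lambda>s. y + s *\<^sub>R v) has_derivative (\<lambda>h. h *\<^sub>R v)) (at s)"
      by (auto intro!: derivative_eq_intros)
    from has_derivative_compose[OF this dg]
    show ?thesis unfolding has_vector_derivative_def d_def
      using has_derivative_bounded_linear[OF dg] by (simp add: linear_cmul bounded_linear.linear)
  qed
  have lip: "norm (g (y + e n *\<^sub>R v) - g y) \<le> C * e n" for y n
  proof -
    have "norm (g (y + e n *\<^sub>R v) - g (y + 0 *\<^sub>R v)) \<le> C * norm (e n - 0)"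
    proof (rule differentiable_bound[where S = UNIV and f' = "\<lambda>s h. h *\<^sub>R d (y + s *\<^sub>R v)"])
      show "((\<lambda>s. g (y + s *\<^sub>R v)) has_derivative (\<lambda>h. h *\<^sub>R d (y + s *\<^sub>R v))) (at s)" for s
        using deriv_line[of y s] by (simp add: has_vector_derivative_def)
      show "onorm (\<lambda>h. h *\<^sub>R d (y + s *\<^sub>R v)) \<le> C" for s
        by (rule onorm_le) (simp add: mult.commute[of C] mult_left_mono C(2))
    qed auto
    then show ?thesis using e[of n] by simp
  qed
  define q where "q n y = real (Suc n) *\<^sub>R (g (y + e n *\<^sub>R v) - g y)" for n y
  \<comment> \<open>K swept backwards along v by steps of size up to 1: one compact set outside
    which all difference quotients vanish, so that a constant on it is an integrable
    majorant.\<close>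
  define K' where "K' = {k - s *\<^sub>R v |k s. k \<in> K \<and> s \<in> {0..1::real}}"
  have "compact K'"
  proof -
    have "K' = (\<lambda>(k, s). k - s *\<^sub>R v) ` (K \<times> {0..1})"
      unfolding K'_def image_def by fastforce
    then show ?thesis
      by (auto intro!: compact_continuous_image compact_Times K(1) continuous_intros simp: case_prod_unfold)
  qed
  have q0: "q n y = 0" if "y \<notin> K'" for n y
  proof -
    have "y + e n *\<^sub>R v \<notin> K"
    proof
      assume "y + e n *\<^sub>R v \<in> K"
      moreover have "y = (y + e n *\<^sub>R v) - e n *\<^sub>R v" by simp
      ultimately have "y \<in> K'" unfolding K'_def using e[of n] by (metis (mono_tags, lifting) atLeastAtMost_iff less_imp_le mem_Collect_eq)
      with that show False by simp
    qed
    moreover have "y \<notin> K"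
    proof
      assume "y \<in> K"
      moreover have "y = y - 0 *\<^sub>R v" by simp
      ultimately have "y \<in> K'" unfolding K'_def by (metis (mono_tags, lifting) atLeastAtMost_iff order_refl zero_le_one mem_Collect_eq)
      with that show False by simp
    qed
    ultimately show ?thesis by (simp add: q_def K(2))
  qed
  have gm: "g \<in> borel_measurable borel" using cont(1) by (rule borel_measurable_continuous_onI)
  have gi: "integrable lborel g" using integrable_compact_support[OF cont(1) K] .
  have gt: "integrable lborel (\<lambda>y. g (y + e n *\<^sub>R v))" for n
  proof -
    have c: "continuous_on UNIV (\<lambda>y. g (y + e n *\<^sub>R v))"
      by (rule continuous_on_compose2[OF cont(1)]) (auto intro!: continuous_intros)
    have "compact ((\<lambda>y. y - e n *\<^sub>R v) ` K)"
      by (auto intro!: compact_continuous_image K(1) continuous_intros)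
    moreover have "g (y + e n *\<^sub>R v) = 0" if "y \<notin> (\<lambda>y. y - e n *\<^sub>R v) ` K" for y
    proof (rule K(2), rule notI)
      assume "y + e n *\<^sub>R v \<in> K"
      then have "(y + e n *\<^sub>R v) - e n *\<^sub>R v \<in> (\<lambda>y. y - e n *\<^sub>R v) ` K" by (rule imageI)
      with that show False by simp
    qed
    ultimately show ?thesis by (rule integrable_compact_support[OF c])
  qed
  have "(LINT y|lborel. q n y) = 0" for n
    unfolding q_def using lborel_integral_translation[OF gm, of "e n *\<^sub>R v"]
    by (simp add: gi gt add.commute)
  moreover have "(\<lambda>n. LINT y|lborel. q n y) \<longlonglongrightarrow> (LINT y|lborel. d y)"
  proof (rule integral_dominated_convergence[where w = "\<lambda>y. indicator K' y * C"])
    show "d \<in> borel_measurable lborel" using borel_measurable_continuous_onI[OF cont(2)] by simp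
    show "q n \<in> borel_measurable lborel" for n
      unfolding q_def using gt[of n] gi by (intro borel_measurable_integrable) auto
    show "integrable lborel (\<lambda>y. indicator K' y * C)"
      using borel_integrable_compact[OF \<open>compact K'\<close>, of "\<lambda>_. C"] by simp
    show "AE y in lborel. norm (q n y) \<le> indicator K' y * C" for n
    proof (rule AE_I2)
      fix y
      show "norm (q n y) \<le> indicator K' y * C"
      proof (cases "y \<in> K'")
        case True
        have "norm (q n y) \<le> real (Suc n) * (C * e n)"
          unfolding q_def using mult_left_mono[OF lip[of y n], of "real (Suc n)"] by simp
        also have "\<dots> = C" by (simp add: e_def)
        finally show ?thesis using True by simp
      qed (simp add: q0)
    qed
    show "AE y in lborel. (\<lambda>n. q n y) \<longlonglongrightarrow> d y"
    proof (rule AE_I2)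
      fix y
      have "((\<lambda>s. (g (y + s *\<^sub>R v) - g y) /\<^sub>R s) \<longlongrightarrow> d y) (at 0)"
      proof (subst Lim_null, rule tendsto_norm_zero_cancel, rule Lim_transform_eventually)
        show "((\<lambda>h. norm (g (y + h *\<^sub>R v) - g y - h *\<^sub>R d y) / norm h) \<longlongrightarrow> 0) (at 0)"
          using deriv_line[of y 0] by (simp add: has_vector_derivative_def has_derivative_at)
        have "norm (g (y + h *\<^sub>R v) - g y - h *\<^sub>R d y) / norm h =
            norm ((g (y + h *\<^sub>R v) - g y) /\<^sub>R h - d y)" if "h \<noteq> 0" for h
        proof -
          have "(g (y + h *\<^sub>R v) - g y) /\<^sub>R h - d y = (g (y + h *\<^sub>R v) - g y - h *\<^sub>R d y) /\<^sub>R h"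
            using that by (simp add: scaleR_diff_right)
          then show ?thesis by (simp add: divide_inverse mult.commute)
        qed
        then show "\<forall>\<^sub>F h in at 0. norm (g (y + h *\<^sub>R v) - g y - h *\<^sub>R d y) / norm h =
            norm ((g (y + h *\<^sub>R v) - g y) /\<^sub>R h - d y)"
          by (auto simp: eventually_at_filter)
      qed
      moreover have "filterlim e (at 0) sequentially"
        unfolding filterlim_at e_def using LIMSEQ_inverse_real_of_nat
        by (auto simp: inverse_eq_divide)
      ultimately have "(\<lambda>n. (g (y + e n *\<^sub>R v) - g y) /\<^sub>R e n) \<longlonglongrightarrow> d y"
        by (rule filterlim_compose)
      then show "(\<lambda>n. q n y) \<longlonglongrightarrow> d y" by (simp add: q_def e_def)
    qed
  qed
  ultimately show ?thesis by (simp add: d_def LIMSEQ_const_iff)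
qed

text \<open>Integration by parts: the derivative of g(y) e^(i<y,\<xi>>) in direction v has integral
  0, and the product rule splits it into these two terms.\<close>

lemma fourier_integral_derivative:
  fixes g :: "'a::euclidean_space \<Rightarrow> complex"
  assumes g: "smooth_on UNIV g" and K: "compact K" "\<And>x. x \<notin> K \<Longrightarrow> g x = 0"
  shows "(LINT y|lborel. frechet_derivative g (at y) v * exp (\<i> * of_real (y \<bullet> \<xi>))) =
    - (\<i> * of_real (v \<bullet> \<xi>)) * (LINT y|lborel. g y * exp (\<i> * of_real (y \<bullet> \<xi>)))"
proof -
  define e where "e y = exp (\<i> * of_real (y \<bullet> \<xi>))" for y :: 'a
  have e: "smooth_on UNIV e" unfolding e_def by (rule smooth_on_cis)
  have de: "(e has_derivative (\<lambda>v. \<i> * of_real (v \<bullet> \<xi>) * e y)) (at y)" for y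
    unfolding e_def by (rule has_derivative_cis)
  have dg: "(g has_derivative frechet_derivative g (at y)) (at y)" for y
    using smooth_on_differentiable[OF g] frechet_derivative_works by blast
  have "((\<lambda>y. g y * e y) has_derivative
      (\<lambda>v. g y * (\<i> * of_real (v \<bullet> \<xi>) * e y) + frechet_derivative g (at y) v * e y)) (at y)" for y
    by (rule has_derivative_mult[OF dg de])
  then have D: "frechet_derivative (\<lambda>y. g y * e y) (at y) v =
      frechet_derivative g (at y) v * e y + \<i> * of_real (v \<bullet> \<xi>) * (g y * e y)" for y
    by (subst frechet_derivative_at[symmetric]) (auto simp: mult_ac add_ac)
  have ge: "smooth_on UNIV (\<lambda>y. g y * e y)"
    by (intro bounded_bilinear.smooth_on_bilinear[OF bounded_bilinear_mult] g e open_UNIV)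
  have dge: "smooth_on UNIV (\<lambda>y. frechet_derivative g (at y) v * e y)"
    by (intro bounded_bilinear.smooth_on_bilinear[OF bounded_bilinear_mult] e open_UNIV
        smooth_on_frechet_derivative g)
  have i1: "integrable lborel (\<lambda>y. g y * e y)"
    by (rule integrable_compact_support[OF smooth_on_continuous_on[OF ge] K(1)]) (simp add: K(2))
  have i2: "integrable lborel (\<lambda>y. frechet_derivative g (at y) v * e y)"
    by (rule integrable_compact_support[OF smooth_on_continuous_on[OF dge] K(1)])
      (simp add: frechet_derivative_outside_support[of K g] K compact_imp_closed)
  have "(LINT y|lborel. frechet_derivative (\<lambda>y. g y * e y) (at y) v) = 0"
    by (rule integral_derivative_compact_support[OF ge K(1)]) (simp add: K(2))
  then have "(LINT y|lborel. frechet_derivative g (at y) v * e y) +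
      \<i> * of_real (v \<bullet> \<xi>) * (LINT y|lborel. g y * e y) = 0"
    unfolding D using i1 i2 by simp
  then show ?thesis unfolding e_def by (simp add: eq_neg_iff_add_eq_0)
qed

lemma fourier_integral_rapid_decay:
  fixes g :: "'a::euclidean_space \<Rightarrow> complex"
  assumes "smooth_on UNIV g" "compact K" "\<And>x. x \<notin> K \<Longrightarrow> g x = 0" "\<xi> \<noteq> 0"
  shows "\<exists>C. \<forall>t>0. t ^ N * norm (LINT y|lborel. g y * exp (\<i> * of_real (y \<bullet> (t *\<^sub>R \<xi>)))) \<le> C"
  using assms(1,3)
proof (induction N arbitrary: g)
  case 0
  have "norm (LINT y|lborel. g y * exp (\<i> * of_real (y \<bullet> (t *\<^sub>R \<xi>)))) \<le> (LINT y|lborel. norm (g y))" for t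
    using integral_norm_bound[of lborel "\<lambda>y. g y * exp (\<i> * of_real (y \<bullet> (t *\<^sub>R \<xi>)))"]
    by (simp add: norm_mult)
  then show ?case by (intro exI[of _ "LINT y|lborel. norm (g y)"]) simp
next
  case (Suc N)
  \<comment> \<open>The direction with <v,\<xi>> = 1: integrating by parts along it at frequency t
    \<xi> gains exactly a factor t.\<close>
  define v where "v = \<xi> /\<^sub>R (\<xi> \<bullet> \<xi>)"
  have v: "v \<bullet> \<xi> = 1" using assms(4) by (simp add: v_def)
  obtain C where C: "\<forall>t>0. t ^ N * norm (LINT y|lborel. frechet_derivative g (at y) v *
      exp (\<i> * of_real (y \<bullet> (t *\<^sub>R \<xi>)))) \<le> C"
    using Suc.IH[OF smooth_on_frechet_derivative[OF Suc.prems(1)]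
        frechet_derivative_outside_support[OF compact_imp_closed[OF assms(2)] Suc.prems(2)]]
    by blast
  have "t ^ Suc N * norm (LINT y|lborel. g y * exp (\<i> * of_real (y \<bullet> (t *\<^sub>R \<xi>)))) \<le> C" if "t > 0" for t
  proof -
    have "norm (LINT y|lborel. frechet_derivative g (at y) v * exp (\<i> * of_real (y \<bullet> (t *\<^sub>R \<xi>)))) =
        t * norm (LINT y|lborel. g y * exp (\<i> * of_real (y \<bullet> (t *\<^sub>R \<xi>))))"
      using fourier_integral_derivative[OF Suc.prems(1) assms(2) Suc.prems(2), of v "t *\<^sub>R \<xi>"] v that
      by (simp add: norm_mult)
    then show ?thesis using C[rule_format, OF that] by (simp only: power_Suc mult_ac)
  qed
  then show ?case by blast
qed

section \<open>Uniqueness of asymptotic expansions\<close>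

text \<open>After division by its power of t the top coefficient is bounded by a constant over t, so
  it vanishes, and the next one becomes the top. The bound C t^N has the size of the bottom term,
  which is why \<open>a N\<close> itself stays undetermined.\<close>

lemma laurent_coeff_zero:
  fixes a :: "int \<Rightarrow> 'b::real_normed_vector"
  assumes "t0 \<ge> 1"
    and "\<And>t::real. t \<ge> t0 \<Longrightarrow> norm (\<Sum>l=N..N + int n. (t powi l) *\<^sub>R a l) \<le> C * t powi N"
    and "N < l" "l \<le> N + int n"
  shows "a l = 0"
  using assms(2-)
proof (induction n arbitrary: l C)
  case (Suc n)
  define m where "m = N + int (Suc n)"
  have split: "(\<Sum>l=N..m. (t powi l) *\<^sub>R a l) = (\<Sum>l=N..N + int n. (t powi l) *\<^sub>R a l) + (t powi m) *\<^sub>R a m"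
    for t :: real
  proof -
    have "{N..m} = insert m {N..N + int n}" by (auto simp: m_def)
    then show ?thesis by (simp add: m_def)
  qed
  define B where "B = \<bar>C\<bar> + (\<Sum>l=N..N + int n. norm (a l))"
  have bound: "norm (a m) \<le> B / t" if t0: "t \<ge> t0" for t :: real
  proof -
    have t: "t \<ge> 1" using t0 assms(1) by linarith
    have mono: "t powi l \<le> t powi (m - 1)" if "l \<le> m - 1" for l
      using that t by (intro power_int_increasing) auto
    have "norm ((t powi m) *\<^sub>R a m) \<le> norm (\<Sum>l=N..m. (t powi l) *\<^sub>R a l) +
        norm (\<Sum>l=N..N + int n. (t powi l) *\<^sub>R a l)"
      unfolding split using norm_triangle_ineq4 by (metis add_diff_cancel_left')
    also have "\<dots> \<le> C * t powi N + (\<Sum>l=N..N + int n. t powi l * norm (a l))"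
    proof (rule add_mono)
      show "norm (\<Sum>l=N..m. (t powi l) *\<^sub>R a l) \<le> C * t powi N"
        using Suc.prems(1)[OF t0] by (simp only: m_def)
      show "norm (\<Sum>l=N..N + int n. (t powi l) *\<^sub>R a l) \<le> (\<Sum>l=N..N + int n. t powi l * norm (a l))"
        using t by (intro order_trans[OF norm_sum] sum_mono) auto
    qed
    also have "\<dots> \<le> \<bar>C\<bar> * t powi (m - 1) + (\<Sum>l=N..N + int n. t powi (m - 1) * norm (a l))"
      using t by (intro add_mono sum_mono mult_right_mono mult_mono mono) (auto simp: m_def)
    also have "\<dots> = t powi (m - 1) * B" by (simp add: B_def sum_distrib_left algebra_simps)
    finally have "t powi m * norm (a m) \<le> t powi (m - 1) * B" using t by simp
    moreover have "t powi m = t powi (m - 1) * t" using t by (simp add: power_int_diff)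
    ultimately have "t powi (m - 1) * (t * norm (a m)) \<le> t powi (m - 1) * B" by (simp add: mult_ac)
    then have "t * norm (a m) \<le> B" using t by (subst (asm) mult_le_cancel_left_pos) auto
    then show ?thesis using t by (simp add: field_simps)
  qed
  have "((\<lambda>t. B / t) \<longlongrightarrow> 0) at_top" by real_asymp
  then have "norm (a m) \<le> 0"
    by (rule tendsto_lowerbound) (use bound in \<open>auto simp: eventually_at_top_linorder intro!: exI[of _ t0]\<close>)
  then have am: "a m = 0" by simp
  show ?case
  proof (cases "l = m")
    case False
    have "norm (\<Sum>l=N..N + int n. (t powi l) *\<^sub>R a l) \<le> C * t powi N" if "t \<ge> t0" for t :: real
      using Suc.prems(1)[OF that] split[of t] am by (simp add: m_def)
    then show ?thesis using Suc.IH[of C l] Suc.prems(2,3) False by (auto simp: m_def)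
  qed (simp add: am)
qed simp

section \<open>Complex matrices as a real Banach algebra\<close>

text \<open>Scaling a matrix by a complex number, where \<open>scaleR\<close> takes real factors
  only. As a real bilinear map it obeys the calculus of \<open>bounded_bilinear\<close>, like the
  matrix products.\<close>

definition cscale :: "complex \<Rightarrow> complex^'n^'m \<Rightarrow> complex^'n^'m" where
  "cscale z M = (\<chi> i j. z * M $ i $ j)"

lemma cscale_nth [simp]: "cscale z M $ i $ j = z * M $ i $ j"
  by (simp add: cscale_def)

lemma bounded_bilinear_matrix_mult:
  "bounded_bilinear ((**) :: complex^'n^'m \<Rightarrow> complex^'p^'n \<Rightarrow> complex^'p^'m)"
  unfolding bilinear_conv_bounded_bilinear[symmetric] bilinear_def
  by (auto intro!: linearI simp: vec_eq_iff matrix_matrix_mult_def sum.distrib algebra_simps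
      scaleR_sum_right)

lemma bounded_bilinear_matrix_vector:
  "bounded_bilinear ((*v) :: complex^'n^'m \<Rightarrow> complex^'n \<Rightarrow> complex^'m)"
  unfolding bilinear_conv_bounded_bilinear[symmetric] bilinear_def
  by (auto intro!: linearI simp: vec_eq_iff matrix_vector_mult_def sum.distrib algebra_simps
      scaleR_sum_right)

lemma bounded_bilinear_cscale:
  "bounded_bilinear (cscale :: complex \<Rightarrow> complex^'n^'m \<Rightarrow> complex^'n^'m)"
  unfolding bilinear_conv_bounded_bilinear[symmetric] bilinear_def
  by (auto intro!: linearI simp: vec_eq_iff algebra_simps)

lemma bounded_bilinear_vector_scalar:
  "bounded_bilinear ((*s) :: complex \<Rightarrow> complex^'n \<Rightarrow> complex^'n)"
  unfolding bilinear_conv_bounded_bilinear[symmetric] bilinear_def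
  by (auto intro!: linearI simp: vec_eq_iff algebra_simps)

interpretation matmul: bounded_bilinear "(**) :: complex^'n^'m \<Rightarrow> complex^'p^'n \<Rightarrow> complex^'p^'m"
  by (rule bounded_bilinear_matrix_mult)

interpretation matvec: bounded_bilinear "(*v) :: complex^'n^'m \<Rightarrow> complex^'n \<Rightarrow> complex^'m"
  by (rule bounded_bilinear_matrix_vector)

interpretation cscale: bounded_bilinear "cscale :: complex \<Rightarrow> complex^'n^'m \<Rightarrow> complex^'n^'m"
  by (rule bounded_bilinear_cscale)

interpretation vecscale: bounded_bilinear "(*s) :: complex \<Rightarrow> complex^'n \<Rightarrow> complex^'n"
  by (rule bounded_bilinear_vector_scalar)

lemma matmul_cscale_left: "cscale z M ** N = cscale z (M ** N)"
  by (simp add: vec_eq_iff matrix_matrix_mult_def sum_distrib_left mult_ac)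

lemma matmul_cscale_right: "M ** cscale z N = cscale z (M ** N)"
  by (simp add: vec_eq_iff matrix_matrix_mult_def sum_distrib_left mult_ac)

lemma cscale_cscale: "cscale z (cscale w M) = cscale (z * w) M"
  by (simp add: vec_eq_iff)

lemma cscale_of_real: "cscale (z * of_real r) M = r *\<^sub>R cscale z M"
  by (simp add: vec_eq_iff) (simp add: scaleR_conv_of_real mult_ac)

lemma cscale_one [simp]: "cscale 1 M = M"
  by (simp add: vec_eq_iff)

lemma matvec_axis: "((M :: complex^'n^'m) *v axis k 1) $ i = M $ i $ k"
  by (simp add: matrix_vector_mult_def axis_def if_distrib cong: if_cong)

lemma matrix_eq_columns:
  fixes M N :: "complex^'n^'m"
  assumes "\<And>k. M *v axis k 1 = N *v axis k 1"
  shows "M = N"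
  using assms by (metis matvec_axis vec_eq_iff)

section \<open>Partial derivatives\<close>

lemma partialI: "(f has_derivative f') (at x) \<Longrightarrow> partial k f x = f' (axis k 1)"
  unfolding partial_def using frechet_derivative_at by metis

lemma partial_cong:
  assumes "open S" "x \<in> S" "\<And>y. y \<in> S \<Longrightarrow> f y = g y"
  shows "partial k f x = partial k g x"
  unfolding partial_def using frechet_derivative_cong(1)[OF assms] by simp

lemma partial_const: "partial k (\<lambda>x. c) x = 0"
  by (rule partialI[where f' = "\<lambda>_. 0", simplified]) simp

lemma (in bounded_linear) partial_bounded_linear:
  assumes "g differentiable (at x)"
  shows "partial k (\<lambda>x. f (g x)) x = f (partial k g x)"
  using partialI[OF has_derivative[OF assms[unfolded frechet_derivative_works]]]
  by (simp add: partial_def)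

lemma (in bounded_bilinear) partial_bilinear:
  assumes "f differentiable (at x)" "g differentiable (at x)"
  shows "partial k (\<lambda>x. prod (f x) (g x)) x = prod (f x) (partial k g x) + prod (partial k f x) (g x)"
  using partialI[OF FDERIV[OF assms[unfolded frechet_derivative_works]]]
  by (simp add: partial_def)

lemma differentiable_fst_slice:
  assumes "F differentiable (at (x, \<eta>))"
  shows "((\<lambda>y. F (y, \<eta>)) has_derivative (\<lambda>v. frechet_derivative F (at (x, \<eta>)) (v, 0))) (at x)"
proof -
  have "((\<lambda>y. (y, \<eta>)) has_derivative (\<lambda>v. (v, 0))) (at x)"
    by (auto intro!: derivative_eq_intros)
  from has_derivative_compose[OF this assms[unfolded frechet_derivative_works]]
  show ?thesis by simp
qed

section \<open>The symbol of a right parametrix of a first order operator\<close>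

text \<open>The symbol of \<Sum> \<alpha>_k \<partial>_k without its factor \<i>, which is supplied
  by \<open>cscale \<i>\<close> where the full symbol is meant.\<close>

definition principal_symbol :: "(real^4 \<Rightarrow> 4 \<Rightarrow> complex^4^4) \<Rightarrow> real^4 \<Rightarrow> real^4 \<Rightarrow> complex^4^4" where
  "principal_symbol \<alpha> x \<xi> = (\<Sum>k\<in>UNIV. (\<xi> $ k) *\<^sub>R \<alpha> x k)"

definition first_order ::
  "(real^4 \<Rightarrow> 4 \<Rightarrow> complex^4^4) \<Rightarrow> (real^4 \<Rightarrow> complex^4^4) \<Rightarrow> (real^4 \<Rightarrow> complex^4^4) \<Rightarrow> real^4 \<Rightarrow> complex^4^4"
  where "first_order \<alpha> \<beta> q x = (\<Sum>k\<in>UNIV. \<alpha> x k ** partial k q x) + \<beta> x ** q x"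

lemma first_order_cong:
  assumes "open S" "x \<in> S" "\<And>y. y \<in> S \<Longrightarrow> f y = g y"
  shows "first_order \<alpha> \<beta> f x = first_order \<alpha> \<beta> g x"
  using assms partial_cong[OF assms] by (simp add: first_order_def)

lemma first_order_zero: "first_order \<alpha> \<beta> (\<lambda>x. 0) x = 0"
  by (simp add: first_order_def partial_const matmul.zero_right)

lemma classical_symbol_D:
  assumes "classical_symbol W m p \<sigma>"
  shows "smooth_on (W \<times> UNIV) (\<lambda>(x, \<xi>). p x \<xi>)"
    and "smooth_on (W \<times> (- {0})) (\<lambda>(x, \<xi>). \<sigma> l x \<xi>)"
    and "x \<in> W \<Longrightarrow> \<xi> \<noteq> 0 \<Longrightarrow> t > 0 \<Longrightarrow> \<sigma> l x (t *\<^sub>R \<xi>) = (t powi l) *\<^sub>R \<sigma> l x \<xi>"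
    and "x \<in> W \<Longrightarrow> \<xi> \<noteq> 0 \<Longrightarrow> l > m \<Longrightarrow> \<sigma> l x \<xi> = 0"
    and "symbol_class W (N - 1) (\<lambda>x \<xi>. p x \<xi> - (\<Sum>l=N..m. \<sigma> l x \<xi>))"
  using assms unfolding classical_symbol_def by blast+

text \<open>The symbol estimates restricted to a ray t \<xi> over a fixed x, where homogeneity turns
  the partial sums into Laurent polynomials in t. Differentiation in x does not change the order in
  \<xi>, so both remainders have the same size; \<open>t0\<close> keeps |t \<xi>| \<ge> 1, where the
  estimates are stated.\<close>

lemma classical_symbol_bounds:
  assumes W: "open W" and cl: "classical_symbol W m p \<sigma>" and x: "x \<in> W" and xi: "\<xi> \<noteq> 0"
  defines "t0 \<equiv> max 1 (1 / norm \<xi>)"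
  shows "\<exists>C. \<forall>t\<ge>t0. norm (p x (t *\<^sub>R \<xi>) - (\<Sum>l=N..m. (t powi l) *\<^sub>R \<sigma> l x \<xi>)) \<le> C * t powi (N - 1)"
    and "\<exists>C. \<forall>t\<ge>t0. norm (partial k (\<lambda>y. p y (t *\<^sub>R \<xi>)) x -
           (\<Sum>l=N..m. (t powi l) *\<^sub>R partial k (\<lambda>y. \<sigma> l y \<xi>) x)) \<le> C * t powi (N - 1)"
proof -
  note D = classical_symbol_D[OF cl]
  let ?F = "\<lambda>(y, \<eta>). p y \<eta> - (\<Sum>l=N..m. \<sigma> l y \<eta>)"
  have t0: "t > 0" "norm (t *\<^sub>R \<xi>) \<ge> 1" "norm (t *\<^sub>R \<xi>) = t * norm \<xi>" if "t \<ge> t0" for t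
  proof -
    show "t > 0" using that by (simp add: t0_def)
    have "1 / norm \<xi> \<le> t" using that by (simp add: t0_def)
    then show "norm (t *\<^sub>R \<xi>) \<ge> 1" using \<open>t > 0\<close> xi by (simp add: field_simps)
    show "norm (t *\<^sub>R \<xi>) = t * norm \<xi>" using \<open>t > 0\<close> by simp
  qed
  have sc: "\<exists>C. \<forall>\<xi>. norm \<xi> \<ge> 1 \<longrightarrow> norm (iter_deriv (map (\<lambda>v. (v, 0)) vs) ?F (x, \<xi>)) \<le> C * norm \<xi> powi (N - 1)"
    for vs
  proof -
    have "\<exists>C. \<forall>y\<in>{x}. \<forall>\<xi>. norm \<xi> \<ge> 1 \<longrightarrow>
        norm (iter_deriv (map (\<lambda>v. (v, 0)) vs @ map (Pair 0) []) ?F (y, \<xi>)) \<le> C * norm \<xi> powi (N - 1 - int (length ([] :: (real^4) list)))"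
      by (rule D(5)[of N, unfolded symbol_class_def, THEN spec[of _ "{x}"], THEN spec[of _ vs],
            THEN spec[of _ "[]"], THEN mp]) (simp add: x)
    then show ?thesis by simp
  qed
  have scale: "\<exists>C'. \<forall>t\<ge>t0. norm (f t) \<le> C' * t powi (N - 1)"
    if "\<And>t. t \<ge> t0 \<Longrightarrow> norm (f t) \<le> C * norm (t *\<^sub>R \<xi>) powi (N - 1)" for f :: "real \<Rightarrow> complex^4^4" and C
  proof (intro exI[of _ "C * norm \<xi> powi (N - 1)"] allI impI)
    fix t assume "t \<ge> t0"
    then show "norm (f t) \<le> C * norm \<xi> powi (N - 1) * t powi (N - 1)"
      using that[of t] unfolding t0(3)[OF \<open>t \<ge> t0\<close>] power_int_mult_distrib by (simp only: mult_ac)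
  qed
  obtain C where C: "\<And>\<eta>. norm \<eta> \<ge> 1 \<Longrightarrow> norm (?F (x, \<eta>)) \<le> C * norm \<eta> powi (N - 1)"
    using sc[of "[]"] by auto
  show "\<exists>C. \<forall>t\<ge>t0. norm (p x (t *\<^sub>R \<xi>) - (\<Sum>l=N..m. (t powi l) *\<^sub>R \<sigma> l x \<xi>)) \<le> C * t powi (N - 1)"
  proof (rule scale)
    fix t assume t: "t \<ge> t0"
    have "(\<Sum>l=N..m. \<sigma> l x (t *\<^sub>R \<xi>)) = (\<Sum>l=N..m. (t powi l) *\<^sub>R \<sigma> l x \<xi>)"
      by (rule sum.cong) (use D(3)[OF x xi] t0[OF t] in auto)
    then show "norm (p x (t *\<^sub>R \<xi>) - (\<Sum>l=N..m. (t powi l) *\<^sub>R \<sigma> l x \<xi>)) \<le> C * norm (t *\<^sub>R \<xi>) powi (N - 1)"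
      using C[OF t0(2)[OF t]] by simp
  qed
  obtain C' where C': "\<And>\<eta>. norm \<eta> \<ge> 1 \<Longrightarrow>
      norm (frechet_derivative ?F (at (x, \<eta>)) (axis k 1, 0)) \<le> C' * norm \<eta> powi (N - 1)"
    using sc[of "[axis k 1]"] by auto
  show "\<exists>C. \<forall>t\<ge>t0. norm (partial k (\<lambda>y. p y (t *\<^sub>R \<xi>)) x -
           (\<Sum>l=N..m. (t powi l) *\<^sub>R partial k (\<lambda>y. \<sigma> l y \<xi>) x)) \<le> C * t powi (N - 1)"
  proof (rule scale)
    fix t assume t: "t \<ge> t0"
    define \<eta> where "\<eta> = t *\<^sub>R \<xi>"
    have eta: "\<eta> \<noteq> 0" using t0[OF t] xi by (simp add: \<eta>_def)
    have dp: "(\<lambda>(y, \<eta>). p y \<eta>) differentiable (at (x, \<eta>))"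
      by (rule smooth_on_differentiable[OF D(1)]) (use x in auto)
    have ds: "(\<lambda>(y, \<eta>). \<sigma> l y \<eta>) differentiable (at (x, \<eta>))" if "\<eta> \<noteq> 0" for l \<eta>
      by (rule smooth_on_differentiable[OF D(2)]) (use x that in auto)
    have dF: "?F differentiable (at (x, \<eta>))"
    proof -
      have "(\<lambda>z. (\<lambda>(y, \<eta>). p y \<eta>) z - (\<Sum>l=N..m. (\<lambda>(y, \<eta>). \<sigma> l y \<eta>) z)) differentiable (at (x, \<eta>))"
        by (intro differentiable_diff differentiable_sum dp finite_atLeastAtMost_int ballI ds[OF eta])
      then show ?thesis by (simp add: case_prod_unfold)
    qed
    have d1: "(\<lambda>y. p y \<eta>) differentiable (at x)"
      using differentiable_fst_slice[OF dp] by (auto simp: differentiable_def)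
    have d2: "(\<lambda>y. \<sigma> l y \<eta>) differentiable (at x)" if "\<eta> \<noteq> 0" for l \<eta>
      using differentiable_fst_slice[OF ds[OF that]] by (auto simp: differentiable_def)
    have "partial k (\<lambda>y. p y \<eta> - (\<Sum>l=N..m. \<sigma> l y \<eta>)) x =
        partial k (\<lambda>y. p y \<eta>) x - (\<Sum>l=N..m. partial k (\<lambda>y. \<sigma> l y \<eta>) x)"
      using partialI[OF has_derivative_diff[OF d1[unfolded frechet_derivative_works]
            has_derivative_sum[of "{N..m}", OF d2[OF eta, unfolded frechet_derivative_works]]]]
      by (simp add: partial_def)
    moreover have "partial k (\<lambda>y. p y \<eta> - (\<Sum>l=N..m. \<sigma> l y \<eta>)) x = frechet_derivative ?F (at (x, \<eta>)) (axis k 1, 0)"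
      using partialI[OF differentiable_fst_slice[OF dF]] by simp
    moreover have "partial k (\<lambda>y. \<sigma> l y \<eta>) x = (t powi l) *\<^sub>R partial k (\<lambda>y. \<sigma> l y \<xi>) x" for l
    proof -
      have "partial k (\<lambda>y. \<sigma> l y \<eta>) x = partial k (\<lambda>y. (t powi l) *\<^sub>R \<sigma> l y \<xi>) x"
        by (rule partial_cong[OF W x]) (simp add: \<eta>_def D(3)[OF _ xi] t0[OF t])
      also have "\<dots> = (t powi l) *\<^sub>R partial k (\<lambda>y. \<sigma> l y \<xi>) x"
        by (rule bounded_linear.partial_bounded_linear[OF bounded_linear_scaleR_right d2[OF xi]])
      finally show ?thesis .
    qed
    ultimately show "norm (partial k (\<lambda>y. p y (t *\<^sub>R \<xi>)) x -
           (\<Sum>l=N..m. (t powi l) *\<^sub>R partial k (\<lambda>y. \<sigma> l y \<xi>) x)) \<le> C' * norm (t *\<^sub>R \<xi>) powi (N - 1)"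
      using C'[OF t0(2)[OF t]] by (simp add: \<eta>_def)
  qed
qed

text \<open>Along the ray t \<xi> the equation becomes a Laurent polynomial identity up to an error
  O(t^N), with N as low as desired; \<open>laurent_coeff_zero\<close> then kills the coefficient of
  every t^l with l > N.\<close>

lemma symbol_recursion:
  assumes W: "open W" and cl: "classical_symbol W m p \<sigma>" and x: "x \<in> W" and xi: "\<xi> \<noteq> 0"
    and eq: "\<And>\<eta>. cscale \<i> (principal_symbol \<alpha> x \<eta>) ** p x \<eta> + first_order \<alpha> \<beta> (\<lambda>y. p y \<eta>) x = mat 1 + r \<eta>"
    and decay: "\<And>N. \<exists>C. \<forall>t>0. t ^ N * norm (r (t *\<^sub>R \<xi>)) \<le> C"
  shows "cscale \<i> (principal_symbol \<alpha> x \<xi>) ** \<sigma> (l - 1) x \<xi> + first_order \<alpha> \<beta> (\<lambda>y. \<sigma> l y \<xi>) x =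
    (if l = 0 then mat 1 else 0)"
proof -
  note D = classical_symbol_D[OF cl]
  \<comment> \<open>The window N..M contains l, m and 0 strictly inside, so that the coefficient of
    t^l can be read off, and both the top symbol, shifted up by one degree, and the identity matrix
    fall into it.\<close>
  define N where "N = min (min l m) 0 - 1"
  define M where "M = max (max l m) 0 + 1"
  define t0 where "t0 = max 1 (1 / norm \<xi>)"
  have t0: "t0 \<ge> 1" by (simp add: t0_def)
  define A where "A = cscale \<i> (principal_symbol \<alpha> x \<xi>)"
  define e where "e t = p x (t *\<^sub>R \<xi>) - (\<Sum>l=N..m. (t powi l) *\<^sub>R \<sigma> l x \<xi>)" for t
  define e' where "e' k t = partial k (\<lambda>y. p y (t *\<^sub>R \<xi>)) x -
    (\<Sum>l=N..m. (t powi l) *\<^sub>R partial k (\<lambda>y. \<sigma> l y \<xi>) x)" for k t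
  define L where "L l = first_order \<alpha> \<beta> (\<lambda>y. \<sigma> l y \<xi>) x" for l
  define a where "a l = A ** \<sigma> (l - 1) x \<xi> + L l - (if l = 0 then mat 1 else 0)" for l
  obtain Ce where Ce: "\<And>t. t \<ge> t0 \<Longrightarrow> norm (e t) \<le> Ce * t powi (N - 1)"
    using classical_symbol_bounds(1)[OF W cl x xi, of N] unfolding e_def t0_def by blast
  have "\<forall>k. \<exists>C. \<forall>t\<ge>t0. norm (e' k t) \<le> C * t powi (N - 1)"
    using classical_symbol_bounds(2)[OF W cl x xi, of _ N] unfolding e'_def t0_def by blast
  then obtain Ck where Ck: "\<And>k t. t \<ge> t0 \<Longrightarrow> norm (e' k t) \<le> Ck k * t powi (N - 1)" by metis
  obtain Cr where Cr: "\<And>t. t > 0 \<Longrightarrow> t ^ nat (- N) * norm (r (t *\<^sub>R \<xi>)) \<le> Cr"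
    using decay[of "nat (- N)"] by blast
  have Cr': "norm (r (t *\<^sub>R \<xi>)) \<le> Cr * t powi N" if "t > 0" for t
  proof -
    have "t powi N * t ^ nat (- N) = 1"
      using that N_def by (simp add: power_int_def power_inverse field_simps)
    then have "norm (r (t *\<^sub>R \<xi>)) = t powi N * (t ^ nat (- N) * norm (r (t *\<^sub>R \<xi>)))"
      by (simp add: mult.assoc[symmetric])
    also have "\<dots> \<le> t powi N * Cr" using that Cr[OF that] by (intro mult_left_mono) auto
    finally show ?thesis by (simp add: mult.commute)
  qed
  obtain K where K: "K > 0" "\<And>(P::complex^4^4) (Q::complex^4^4). norm (P ** Q) \<le> norm P * norm Q * K"
    using matmul.pos_bounded by blast
  have prin: "cscale \<i> (principal_symbol \<alpha> x (t *\<^sub>R \<xi>)) = t *\<^sub>R A" for t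
    by (simp add: A_def principal_symbol_def scaleR_sum_right[symmetric] cscale.scaleR_right
        scaleR_scaleR[symmetric] del: scaleR_scaleR)
  have L0: "L l = 0" if "l > m" for l
    unfolding L_def using first_order_cong[OF W x, of "\<lambda>y. \<sigma> l y \<xi>" "\<lambda>_. 0"] D(4)[OF _ xi that]
    by (simp add: first_order_zero)
  have sum_L: "(\<Sum>k\<in>UNIV. \<alpha> x k ** (\<Sum>l=N..m. (t powi l) *\<^sub>R partial k (\<lambda>y. \<sigma> l y \<xi>) x)) +
      \<beta> x ** (\<Sum>l=N..m. (t powi l) *\<^sub>R \<sigma> l x \<xi>) = (\<Sum>l=N..m. (t powi l) *\<^sub>R L l)" for t
  proof -
    have "(\<Sum>k\<in>UNIV. \<alpha> x k ** (\<Sum>l=N..m. (t powi l) *\<^sub>R partial k (\<lambda>y. \<sigma> l y \<xi>) x)) =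
        (\<Sum>l=N..m. (t powi l) *\<^sub>R (\<Sum>k\<in>UNIV. \<alpha> x k ** partial k (\<lambda>y. \<sigma> l y \<xi>) x))"
      by (simp add: matmul.sum_right matmul.scaleR_right scaleR_sum_right) (rule sum.swap)
    then show ?thesis
      by (simp add: L_def first_order_def matmul.sum_right matmul.scaleR_right scaleR_add_right sum.distrib)
  qed
  have regroup: "u2 + q + (v2 + w2) - c = q + s - (u1 + v1 + w1)"
    if "(u1 + u2) + (v1 + v2) + (w1 + w2) = c + s" for u1 u2 v1 v2 w1 w2 q s c :: "complex^4^4"
  proof -
    have "c = (u1 + u2) + (v1 + v2) + (w1 + w2) - s" using that by (simp only: eq_diff_eq)
    then show ?thesis by (simp add: algebra_simps)
  qed
  \<comment> \<open>Multiplication by A raises the degree by one, so the expansion of p down to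
    degree N leaves the coefficient at t^N incomplete. The missing A \<sigma>_(N-1) is put on the
    error side, where it has the admissible size t^N.\<close>
  have key: "(\<Sum>l=N..M. (t powi l) *\<^sub>R a l) = (t powi N) *\<^sub>R (A ** \<sigma> (N - 1) x \<xi>) + r (t *\<^sub>R \<xi>) -
      (t *\<^sub>R (A ** e t) + (\<Sum>k\<in>UNIV. \<alpha> x k ** e' k t) + \<beta> x ** e t)" if t: "t \<ge> t0" for t
  proof -
    have tp: "t > 0" using t t0 by linarith
    define S where "S = (\<Sum>l=N..m. (t powi l) *\<^sub>R \<sigma> l x \<xi>)"
    define S' where "S' k = (\<Sum>l=N..m. (t powi l) *\<^sub>R partial k (\<lambda>y. \<sigma> l y \<xi>) x)" for k
    have 1: "t *\<^sub>R (A ** (e t + S)) + (\<Sum>k\<in>UNIV. \<alpha> x k ** (e' k t + S' k)) + \<beta> x ** (e t + S) =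
        mat 1 + r (t *\<^sub>R \<xi>)"
      using eq[of "t *\<^sub>R \<xi>"]
      by (simp add: prin e_def S_def e'_def S'_def first_order_def matmul.scaleR_left add.assoc)
    have 2: "(\<Sum>k\<in>UNIV. \<alpha> x k ** S' k) + \<beta> x ** S = (\<Sum>l=N..M. (t powi l) *\<^sub>R L l)"
    proof -
      have "(\<Sum>l=N..M. (t powi l) *\<^sub>R L l) = (\<Sum>l=N..m. (t powi l) *\<^sub>R L l)"
        by (rule sum.mono_neutral_right) (auto simp: M_def L0)
      then show ?thesis using sum_L[of t] by (simp add: S_def S'_def)
    qed
    have 3: "t *\<^sub>R (A ** S) + (t powi N) *\<^sub>R (A ** \<sigma> (N - 1) x \<xi>) = (\<Sum>l=N..M. (t powi l) *\<^sub>R (A ** \<sigma> (l - 1) x \<xi>))"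
    proof -
      have "t *\<^sub>R (A ** S) = (\<Sum>l=N..m. (t powi (l + 1)) *\<^sub>R (A ** \<sigma> l x \<xi>))"
        using tp by (simp add: S_def matmul.sum_right matmul.scaleR_right scaleR_sum_right power_int_add mult.commute)
      also have "\<dots> = (\<Sum>l=N+1..m+1. (t powi l) *\<^sub>R (A ** \<sigma> (l - 1) x \<xi>))"
        by (rule sum.reindex_bij_witness[of _ "\<lambda>l. l - 1" "\<lambda>l. l + 1"]) auto
      also have "\<dots> = (\<Sum>l=N+1..M. (t powi l) *\<^sub>R (A ** \<sigma> (l - 1) x \<xi>))"
        by (rule sum.mono_neutral_left) (auto simp: M_def D(4)[OF x xi] matmul.zero_right)
      finally have "t *\<^sub>R (A ** S) = (\<Sum>l=N+1..M. (t powi l) *\<^sub>R (A ** \<sigma> (l - 1) x \<xi>))" .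
      moreover have "{N..M} = insert N {N+1..M}" by (auto simp: N_def M_def)
      ultimately show ?thesis by simp
    qed
    have 4: "(\<Sum>l=N..M. (t powi l) *\<^sub>R (if l = 0 then mat 1 else 0)) = (mat 1 :: complex^4^4)"
    proof -
      have "(\<Sum>l=N..M. (t powi l) *\<^sub>R (if l = 0 then mat 1 else (0::complex^4^4))) =
          (\<Sum>l\<in>{0}. (t powi l) *\<^sub>R (if l = 0 then mat 1 else 0))"
        by (rule sum.mono_neutral_right) (auto simp: N_def M_def)
      then show ?thesis by simp
    qed
    have "(\<Sum>l=N..M. (t powi l) *\<^sub>R a l) = (\<Sum>l=N..M. (t powi l) *\<^sub>R (A ** \<sigma> (l - 1) x \<xi>)) +
        (\<Sum>l=N..M. (t powi l) *\<^sub>R L l) - (\<Sum>l=N..M. (t powi l) *\<^sub>R (if l = 0 then mat 1 else 0))"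
      by (simp only: a_def scaleR_add_right scaleR_diff_right sum.distrib sum_subtractf)
    also have "\<dots> = t *\<^sub>R (A ** S) + (t powi N) *\<^sub>R (A ** \<sigma> (N - 1) x \<xi>) +
        ((\<Sum>k\<in>UNIV. \<alpha> x k ** S' k) + \<beta> x ** S) - mat 1"
      by (simp only: 2 3 4)
    also have "\<dots> = (t powi N) *\<^sub>R (A ** \<sigma> (N - 1) x \<xi>) + r (t *\<^sub>R \<xi>) -
      (t *\<^sub>R (A ** e t) + (\<Sum>k\<in>UNIV. \<alpha> x k ** e' k t) + \<beta> x ** e t)"
      by (rule regroup, use 1 in \<open>simp only: matmul.add_right scaleR_add_right sum.distrib\<close>)
    finally show ?thesis .
  qed
  define C where "C = norm (A ** \<sigma> (N - 1) x \<xi>) + Cr + norm A * Ce * K +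
      (\<Sum>k\<in>UNIV. norm (\<alpha> x k) * \<bar>Ck k\<bar> * K) + norm (\<beta> x) * \<bar>Ce\<bar> * K"
  have bound: "norm (\<Sum>l=N..M. (t powi l) *\<^sub>R a l) \<le> C * t powi N" if t: "t \<ge> t0" for t
  proof -
    have t1: "t \<ge> 1" using t t0 by linarith
    then have tp: "t > 0" by linarith
    have tN: "t * t powi (N - 1) = t powi N" using tp by (simp add: power_int_diff)
    have tN': "t powi (N - 1) \<le> t powi N" using t1 by (intro power_int_increasing) auto
    have b1: "norm (t *\<^sub>R (A ** e t)) \<le> norm A * Ce * K * t powi N"
    proof -
      have "norm (t *\<^sub>R (A ** e t)) \<le> t * (norm A * norm (e t) * K)"
        using K(2)[of A "e t"] tp by simp
      also have "\<dots> \<le> t * (norm A * (Ce * t powi (N - 1)) * K)"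
        using K(1) tp by (intro mult_left_mono mult_right_mono Ce t) auto
      also have "\<dots> = norm A * Ce * K * t powi N" by (simp add: tN[symmetric] mult_ac)
      finally show ?thesis .
    qed
    have b2: "norm (P ** Q) \<le> norm P * \<bar>c\<bar> * K * t powi N"
      if "norm Q \<le> c * t powi (N - 1)" for P Q :: "complex^4^4" and c
    proof -
      have q: "norm Q \<le> \<bar>c\<bar> * t powi N"
        using that tN' tp by (smt (verit) mult_mono zero_le_power_int abs_ge_self abs_ge_zero)
      have "norm P * norm Q * K \<le> norm P * (\<bar>c\<bar> * t powi N) * K"
        using K(1) by (intro mult_right_mono mult_left_mono q) auto
      then show ?thesis using K(2)[of P Q] by (simp add: mult_ac)
    qed
    have "norm (\<Sum>l=N..M. (t powi l) *\<^sub>R a l) \<le> norm ((t powi N) *\<^sub>R (A ** \<sigma> (N - 1) x \<xi>)) + norm (r (t *\<^sub>R \<xi>)) +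
      (norm (t *\<^sub>R (A ** e t)) + norm (\<Sum>k\<in>UNIV. \<alpha> x k ** e' k t) + norm (\<beta> x ** e t))"
      unfolding key[OF t] by (intro norm_triangle_le_diff norm_triangle_le add_mono order_refl)
    also have "\<dots> \<le> t powi N * norm (A ** \<sigma> (N - 1) x \<xi>) + Cr * t powi N +
      (norm A * Ce * K * t powi N + (\<Sum>k\<in>UNIV. norm (\<alpha> x k) * \<bar>Ck k\<bar> * K * t powi N) +
        norm (\<beta> x) * \<bar>Ce\<bar> * K * t powi N)"
      by (intro add_mono Cr'[OF tp] b1 order_trans[OF norm_sum] sum_mono b2 Ck[OF t] Ce[OF t])
        (use tp in simp)
    also have "\<dots> = C * t powi N"
      by (simp add: C_def distrib_right sum_distrib_right)
    finally show ?thesis .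
  qed
  have MN: "M = N + int (nat (M - N))" by (simp add: N_def M_def)
  have "a l = 0"
  proof (rule laurent_coeff_zero[OF t0])
    show "norm (\<Sum>l=N..N + int (nat (M - N)). (t powi l) *\<^sub>R a l) \<le> C * t powi N" if "t \<ge> t0" for t
      using bound[OF that] MN by simp
    show "N < l" by (simp add: N_def)
    show "l \<le> N + int (nat (M - N))" using MN by (simp add: M_def)
  qed
  then show ?thesis by (simp add: a_def A_def L_def)
qed

text \<open>The solution of the recursion, with n standing for degree -n-1: multiplying by the
  inverse R of \<i> A gives \<sigma>_(-1) = R, and each later part is -R times the operator L
  applied to the previous one.\<close>

primrec inverse_symbol_aux ::
  "(real^4 \<Rightarrow> 4 \<Rightarrow> complex^4^4) \<Rightarrow> (real^4 \<Rightarrow> complex^4^4) \<Rightarrow> (real^4 \<Rightarrow> real^4 \<Rightarrow> complex^4^4) \<Rightarrow>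
    nat \<Rightarrow> real^4 \<Rightarrow> real^4 \<Rightarrow> complex^4^4" where
  "inverse_symbol_aux \<alpha> \<beta> R 0 x \<xi> = R x \<xi>"
| "inverse_symbol_aux \<alpha> \<beta> R (Suc n) x \<xi> =
     - (R x \<xi> ** first_order \<alpha> \<beta> (\<lambda>y. inverse_symbol_aux \<alpha> \<beta> R n y \<xi>) x)"

definition inverse_symbol ::
  "(real^4 \<Rightarrow> 4 \<Rightarrow> complex^4^4) \<Rightarrow> (real^4 \<Rightarrow> complex^4^4) \<Rightarrow> (real^4 \<Rightarrow> real^4 \<Rightarrow> complex^4^4) \<Rightarrow>
    int \<Rightarrow> real^4 \<Rightarrow> real^4 \<Rightarrow> complex^4^4" where
  "inverse_symbol \<alpha> \<beta> R l = (if l \<ge> 0 then (\<lambda>x \<xi>. 0) else inverse_symbol_aux \<alpha> \<beta> R (nat (- l - 1)))"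

text \<open>For l > 0 the right side is zero, so the vanishing of \<sigma>_l above m descends degree
  by degree to l = 0. The identity matrix enters at l = 0 and starts the negative degrees. The
  recursion is assumed on all of W because the operator differentiates in x.\<close>

lemma symbol_recursion_solution:
  assumes W: "open W" and xi: "\<xi> \<noteq> 0"
    and inv: "\<And>x. x \<in> W \<Longrightarrow> R x \<xi> ** cscale \<i> (principal_symbol \<alpha> x \<xi>) = mat 1"
    and zero: "\<And>l x. l > m \<Longrightarrow> x \<in> W \<Longrightarrow> \<sigma> l x \<xi> = 0"
    and rec: "\<And>l x. x \<in> W \<Longrightarrow> cscale \<i> (principal_symbol \<alpha> x \<xi>) ** \<sigma> (l - 1) x \<xi> +
      first_order \<alpha> \<beta> (\<lambda>y. \<sigma> l y \<xi>) x = (if l = 0 then mat 1 else 0)"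
    and x: "x \<in> W"
  shows "\<sigma> l x \<xi> = inverse_symbol \<alpha> \<beta> R l x \<xi>"
proof -
  have step: "\<sigma> (l - 1) x \<xi> = (if l = 0 then R x \<xi> else 0) - R x \<xi> ** first_order \<alpha> \<beta> (\<lambda>y. \<sigma> l y \<xi>) x"
    if x: "x \<in> W" for l x
  proof -
    have "cscale \<i> (principal_symbol \<alpha> x \<xi>) ** \<sigma> (l - 1) x \<xi> =
        (if l = 0 then mat 1 else 0) - first_order \<alpha> \<beta> (\<lambda>y. \<sigma> l y \<xi>) x"
      using rec[OF x, of l] by (simp only: eq_diff_eq)
    then have "R x \<xi> ** (cscale \<i> (principal_symbol \<alpha> x \<xi>) ** \<sigma> (l - 1) x \<xi>) =
        R x \<xi> ** ((if l = 0 then mat 1 else 0) - first_order \<alpha> \<beta> (\<lambda>y. \<sigma> l y \<xi>) x)" by simp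
    then show ?thesis
      by (auto simp: matrix_mul_assoc inv[OF x] matmul.diff_right matmul.zero_right split: if_splits)
  qed
  \<comment> \<open>Induction on the distance below m; the bound \<open>l \<ge> 0\<close> keeps the
    step, taken at l + 1, away from the inhomogeneous equation.\<close>
  have nonneg: "\<forall>x\<in>W. \<sigma> l x \<xi> = 0" if "l \<ge> 0" "l > m - int n" for l n
    using that
  proof (induction n arbitrary: l)
    case 0
    then show ?case using zero by simp
  next
    case (Suc n)
    then have "\<forall>y\<in>W. \<sigma> (l + 1) y \<xi> = 0" by simp
    then have "first_order \<alpha> \<beta> (\<lambda>y. \<sigma> (l + 1) y \<xi>) x = 0" if "x \<in> W" for x
      using first_order_cong[OF W that, of "\<lambda>y. \<sigma> (l + 1) y \<xi>" "\<lambda>_. 0"] by (simp add: first_order_zero)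
    then show ?case using step[of _ "l + 1"] Suc.prems(1) by (simp add: matmul.zero_right)
  qed
  have nonneg': "\<sigma> l x \<xi> = 0" if "l \<ge> 0" "x \<in> W" for l x
    using nonneg[of l "nat (m + 1)"] that by force
  have neg: "\<forall>x\<in>W. \<sigma> (- int n - 1) x \<xi> = inverse_symbol_aux \<alpha> \<beta> R n x \<xi>" for n
  proof (induction n)
    case 0
    have "first_order \<alpha> \<beta> (\<lambda>y. \<sigma> 0 y \<xi>) x = 0" if "x \<in> W" for x
      using first_order_cong[OF W that, of "\<lambda>y. \<sigma> 0 y \<xi>" "\<lambda>_. 0"] nonneg'[of 0] by (simp add: first_order_zero)
    then show ?case using step[of _ 0] by (simp add: matmul.zero_right)
  next
    case (Suc n)
    have "first_order \<alpha> \<beta> (\<lambda>y. \<sigma> (- int n - 1) y \<xi>) x =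
        first_order \<alpha> \<beta> (\<lambda>y. inverse_symbol_aux \<alpha> \<beta> R n y \<xi>) x" if "x \<in> W" for x
      by (rule first_order_cong[OF W that]) (use Suc in auto)
    then show ?case using step[of _ "- int n - 1"] by (simp add: algebra_simps)
  qed
  show ?thesis
  proof (cases "l \<ge> 0")
    case True
    then show ?thesis using nonneg'[OF True x] by (simp add: inverse_symbol_def)
  next
    case False
    then have "l = - int (nat (- l - 1)) - 1" by simp
    then show ?thesis using neg[of "nat (- l - 1)"] x False by (simp add: inverse_symbol_def)
  qed
qed

lemma classical_symbol_subset:
  assumes "classical_symbol V m p \<sigma>" "W \<subseteq> V"
  shows "classical_symbol W m p \<sigma>"
proof -
  have "symbol_class W d r" if "symbol_class V d r" for d and r :: "real^4 \<Rightarrow> real^4 \<Rightarrow> complex^4^4"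
    using that assms(2) unfolding symbol_class_def by (meson subset_trans)
  moreover have "smooth_on (W \<times> T) f" if "smooth_on (V \<times> T) f" for T and f :: "(real^4) \<times> (real^4) \<Rightarrow> complex^4^4"
    using smooth_on_subset[OF that] assms(2) by (simp add: Sigma_mono)
  ultimately show ?thesis using assms unfolding classical_symbol_def by (meson subsetD)
qed

text \<open>The conditions on \<sigma> concern \<xi> \<noteq> 0 only, and the remainder is estimated
  for |\<xi>| \<ge> 1, so agreement on the open set \<xi> \<noteq> 0 carries over to all derivatives
  involved.\<close>

lemma classical_symbol_cong:
  assumes cl: "classical_symbol W m p \<sigma>" and W: "open W"
    and eq: "\<And>l x \<xi>. x \<in> W \<Longrightarrow> \<xi> \<noteq> 0 \<Longrightarrow> \<sigma> l x \<xi> = \<sigma>' l x \<xi>"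
  shows "classical_symbol W m p \<sigma>'"
proof -
  note D = classical_symbol_D[OF cl]
  have op: "open (W \<times> (- {0::real^4}))" by (intro open_Times W) auto
  have "smooth_on (W \<times> (- {0})) (\<lambda>(x, \<xi>). \<sigma>' l x \<xi>)" for l
    using smooth_on_cong[OF op, of "\<lambda>(x, \<xi>). \<sigma> l x \<xi>" "\<lambda>(x, \<xi>). \<sigma>' l x \<xi>"] D(2)[of l] eq by auto
  moreover have "\<sigma>' l x (t *\<^sub>R \<xi>) = (t powi l) *\<^sub>R \<sigma>' l x \<xi>" if "x \<in> W" "\<xi> \<noteq> 0" "t > 0" for l x \<xi> t
    using D(3)[OF that, of l] eq[OF that(1), of _ l] that by simp
  moreover have "\<sigma>' l x \<xi> = 0" if "l > m" "x \<in> W" "\<xi> \<noteq> 0" for l x \<xi>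
    using D(4)[OF that(2,3,1)] eq[OF that(2,3)] by simp
  moreover have "symbol_class W (N - 1) (\<lambda>x \<xi>. p x \<xi> - (\<Sum>l=N..m. \<sigma>' l x \<xi>))" for N
  proof -
    have "iter_deriv vs (\<lambda>(y, \<eta>). p y \<eta> - (\<Sum>l=N..m. \<sigma> l y \<eta>)) (x, \<xi>) =
        iter_deriv vs (\<lambda>(y, \<eta>). p y \<eta> - (\<Sum>l=N..m. \<sigma>' l y \<eta>)) (x, \<xi>)"
      if "x \<in> W" "norm \<xi> \<ge> 1" for vs x \<xi>
      by (rule iter_deriv_cong[OF op]) (use that eq in \<open>auto intro!: sum.cong\<close>)
    note iter = this
    show ?thesis
      unfolding symbol_class_def
    proof (intro allI impI)
      fix K :: "(real^4) set" and vs ws :: "(real^4) list"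
      assume K: "compact K \<and> K \<subseteq> W"
      obtain C where C: "\<forall>x\<in>K. \<forall>\<xi>. norm \<xi> \<ge> 1 \<longrightarrow>
          norm (iter_deriv (map (\<lambda>v. (v, 0)) vs @ map (Pair 0) ws) (\<lambda>(y, \<eta>). p y \<eta> - (\<Sum>l=N..m. \<sigma> l y \<eta>)) (x, \<xi>))
          \<le> C * norm \<xi> powi (N - 1 - int (length ws))"
        using D(5)[of N, unfolded symbol_class_def, THEN spec[of _ K], THEN spec[of _ vs],
            THEN spec[of _ ws], THEN mp, OF K] by blast
      show "\<exists>C. \<forall>x\<in>K. \<forall>\<xi>. norm \<xi> \<ge> 1 \<longrightarrow>
          norm (iter_deriv (map (\<lambda>v. (v, 0)) vs @ map (Pair 0) ws) (\<lambda>(y, \<eta>). p y \<eta> - (\<Sum>l=N..m. \<sigma>' l y \<eta>)) (x, \<xi>))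
          \<le> C * norm \<xi> powi (N - 1 - int (length ws))"
      proof (intro exI[of _ C] ballI allI impI)
        fix x \<xi> :: "real^4"
        assume "x \<in> K" "norm \<xi> \<ge> 1"
        then show "norm (iter_deriv (map (\<lambda>v. (v, 0)) vs @ map (Pair 0) ws) (\<lambda>(y, \<eta>). p y \<eta> - (\<Sum>l=N..m. \<sigma>' l y \<eta>)) (x, \<xi>))
          \<le> C * norm \<xi> powi (N - 1 - int (length ws))"
          using C K iter[of x \<xi>] by (subst iter[symmetric]) auto
      qed
    qed
  qed
  ultimately show ?thesis using D(1) unfolding classical_symbol_def by blast
qed

section \<open>The local expression of the Dirac operator\<close>

definition dirac_alpha :: "'m spin_mfd \<Rightarrow> 'm spin_frame \<Rightarrow> real^4 \<Rightarrow> 4 \<Rightarrow> complex^4^4" where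
  "dirac_alpha X a x k = (\<Sum>j\<in>UNIV. (frame a x $ k $ j) *\<^sub>R cliff X j)"

definition dirac_beta :: "'m spin_mfd \<Rightarrow> 'm spin_frame \<Rightarrow> real^4 \<Rightarrow> complex^4^4" where
  "dirac_beta X a x = (\<Sum>j\<in>UNIV. \<Sum>l\<in>UNIV. \<Sum>m\<in>UNIV.
     (conn_form X a x j l m / 4) *\<^sub>R (cliff X j ** (cliff X l ** cliff X m)))"

lemma dirac_local:
  "(\<Sum>j\<in>UNIV. cliff X j *v spin_conn X a j u x) =
    (\<Sum>k\<in>UNIV. dirac_alpha X a x k *v partial k u x) + dirac_beta X a x *v u x"
proof -
  have "(\<Sum>j\<in>UNIV. cliff X j *v (\<Sum>k\<in>UNIV. (frame a x $ k $ j) *\<^sub>R partial k u x)) =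
      (\<Sum>k\<in>UNIV. dirac_alpha X a x k *v partial k u x)"
    unfolding dirac_alpha_def
    by (simp add: matvec.sum_right matvec.sum_left matvec.scaleR_left matvec.scaleR_right)
      (rule sum.swap)
  moreover have "(\<Sum>j\<in>UNIV. cliff X j *v (\<Sum>l\<in>UNIV. \<Sum>m\<in>UNIV.
      (conn_form X a x j l m / 4) *\<^sub>R ((cliff X l ** cliff X m) *v u x))) = dirac_beta X a x *v u x"
    unfolding dirac_beta_def
    by (simp add: matvec.sum_right matvec.sum_left matvec.scaleR_left matvec.scaleR_right
        matrix_vector_mul_assoc)
  ultimately show ?thesis
    by (simp add: spin_conn_def matrix_vector_right_distrib sum.distrib)
qed

text \<open>Adding the double sum to its transpose leaves anticommutators, which vanish off the
  diagonal; the result is twice the claim.\<close>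

lemma cl_vec_sq:
  assumes "clifford_gens c"
  shows "cl_vec c v ** cl_vec c v = cscale (- of_real (v \<bullet> v)) (mat 1)"
proof -
  have anti: "c i ** c j + c j ** c i = (if i = j then mat (- 2) else 0)" for i j
    using assms by (auto simp: clifford_gens_def)
  define s where "s = cl_vec c v ** cl_vec c v"
  have s: "s = (\<Sum>i\<in>UNIV. \<Sum>j\<in>UNIV. (v $ i * v $ j) *\<^sub>R (c i ** c j))"
    by (simp add: s_def cl_vec_def matmul.sum_right matmul.sum_left matmul.scaleR_left
        matmul.scaleR_right scaleR_sum_right) (subst sum.swap, simp add: mult.commute)
  also have "\<dots> = (\<Sum>i\<in>UNIV. \<Sum>j\<in>UNIV. (v $ i * v $ j) *\<^sub>R (c j ** c i))"
    by (subst sum.swap) (simp add: mult.commute)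
  finally have s': "s = (\<Sum>i\<in>UNIV. \<Sum>j\<in>UNIV. (v $ i * v $ j) *\<^sub>R (c j ** c i))" .
  have "s + s = (\<Sum>i\<in>UNIV. \<Sum>j\<in>UNIV. (v $ i * v $ j) *\<^sub>R (c i ** c j + c j ** c i))"
    by (subst s, subst s') (simp add: sum.distrib scaleR_add_right)
  also have "\<dots> = (\<Sum>i\<in>UNIV. (v $ i * v $ i) *\<^sub>R mat (- 2))"
    by (simp add: anti if_distrib cong: if_cong)
  also have "\<dots> = (v \<bullet> v) *\<^sub>R mat (- 2)"
    by (simp add: inner_vec_def scaleR_sum_left)
  also have "\<dots> = cscale (- of_real (v \<bullet> v)) (mat 1) + cscale (- of_real (v \<bullet> v)) (mat 1)"
    by (simp add: vec_eq_iff mat_def) (simp add: scaleR_conv_of_real)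
  finally have "(2::real) *\<^sub>R s = 2 *\<^sub>R cscale (- of_real (v \<bullet> v)) (mat 1)"
    by (simp add: scaleR_2)
  then show ?thesis by (simp add: s_def)
qed

lemma principal_symbol_dirac: "principal_symbol (dirac_alpha X a) x \<xi> = cl_vec (cliff X) (transpose (frame a x) *v \<xi>)"
  unfolding principal_symbol_def dirac_alpha_def cl_vec_def
  by (simp add: matrix_vector_mult_def transpose_def scaleR_sum_left scaleR_sum_right mult.commute)
    (rule sum.swap)

text \<open>Since c(v)^2 = -|v|^2, the inverse of \<i> c(v) is \<i> c(v) / |v|^2; here v is the
  covector \<xi> expressed in the orthonormal frame.\<close>

definition dirac_resolvent :: "'m spin_mfd \<Rightarrow> 'm spin_frame \<Rightarrow> real^4 \<Rightarrow> real^4 \<Rightarrow> complex^4^4" where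
  "dirac_resolvent X a x \<xi> = (let v = transpose (frame a x) *v \<xi> in
     cscale (\<i> / of_real (v \<bullet> v)) (cl_vec (cliff X) v))"

lemma dirac_resolvent_inverse:
  assumes "clifford_gens (cliff X)" "det (frame a x) > 0" "\<xi> \<noteq> 0"
  shows "dirac_resolvent X a x \<xi> ** cscale \<i> (principal_symbol (dirac_alpha X a) x \<xi>) = mat 1"
proof -
  define v where "v = transpose (frame a x) *v \<xi>"
  have "invertible (transpose (frame a x))"
    using assms(2) by (simp add: invertible_det_nz)
  then have "v \<noteq> 0"
    using assms(3) by (metis v_def invertible_def matrix_vector_mul_assoc matrix_vector_mul_lid
        matrix_vector_mult_0_right)
  then show ?thesis
    unfolding dirac_resolvent_def principal_symbol_dirac v_def[symmetric] Let_def
    by (simp add: matmul_cscale_left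
        matmul_cscale_right cl_vec_sq[OF assms(1)] cscale_cscale)
qed

lemma matrix_inv_right_left:
  fixes A :: "'a::semiring_1^'n^'n"
  assumes "invertible A"
  shows "A ** matrix_inv A = mat 1" "matrix_inv A ** A = mat 1"
  using someI_ex[OF assms[unfolded invertible_def]] unfolding matrix_inv_def by blast+

section \<open>Compactly supported local sections\<close>

lemma chart_facts:
  assumes "is_chart \<kappa>"
  shows "open (cdom \<kappa>)" "open (cimg \<kappa>)" "continuous_on (cdom \<kappa>) (cmap \<kappa>)" "continuous_on (cimg \<kappa>) (cinv \<kappa>)"
    and "q \<in> cdom \<kappa> \<Longrightarrow> cinv \<kappa> (cmap \<kappa> q) = q" "q \<in> cdom \<kappa> \<Longrightarrow> cmap \<kappa> q \<in> cimg \<kappa>"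
    and "x \<in> cimg \<kappa> \<Longrightarrow> cmap \<kappa> (cinv \<kappa> x) = x" "x \<in> cimg \<kappa> \<Longrightarrow> cinv \<kappa> x \<in> cdom \<kappa>"
  using assms unfolding is_chart_def homeomorphism_def by auto

lemma chart_open_image:
  assumes "is_chart \<kappa>" "open S" "S \<subseteq> cdom \<kappa>"
  shows "open (cmap \<kappa> ` S)"
proof -
  note c = chart_facts[OF assms(1)]
  have "cmap \<kappa> ` S = cimg \<kappa> \<inter> cinv \<kappa> -` S"
    using assms(3) c(5-8) by (force simp: image_iff)
  then show ?thesis using continuous_open_preimage[OF c(4,2) assms(2)] by simp
qed

lemma spin_mfd_facts:
  assumes "riemannian_spin_mfd X" "a \<in> spin_frames X"
  shows "is_chart (fchart a)" "fchart a \<in> atlas X" "q \<in> fdom a \<Longrightarrow> invertible (triv a q)"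
    "clifford_gens (cliff X)" "x \<in> fimg a \<Longrightarrow> det (frame a x) > 0" "smooth_on (fimg a) (frame a)"
  using assms unfolding riemannian_spin_mfd_def spin_structure_def oriented_atlas_def on_frame_def
  by blast+

lemma local_rep_glob_sec:
  assumes "riemannian_spin_mfd X" "a \<in> spin_frames X" "x \<in> fimg a"
  shows "local_rep a (glob_sec a u) x = u x"
proof -
  note c = chart_facts[OF spin_mfd_facts(1)[OF assms(1,2)]]
  have "invertible (triv a (finv a x))"
    using spin_mfd_facts(3)[OF assms(1,2)] c(8)[OF assms(3)] by blast
  then show ?thesis
    using c(7,8)[OF assms(3)]
    by (simp add: local_rep_def glob_sec_def matrix_vector_mul_assoc matrix_inv_right_left)
qed

text \<open>In another frame b the section is a smooth expression in the transition functions on the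
  overlap with a, and it vanishes off the image of K, which is closed because the manifold is
  Hausdorff. These two open sets cover the domain of b.\<close>

lemma glob_sec_smooth:
  fixes X :: "'m::{t2_space,second_countable_topology} spin_mfd"
  assumes X: "riemannian_spin_mfd X" and a: "a \<in> spin_frames X"
    and u: "smooth_on UNIV u" and K: "compact K" "K \<subseteq> fimg a" "\<And>x. x \<notin> K \<Longrightarrow> u x = 0"
  shows "smooth_section_c X (fdom a) (glob_sec a u)"
proof -
  note ca = chart_facts[OF spin_mfd_facts(1)[OF X a]]
  define K' where "K' = finv a ` K"
  have K': "compact K'" "K' \<subseteq> fdom a"
    unfolding K'_def using K(1,2) ca(4,8) by (auto intro!: compact_continuous_image intro: continuous_on_subset)
  have zero: "glob_sec a u q = 0" if "q \<notin> K'" for q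
  proof (cases "q \<in> fdom a")
    case True
    have "fmap a q \<notin> K"
    proof
      assume "fmap a q \<in> K"
      then have "finv a (fmap a q) \<in> K'" unfolding K'_def by (rule imageI)
      then show False using that ca(5)[OF True] by simp
    qed
    then show ?thesis using K(3) by (simp add: glob_sec_def)
  qed (simp add: glob_sec_def)
  have "smooth_on (fimg b) (local_rep b (glob_sec a u))" if b: "b \<in> spin_frames X" for b
  proof (rule smooth_on_local)
    fix x assume x: "x \<in> fimg b"
    note cb = chart_facts[OF spin_mfd_facts(1)[OF X b]]
    note chb = spin_mfd_facts(1)[OF X b]
    show "\<exists>T. open T \<and> x \<in> T \<and> smooth_on T (local_rep b (glob_sec a u))"
    proof (cases "finv b x \<in> fdom a")
      case True
      define T where "T = fmap b ` (fdom b \<inter> fdom a)"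
      have T: "open T" unfolding T_def
        by (rule chart_open_image[OF chb]) (use ca(1) cb(1) in auto)
      have xT: "x \<in> T" unfolding T_def using True cb(7,8)[OF x] by (metis IntI image_eqI)
      have 1: "smooth_on T (trans_map (fchart b) (fchart a))"
        using X spin_mfd_facts(2)[OF X a] spin_mfd_facts(2)[OF X b]
        unfolding riemannian_spin_mfd_def oriented_atlas_def or_compatible_def T_def by blast
      have 2: "smooth_on T (\<lambda>x. triv_trans b a (finv b x))"
        using X a b unfolding riemannian_spin_mfd_def spin_structure_def T_def by blast
      have 3: "smooth_on T (\<lambda>y. triv_trans b a (finv b y) *v u (trans_map (fchart b) (fchart a) y))"
        by (intro matvec.smooth_on_bilinear T 2 smooth_on_compose[OF T open_UNIV _ 1 u]) auto
      have 4: "local_rep b (glob_sec a u) y = triv_trans b a (finv b y) *v u (trans_map (fchart b) (fchart a) y)"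
        if y: "y \<in> T" for y
      proof -
        obtain q where "y = fmap b q" "q \<in> fdom b" "q \<in> fdom a" using y unfolding T_def by blast
        then show ?thesis using cb(5)
          by (simp add: local_rep_def glob_sec_def triv_trans_def trans_map_def matrix_vector_mul_assoc)
      qed
      show ?thesis by (intro exI[of _ T] conjI T xT) (simp only: smooth_on_cong[OF T 4] 3)
    next
      case False
      define T where "T = fmap b ` (fdom b - K')"
      have T: "open T" unfolding T_def
        by (rule chart_open_image[OF chb]) (use cb(1) compact_imp_closed[OF K'(1)] in auto)
      have xT: "x \<in> T" unfolding T_def using False K'(2) cb(7,8)[OF x]
        by (metis DiffI image_eqI subsetD)
      have 4: "local_rep b (glob_sec a u) y = 0" if y: "y \<in> T" for y
      proof -
        obtain q where "y = fmap b q" "q \<in> fdom b" "q \<notin> K'" using y unfolding T_def by blast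
        then show ?thesis using cb(5) zero by (simp add: local_rep_def matrix_vector_mult_0_right)
      qed
      show ?thesis
        by (intro exI[of _ T] conjI T xT) (simp only: smooth_on_cong[OF T 4] smooth_on_const)
    qed
  qed
  then show ?thesis
    unfolding smooth_section_c_def smooth_section_def using K' zero by blast
qed

section \<open>The symbol of a parametrix of the Dirac operator\<close>

lemma norm_matrix_le_sum: "norm (M :: complex^'n^'m) \<le> (\<Sum>i\<in>UNIV. \<Sum>j\<in>UNIV. norm (M $ i $ j))"
proof -
  have "norm M \<le> (\<Sum>i\<in>UNIV. norm (M $ i))"
    unfolding norm_vec_def[of M] by (rule L2_set_le_sum) simp
  also have "\<dots> \<le> (\<Sum>i\<in>UNIV. \<Sum>j\<in>UNIV. norm (M $ i $ j))"
    unfolding norm_vec_def[of "M $ _"] by (intro sum_mono L2_set_le_sum) simp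
  finally show ?thesis .
qed

text \<open>The symbol of the smoothing remainder D P - 1 after the cutoff: its kernel applied to
  the oscillating test sections, with the phase at x removed.\<close>

definition kernel_symbol ::
  "'m spin_frame \<Rightarrow> (real^4 \<Rightarrow> complex) \<Rightarrow> (real^4 \<Rightarrow> real^4 \<Rightarrow> complex^4^4) \<Rightarrow> real^4 \<Rightarrow> real^4 \<Rightarrow> complex^4^4" where
  "kernel_symbol a f k x \<xi> = (\<chi> i j. exp (- \<i> * of_real (x \<bullet> \<xi>)) *
     (LINT y:fimg a|lborel. k x y *v ((f y * exp (\<i> * of_real (y \<bullet> \<xi>))) *s axis j 1)) $ i)"

lemma kernel_symbol_decay:
  assumes V: "open (fimg a)" and f: "cutoff (fimg a) f"
    and k: "smooth_on (fimg a \<times> fimg a) (\<lambda>(x, y). k x y)" and x: "x \<in> fimg a" and xi: "\<xi> \<noteq> 0"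
  shows "\<exists>C. \<forall>t>0. t ^ N * norm (kernel_symbol a f k x (t *\<^sub>R \<xi>)) \<le> C"
proof -
  obtain K where K: "compact K" "K \<subseteq> fimg a" "\<And>y. y \<notin> K \<Longrightarrow> f y = 0"
    and fs: "smooth_on UNIV f" using f unfolding cutoff_def by blast
  \<comment> \<open>The cutoff gives each kernel entry compact support in the chart, so extension by
    0 is smooth on the whole space although k is controlled on the chart only. The entries of the
    symbol are Fourier integrals of these functions up to a phase.\<close>
  define g where "g i j y = (if y \<in> fimg a then f y * k x y $ i $ j else 0)" for i j y
  have ks: "smooth_on (fimg a) (\<lambda>y. k x y)"
  proof -
    have "smooth_on (fimg a) (\<lambda>y. (x, 0) + (0, y))"
      by (intro smooth_on_add smooth_on_const V
          bounded_linear.smooth_on_bounded_linear[OF _ V smooth_on_id[OF V]] bounded_linear_Pair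
          bounded_linear_zero bounded_linear_ident)
    then have "smooth_on (fimg a) (Pair x)" by simp
    from smooth_on_compose[OF V open_Times[OF V V] _ this k] x show ?thesis by auto
  qed
  have gs: "smooth_on UNIV (g i j)" for i j
  proof (rule smooth_on_local)
    fix y :: "real^4"
    show "\<exists>T. open T \<and> y \<in> T \<and> smooth_on T (g i j)"
    proof (cases "y \<in> fimg a")
      case True
      have "smooth_on (fimg a) (\<lambda>y. f y * k x y $ i $ j)"
        by (intro bounded_bilinear.smooth_on_bilinear[OF bounded_bilinear_mult] V
            smooth_on_subset[OF fs] bounded_linear.smooth_on_bounded_linear[OF bounded_linear_vec_nth] ks) auto
      then have "smooth_on (fimg a) (g i j)"
        using smooth_on_cong[OF V, of "\<lambda>y. f y * k x y $ i $ j" "g i j"] by (simp add: g_def)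
      then show ?thesis using V True by blast
    next
      case False
      have op: "open (- K)" using K(1) compact_imp_closed by blast
      have "smooth_on (- K) (g i j)"
        using smooth_on_cong[OF op, of "\<lambda>_. 0" "g i j"] K(3) by (simp add: g_def smooth_on_const)
      then show ?thesis using op False K(2) by blast
    qed
  qed
  have g0: "g i j y = 0" if "y \<notin> K" for i j y using K(3)[OF that] by (simp add: g_def)
  have int: "(LINT y:fimg a|lborel. k x y *v ((f y * exp (\<i> * of_real (y \<bullet> \<eta>))) *s axis j 1)) $ i =
      (LINT y|lborel. g i j y * exp (\<i> * of_real (y \<bullet> \<eta>)))" for i j \<eta>
  proof -
    define v where "v y = (\<chi> i. g i j y * exp (\<i> * of_real (y \<bullet> \<eta>)))" for y
    have "v y = indicator (fimg a) y *\<^sub>R (k x y *v ((f y * exp (\<i> * of_real (y \<bullet> \<eta>))) *s axis j 1))" for y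
      by (simp add: v_def g_def vec_eq_iff vector_scalar_commute matvec_axis)
    then have "(LINT y:fimg a|lborel. k x y *v ((f y * exp (\<i> * of_real (y \<bullet> \<eta>))) *s axis j 1)) =
        (LINT y|lborel. v y)" by (simp add: set_lebesgue_integral_def)
    moreover have "integrable lborel v"
    proof (rule integrable_compact_support[OF _ K(1)])
      show "continuous_on UNIV v" unfolding v_def
        by (intro continuous_on_vec_lambda continuous_intros smooth_on_continuous_on[OF gs])
    qed (simp add: v_def g0 vec_eq_iff)
    from integral_bounded_linear[OF bounded_linear_vec_nth this, of i]
    have "(LINT y|lborel. v y) $ i = (LINT y|lborel. v y $ i)" by simp
    ultimately show ?thesis by (simp add: v_def)
  qed
  have "\<forall>i j. \<exists>C. \<forall>t>0. t ^ N * norm (LINT y|lborel. g i j y * exp (\<i> * of_real (y \<bullet> (t *\<^sub>R \<xi>)))) \<le> C"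
    using fourier_integral_rapid_decay[OF gs K(1) g0 xi] by blast
  then have "\<exists>C. \<forall>i j. \<forall>t>0. t ^ N * norm (LINT y|lborel. g i j y * exp (\<i> * of_real (y \<bullet> (t *\<^sub>R \<xi>)))) \<le> C i j"
    by (simp only: choice_iff)
  then obtain C where C: "\<forall>i j. \<forall>t>0. t ^ N * norm (LINT y|lborel. g i j y * exp (\<i> * of_real (y \<bullet> (t *\<^sub>R \<xi>)))) \<le> C i j"
    by blast
  have norm_entry: "norm (kernel_symbol a f k x \<eta> $ i $ j) = norm (LINT y|lborel. g i j y * exp (\<i> * of_real (y \<bullet> \<eta>)))"
    for \<eta> i j
    by (simp add: kernel_symbol_def int norm_mult)
  have "t ^ N * norm (kernel_symbol a f k x (t *\<^sub>R \<xi>)) \<le> (\<Sum>i\<in>UNIV. \<Sum>j\<in>UNIV. C i j)" if t: "t > 0" for t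
  proof -
    have "t ^ N * norm (kernel_symbol a f k x (t *\<^sub>R \<xi>)) \<le>
        t ^ N * (\<Sum>i\<in>UNIV. \<Sum>j\<in>UNIV. norm (kernel_symbol a f k x (t *\<^sub>R \<xi>) $ i $ j))"
      using t by (intro mult_left_mono norm_matrix_le_sum) auto
    also have "\<dots> = (\<Sum>i\<in>UNIV. \<Sum>j\<in>UNIV. t ^ N * norm (LINT y|lborel. g i j y * exp (\<i> * of_real (y \<bullet> (t *\<^sub>R \<xi>)))))"
      by (simp only: norm_entry sum_distrib_left)
    also have "\<dots> \<le> (\<Sum>i\<in>UNIV. \<Sum>j\<in>UNIV. C i j)" by (intro sum_mono C[rule_format] t)
    finally show ?thesis .
  qed
  then show ?thesis by blast
qed

text \<open>Test D P = 1 + R on the sections f e^(i<y,\<xi>>) e_j. P maps them to e^(i<y,\<xi>>)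
  times column j of its symbol, to which D applies by the product rule; f = 1 at x turns the
  identity operator into \<open>mat 1\<close>.\<close>

lemma parametrix_symbol_equation:
  fixes X :: "'m::{t2_space,second_countable_topology} spin_mfd"
  assumes X: "riemannian_spin_mfd X" and a: "a \<in> spin_frames X" and D: "dirac_operator X D"
    and lin: "linear_op X P"
    and k: "\<And>s x. smooth_section_c X (fdom a) s \<Longrightarrow> x \<in> fimg a \<Longrightarrow>
      local_rep a (\<lambda>q. D (P s) q - s q) x = (LINT y:fimg a|lborel. k x y *v local_rep a s y)"
    and f: "cutoff (fimg a) f" and x: "x \<in> fimg a" "f x = 1"
    and diff: "(\<lambda>y. loc_symbol a P f y \<xi>) differentiable (at x)"
  shows "cscale \<i> (principal_symbol (dirac_alpha X a) x \<xi>) ** loc_symbol a P f x \<xi> +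
      first_order (dirac_alpha X a) (dirac_beta X a) (\<lambda>y. loc_symbol a P f y \<xi>) x =
      mat 1 + kernel_symbol a f k x \<xi>"
proof -
  define e where "e y = exp (\<i> * of_real (y \<bullet> \<xi>))" for y :: "real^4"
  have e': "exp (- \<i> * of_real (y \<bullet> \<xi>)) = inverse (e y)" for y by (simp add: e_def exp_minus)
  have e0: "e y \<noteq> 0" for y by (simp add: e_def)
  define u where "u j = (\<lambda>y. (f y * e y) *s (axis j 1 :: complex^4))" for j
  define s where "s j = glob_sec a (u j)" for j
  define w where "w j = local_rep a (P (s j))" for j
  define p where "p y = loc_symbol a P f y \<xi>" for y
  \<comment> \<open>The phase is restored: column j of \<open>U\<close> is the local form of P
    applied to the j-th test section.\<close>
  define U where "U y = cscale (e y) (p y)" for y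
  obtain K where K: "compact K" "K \<subseteq> fimg a" "\<And>y. y \<notin> K \<Longrightarrow> f y = 0"
    and fs: "smooth_on UNIV f" using f unfolding cutoff_def by blast
  have us: "smooth_on UNIV (u j)" for j
    unfolding u_def e_def
    by (intro vecscale.smooth_on_bilinear bounded_bilinear.smooth_on_bilinear[OF bounded_bilinear_mult]
        fs smooth_on_cis smooth_on_const open_UNIV)
  have sc: "smooth_section_c X (fdom a) (s j)" for j
    unfolding s_def by (rule glob_sec_smooth[OF X a us K(1,2)]) (simp add: u_def K(3))
  have "smooth_section_c X UNIV (s j)" for j
    using sc[of j] unfolding smooth_section_c_def by (metis subset_UNIV)
  then have Ps: "smooth_section X (P (s j))" for j using lin unfolding linear_op_def by blast
  have pw: "p y $ i $ j = inverse (e y) * w j y $ i" for y i j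
    by (simp add: p_def loc_symbol_def w_def s_def u_def e_def exp_minus)
  have Uw: "U y *v axis j 1 = w j y" for j y
    by (simp add: vec_eq_iff matvec_axis U_def pw e0)
  have de: "(e has_derivative (\<lambda>v. \<i> * of_real (v \<bullet> \<xi>) * e x)) (at x)"
    unfolding e_def by (rule has_derivative_cis)
  have dp: "p differentiable (at x)" using diff by (simp add: p_def[abs_def])
  have dU: "U differentiable (at x)"
    unfolding U_def using cscale.FDERIV[OF de dp[unfolded frechet_derivative_works]]
    by (auto simp: differentiable_def)
  have pU: "partial l U x = cscale (e x) (partial l p x + cscale (\<i> * of_real (\<xi> $ l)) (p x))" for l
  proof -
    have "partial l e x = \<i> * of_real (\<xi> $ l) * e x"
      using partialI[OF de] by (simp add: inner_axis')
    moreover have "e differentiable (at x)" using de by (auto simp: differentiable_def)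
    ultimately show ?thesis unfolding U_def
      by (subst cscale.partial_bilinear) (auto simp: dp cscale.add_right cscale_cscale mult_ac)
  qed
  have pw': "partial l (w j) x = partial l U x *v axis j 1" for l j
  proof -
    have "partial l (w j) x = partial l (\<lambda>y. U y *v axis j 1) x" by (simp add: Uw)
    also have "\<dots> = partial l U x *v axis j 1"
      by (rule bounded_linear.partial_bounded_linear[OF matvec.bounded_linear_left dU])
    finally show ?thesis .
  qed
  have dirac: "((\<Sum>l\<in>UNIV. dirac_alpha X a x l ** partial l U x) + dirac_beta X a x ** U x) *v axis j 1 =
      (cscale (e x) (mat 1 + kernel_symbol a f k x \<xi>)) *v axis j 1" for j
  proof -
    have "((\<Sum>l\<in>UNIV. dirac_alpha X a x l ** partial l U x) + dirac_beta X a x ** U x) *v axis j 1 =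
        (\<Sum>l\<in>UNIV. dirac_alpha X a x l *v partial l (w j) x) + dirac_beta X a x *v w j x"
      by (simp add: matvec.add_left matvec.sum_left matrix_vector_mul_assoc[symmetric] pw' Uw)
    also have "\<dots> = local_rep a (D (P (s j))) x"
      using D Ps[of j] a x(1) dirac_local[of X a "w j" x] unfolding dirac_operator_def w_def by simp
    also have "\<dots> = local_rep a (\<lambda>q. D (P (s j)) q - s j q) x + local_rep a (s j) x"
      by (simp add: local_rep_def matvec.diff_right)
    also have "local_rep a (s j) x = e x *s axis j 1"
      using local_rep_glob_sec[OF X a x(1)] by (simp add: s_def u_def x(2))
    also have "local_rep a (\<lambda>q. D (P (s j)) q - s j q) x =
        (LINT y:fimg a|lborel. k x y *v ((f y * exp (\<i> * of_real (y \<bullet> \<xi>))) *s axis j 1))"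
      unfolding k[OF sc x(1)] set_lebesgue_integral_def
      by (rule Bochner_Integration.integral_cong)
        (auto simp: indicator_def s_def local_rep_glob_sec[OF X a] u_def e_def)
    also have "\<dots> + e x *s axis j 1 = (cscale (e x) (mat 1 + kernel_symbol a f k x \<xi>)) *v axis j 1"
      by (simp add: vec_eq_iff matvec_axis kernel_symbol_def e'[simplified] e0)
        (simp add: mat_def axis_def distrib_left e0)
    finally show ?thesis .
  qed
  have "(\<Sum>l\<in>UNIV. dirac_alpha X a x l ** partial l U x) + dirac_beta X a x ** U x =
      cscale (e x) (mat 1 + kernel_symbol a f k x \<xi>)"
    by (rule matrix_eq_columns) (rule dirac)
  moreover have "(\<Sum>l\<in>UNIV. dirac_alpha X a x l ** partial l U x) + dirac_beta X a x ** U x =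
      cscale (e x) (cscale \<i> (principal_symbol (dirac_alpha X a) x \<xi>) ** p x +
        first_order (dirac_alpha X a) (dirac_beta X a) p x)"
  proof -
    have "dirac_alpha X a x l ** cscale (\<i> * of_real (\<xi> $ l)) (p x) =
        cscale \<i> ((\<xi> $ l) *\<^sub>R dirac_alpha X a x l) ** p x" for l
      by (simp add: matmul_cscale_right matmul_cscale_left matmul.scaleR_left matmul.scaleR_right cscale.scaleR_right
          cscale_of_real)
    then show ?thesis
      by (simp add: pU U_def first_order_def principal_symbol_def matmul_cscale_right matmul.add_right
          cscale.add_right cscale.sum_right sum.distrib matmul.sum_left algebra_simps)
  qed
  ultimately have "cscale (inverse (e x)) (cscale (e x) (cscale \<i> (principal_symbol (dirac_alpha X a) x \<xi>) ** p x +
        first_order (dirac_alpha X a) (dirac_beta X a) p x)) =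
      cscale (inverse (e x)) (cscale (e x) (mat 1 + kernel_symbol a f k x \<xi>))" by simp
  then show ?thesis by (simp add: cscale_cscale e0 p_def[abs_def])
qed

definition dirac_inverse_symbol :: "'m spin_mfd \<Rightarrow> 'm spin_frame \<Rightarrow> int \<Rightarrow> real^4 \<Rightarrow> real^4 \<Rightarrow> complex^4^4" where
  "dirac_inverse_symbol X a =
     inverse_symbol (dirac_alpha X a) (dirac_beta X a) (dirac_resolvent X a)"

text \<open>Any expansion satisfies the recursion, whose solution is explicit, so the homogeneous
  parts depend neither on the cutoff nor on the bound m for the order.\<close>

lemma parametrix_symbol_unique:
  fixes X :: "'m::{t2_space,second_countable_topology} spin_mfd"
  assumes X: "riemannian_spin_mfd X" and a: "a \<in> spin_frames X" and D: "dirac_operator X D"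
    and P: "parametrix X D P" and f: "cutoff (fimg a) f" and W: "open W" "W \<subseteq> fimg a" "\<And>x. x \<in> W \<Longrightarrow> f x = 1"
    and cl: "classical_symbol W m (loc_symbol a P f) \<sigma>" and x: "x \<in> W" and xi: "\<xi> \<noteq> 0"
  shows "\<sigma> l x \<xi> = dirac_inverse_symbol X a l x \<xi>"
proof -
  note c = spin_mfd_facts[OF X a]
  have lin: "linear_op X P" using P by (simp add: parametrix_def pseudodifferential_def)
  have img: "fmap a ` fdom a = fimg a" by (simp add: cimg_def)
  have "smooth_kernel X (\<lambda>s q. D (P s) q - s q) a (fdom a) a (fdom a)"
    using P a unfolding parametrix_def smoothing_def by blast
  then obtain k where k1: "smooth_on (fimg a \<times> fimg a) (\<lambda>(x, y). k x y)"
    and k2: "\<And>s x. smooth_section_c X (fdom a) s \<Longrightarrow> x \<in> fimg a \<Longrightarrow>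
      local_rep a (\<lambda>q. D (P s) q - s q) x = (LINT y:fimg a|lborel. k x y *v local_rep a s y)"
    unfolding smooth_kernel_def img by blast
  have rec: "cscale \<i> (principal_symbol (dirac_alpha X a) x \<xi>) ** \<sigma> (l - 1) x \<xi> +
      first_order (dirac_alpha X a) (dirac_beta X a) (\<lambda>y. \<sigma> l y \<xi>) x = (if l = 0 then mat 1 else 0)"
    if x: "x \<in> W" for x l
  proof (rule symbol_recursion[OF W(1) cl x xi])
    have xa: "x \<in> fimg a" using x W(2) by blast
    show "cscale \<i> (principal_symbol (dirac_alpha X a) x \<eta>) ** loc_symbol a P f x \<eta> +
        first_order (dirac_alpha X a) (dirac_beta X a) (\<lambda>y. loc_symbol a P f y \<eta>) x =
        mat 1 + kernel_symbol a f k x \<eta>" for \<eta>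
    proof (rule parametrix_symbol_equation[OF X a D lin k2 f xa W(3)[OF x]])
      have "(\<lambda>(x, \<xi>). loc_symbol a P f x \<xi>) differentiable (at (x, \<eta>))"
        by (rule smooth_on_differentiable[OF classical_symbol_D(1)[OF cl]]) (use x in auto)
      from differentiable_fst_slice[OF this]
      show "(\<lambda>y. loc_symbol a P f y \<eta>) differentiable (at x)" by (auto simp: differentiable_def)
    qed
    show "\<exists>C. \<forall>t>0. t ^ N * norm (kernel_symbol a f k x (t *\<^sub>R \<xi>)) \<le> C" for N
      by (rule kernel_symbol_decay[OF chart_facts(2)[OF c(1)] f k1 xa xi])
  qed
  show ?thesis
    unfolding dirac_inverse_symbol_def
  proof (rule symbol_recursion_solution[where m = m, OF W(1) xi])
    show "dirac_resolvent X a x \<xi> ** cscale \<i> (principal_symbol (dirac_alpha X a) x \<xi>) = mat 1" if "x \<in> W" for x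
      using dirac_resolvent_inverse[OF c(4) _ xi] c(5) that W(2) by blast
    show "\<sigma> l x \<xi> = 0" if "l > m" "x \<in> W" for l x
      by (rule classical_symbol_D(4)[OF cl that(2) xi that(1)])
  qed (fact rec x)+
qed

text \<open>The choice in \<open>hsymbol\<close> is constrained only if one \<sigma> serves all
  cutoffs at once. The explicit solution does: each cutoff comes with some expansion, which equals
  it where f = 1. Conversely the chosen \<sigma> agrees with it at x, by a cutoff that is 1 near
  x.\<close>

lemma hsymbol_parametrix:
  fixes X :: "'m::{t2_space,second_countable_topology} spin_mfd"
  assumes X: "riemannian_spin_mfd X" and a: "a \<in> spin_frames X" and D: "dirac_operator X D"
    and P: "parametrix X D P" and x: "x \<in> fimg a" and xi: "\<xi> \<noteq> 0"
  shows "hsymbol a P l x \<xi> = dirac_inverse_symbol X a l x \<xi>"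
proof -
  note unique = parametrix_symbol_unique[OF X a D P]
  let ?Q = "\<lambda>\<sigma>. \<forall>f W. cutoff (fimg a) f \<and> open W \<and> W \<subseteq> fimg a \<and> (\<forall>x\<in>W. f x = 1) \<longrightarrow>
     (\<exists>m. classical_symbol W m (loc_symbol a P f) \<sigma>)"
  have "?Q (dirac_inverse_symbol X a)"
  proof (intro allI impI)
    fix f W assume fW: "cutoff (fimg a) f \<and> open W \<and> W \<subseteq> fimg a \<and> (\<forall>x\<in>W. f x = 1)"
    obtain \<sigma> where "classical_symbol (fimg a) (- 1) (loc_symbol a P f) \<sigma>"
      using P a fW unfolding parametrix_def pseudodifferential_def by blast
    then have cl: "classical_symbol W (- 1) (loc_symbol a P f) \<sigma>"
      by (rule classical_symbol_subset) (use fW in blast)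
    have "classical_symbol W (- 1) (loc_symbol a P f) (dirac_inverse_symbol X a)"
    proof (rule classical_symbol_cong[OF cl])
      show "\<sigma> l x \<xi> = dirac_inverse_symbol X a l x \<xi>" if "x \<in> W" "\<xi> \<noteq> 0" for l x \<xi>
        by (rule unique[OF _ _ _ _ cl that]) (use fW in auto)
    qed (use fW in blast)
    then show "\<exists>m. classical_symbol W m (loc_symbol a P f) (dirac_inverse_symbol X a)" by blast
  qed
  then have "?Q (SOME \<sigma>. ?Q \<sigma>)" by (rule someI[of ?Q])
  then have Q: "?Q (hsymbol a P)" by (simp only: hsymbol_def)
  have "open (fimg a)" by (rule chart_facts(2)[OF spin_mfd_facts(1)[OF X a]])
  then obtain f W where fW: "cutoff (fimg a) f" "open W" "x \<in> W" "W \<subseteq> fimg a" "\<forall>x\<in>W. f x = 1"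
    using cutoff_exists x by blast
  then obtain m where "classical_symbol W m (loc_symbol a P f) (hsymbol a P)" using Q by blast
  from unique[OF fW(1,2,4) _ this fW(3) xi] fW(5) show ?thesis by blast
qed

section \<open>The projection \<open>\<pi>\<^sup>+\<close> on rational functions with poles at \<open>\<plusminus>\<i>s\<close>\<close>

text \<open>A principal part of order at most three, the highest that occurs here: \<sigma>_(-2) on
  the boundary has triple poles.\<close>

definition pole_part :: "complex \<Rightarrow> complex \<Rightarrow> complex \<Rightarrow> complex \<Rightarrow> complex \<Rightarrow> complex" where
  "pole_part c u1 u2 u3 z = u1 / (z - c) + u2 / (z - c)\<^sup>2 + u3 / (z - c) ^ 3"

text \<open>Partial fractions in w for fixed z: repeated use of b d = a d + a b, with a, b, d the
  reciprocals of z - c, w - c and z - w, separates the pole at z from the powers of 1/(w -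
  c).\<close>

lemma pole_part_cauchy:
  assumes "z \<noteq> c" "w \<noteq> c" "z \<noteq> w"
  shows "pole_part c u1 u2 u3 w / (z - w) = pole_part c u1 u2 u3 z * (1 / (z - w)) +
    pole_part c u1 u2 u3 z * (1 / (w - c)) + (u2 / (z - c) + u3 / (z - c)\<^sup>2) * (1 / (w - c)\<^sup>2) +
    u3 / (z - c) * (1 / (w - c) ^ 3)"
proof -
  define a where "a = 1 / (z - c)"
  define b where "b = 1 / (w - c)"
  define d where "d = 1 / (z - w)"
  have "b * d = a * d + a * b"
    using assms by (simp add: a_def b_def d_def divide_simps)
  then have "(u1 * b + u2 * b\<^sup>2 + u3 * b ^ 3) * d = (u1 * a + u2 * a\<^sup>2 + u3 * a ^ 3) * d +
    (u1 * a + u2 * a\<^sup>2 + u3 * a ^ 3) * b + (u2 * a + u3 * a\<^sup>2) * b\<^sup>2 + u3 * a * b ^ 3"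
    by algebra
  then show ?thesis by (simp add: pole_part_def a_def b_def d_def power_divide)
qed

text \<open>The contour lies in the upper half plane and z does not, so 1/(z - w) integrates to 0;
  the higher powers of 1/(w - c) have primitives, and the simple pole contributes the winding number
  1.\<close>

lemma contour_integral_upper_pole:
  assumes path: "valid_path \<Gamma>" "pathfinish \<Gamma> = pathstart \<Gamma>" "path_image \<Gamma> \<subseteq> {z. Im z > 0}"
    and c: "c \<notin> path_image \<Gamma>" "winding_number \<Gamma> c = 1" and z: "Im z \<le> 0" "z \<noteq> c"
  shows "((\<lambda>w. pole_part c u1 u2 u3 w / (z - w)) has_contour_integral
    2 * of_real pi * \<i> * pole_part c u1 u2 u3 z) \<Gamma>"
proof -
  have i0: "((\<lambda>w. 1 / (z - w)) has_contour_integral 0) \<Gamma>"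
  proof (rule Cauchy_theorem_convex_simple[OF _ _ path(1,3,2)])
    show "(\<lambda>w. 1 / (z - w)) holomorphic_on {z. Im z > 0}"
      using z(1) by (intro holomorphic_intros) auto
  qed (rule convex_halfspace_Im_gt)
  have i1: "((\<lambda>w. 1 / (w - c)) has_contour_integral 2 * of_real pi * \<i> * 1) \<Gamma>"
    using has_contour_integral_winding_number[OF path(1) c(1)] c(2) by simp
  have i2: "((\<lambda>w. 1 / (w - c)\<^sup>2) has_contour_integral 0) \<Gamma>"
  proof (rule Cauchy_theorem_primitive[OF _ path(1) _ path(2)])
    show "((\<lambda>w. - 1 / (w - c)) has_field_derivative 1 / (w - c)\<^sup>2) (at w within - {c})" if "w \<in> - {c}" for w
      using that by (auto intro!: derivative_eq_intros simp: power2_eq_square)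
  qed (use c(1) in auto)
  have i3: "((\<lambda>w. 1 / (w - c) ^ 3) has_contour_integral 0) \<Gamma>"
  proof (rule Cauchy_theorem_primitive[OF _ path(1) _ path(2)])
    show "((\<lambda>w. - 1 / (2 * (w - c)\<^sup>2)) has_field_derivative 1 / (w - c) ^ 3) (at w within - {c})"
      if "w \<in> - {c}" for w
      using that by (auto intro!: derivative_eq_intros simp: divide_simps power2_eq_square power3_eq_cube)
  qed (use c(1) in auto)
  have "((\<lambda>w. pole_part c u1 u2 u3 z * (1 / (z - w)) +
    pole_part c u1 u2 u3 z * (1 / (w - c)) + (u2 / (z - c) + u3 / (z - c)\<^sup>2) * (1 / (w - c)\<^sup>2) +
    u3 / (z - c) * (1 / (w - c) ^ 3)) has_contour_integral
      pole_part c u1 u2 u3 z * 0 + pole_part c u1 u2 u3 z * (2 * of_real pi * \<i> * 1) +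
      (u2 / (z - c) + u3 / (z - c)\<^sup>2) * 0 + u3 / (z - c) * 0) \<Gamma>"
    by (intro has_contour_integral_add has_contour_integral_lmul i0 i1 i2 i3)
  moreover have "pole_part c u1 u2 u3 z * (1 / (z - w)) +
    pole_part c u1 u2 u3 z * (1 / (w - c)) + (u2 / (z - c) + u3 / (z - c)\<^sup>2) * (1 / (w - c)\<^sup>2) +
    u3 / (z - c) * (1 / (w - c) ^ 3) = pole_part c u1 u2 u3 w / (z - w)" if "w \<in> path_image \<Gamma>" for w
    using pole_part_cauchy[of z c w u1 u2 u3] that c(1) z path(3) by force
  ultimately show ?thesis by (auto intro: has_contour_integral_eq simp: mult_ac)
qed

lemma contour_integral_lower_pole:
  assumes path: "valid_path \<Gamma>" "pathfinish \<Gamma> = pathstart \<Gamma>" "path_image \<Gamma> \<subseteq> {z. Im z > 0}"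
    and c: "Im c \<le> 0" and z: "Im z \<le> 0"
  shows "((\<lambda>w. pole_part c u1 u2 u3 w / (z - w)) has_contour_integral 0) \<Gamma>"
proof (rule Cauchy_theorem_convex_simple[OF _ _ path(1,3,2)])
  show "(\<lambda>w. pole_part c u1 u2 u3 w / (z - w)) holomorphic_on {z. Im z > 0}"
    unfolding pole_part_def using z c by (intro holomorphic_intros) auto
qed (rule convex_halfspace_Im_gt)

definition pole_poly :: "complex \<Rightarrow> complex \<Rightarrow> complex \<Rightarrow> complex \<Rightarrow> complex poly" where
  "pole_poly c u1 u2 u3 = smult u1 ([:- c, 1:]\<^sup>2) + smult u2 [:- c, 1:] + [:u3:]"

lemma poly_pole_poly: "poly (pole_poly c u1 u2 u3) z = u1 * (z - c)\<^sup>2 + u2 * (z - c) + u3"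
  by (simp add: pole_poly_def algebra_simps)

lemma degree_pole_poly: "degree (pole_poly c u1 u2 u3) \<le> 2"
  unfolding pole_poly_def
  by (intro degree_add_le order_trans[OF degree_smult_le]) (simp_all add: degree_power_eq)

lemma pole_poly_eq_0:
  assumes "pole_poly c u1 u2 u3 = 0"
  shows "u1 = 0 \<and> u2 = 0 \<and> u3 = 0"
proof -
  have e: "u1 * (z - c)\<^sup>2 + u2 * (z - c) + u3 = 0" for z
    using poly_pole_poly[of c u1 u2 u3 z] assms by simp
  have "u3 = 0" using e[of c] by simp
  moreover have "u1 + u2 = 0" using e[of "c + 1"] \<open>u3 = 0\<close> by simp
  moreover have "u1 - u2 = 0" using e[of "c - 1"] \<open>u3 = 0\<close> by simp
  ultimately show ?thesis by (auto simp: add_eq_0_iff)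
qed

lemma pole_part_poly: "z \<noteq> c \<Longrightarrow> pole_part c u1 u2 u3 z = poly (pole_poly c u1 u2 u3) z / (z - c) ^ 3"
  unfolding pole_part_def poly_pole_poly
  by (simp add: divide_simps) (simp add: algebra_simps power2_eq_square power3_eq_cube)

lemma poly_eq_on_reals:
  fixes p q :: "complex poly"
  assumes "\<And>x::real. poly p (of_real x) = poly q (of_real x)"
  shows "p = q"
proof (rule ccontr)
  assume "p \<noteq> q"
  then have "finite {z. poly (p - q) z = 0}" by (intro poly_roots_finite) simp
  moreover have "range complex_of_real \<subseteq> {z. poly (p - q) z = 0}" using assms by auto
  ultimately have "finite (range complex_of_real)" by (rule finite_subset[rotated])
  then show False using finite_imageD[of complex_of_real UNIV] by (auto simp: inj_on_def infinite_UNIV_char_0)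
qed

lemma linear_power_dvd_mult:
  fixes p q :: "complex poly"
  assumes "[:- c, 1:] ^ n dvd p * q" "q \<noteq> 0" "order c q = 0"
  shows "[:- c, 1:] ^ n dvd p"
proof (cases "p = 0")
  case False
  then show ?thesis using assms by (simp add: order_divides order_mult)
qed simp

text \<open>\<open>pi_plus\<close> admits every rational representation p/q of h, be it reduced or
  not, and every contour suited to that q. The value must come out the same for all of them.\<close>

lemma pi_plus_contour:
  assumes s: "s > 0" and h: "\<And>x. h x = pole_part (\<i> * of_real s) u1 u2 u3 (of_real x) +
      pole_part (- (\<i> * of_real s)) v1 v2 v3 (of_real x)"
    and pq: "rational_repr p q h" and \<Gamma>: "upper_contour q \<Gamma>" and z: "Im z \<le> 0"
  shows "((\<lambda>w. poly p w / poly q w / (z - w)) has_contour_integral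
    2 * of_real pi * \<i> * pole_part (\<i> * of_real s) u1 u2 u3 z) \<Gamma>"
proof -
  define c where "c = \<i> * of_real s"
  define Pt where "Pt = pole_poly c u1 u2 u3"
  define Qt where "Qt = pole_poly (- c) v1 v2 v3"
  define A where "A = [:c, 1:] ^ 3"
  define B where "B = [:- c, 1:] ^ 3"
  have Im_c: "Im c = s" "c \<noteq> 0" using s by (auto simp: c_def)
  have real_ne: "of_real x \<noteq> c" "of_real x \<noteq> - c" for x
    using s by (auto simp: c_def complex_eq_iff)
  have A: "poly A w = (w + c) ^ 3" and B: "poly B w = (w - c) ^ 3" for w
    by (auto simp: A_def B_def add.commute)
  have AB0: "A \<noteq> 0" "B \<noteq> 0" by (auto simp: A_def B_def)
  have path: "valid_path \<Gamma>" "pathfinish \<Gamma> = pathstart \<Gamma>" "path_image \<Gamma> \<subseteq> {z. Im z > 0}"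
    using \<Gamma> by (auto simp: upper_contour_def)
  have \<Gamma>z: "w \<notin> path_image \<Gamma> \<and> winding_number \<Gamma> w = 1" if "poly q w = 0" "Im w > 0" for w
    using \<Gamma> that by (auto simp: upper_contour_def)
  have q0: "q \<noteq> 0" using pq by (auto simp: rational_repr_def)
  have split: "pole_part c u1 u2 u3 w + pole_part (- c) v1 v2 v3 w = poly (Pt * A + Qt * B) w / poly (A * B) w"
    if "w \<noteq> c" "w \<noteq> - c" for w
  proof -
    have "w - c \<noteq> 0" "w + c \<noteq> 0" using that by (auto simp: eq_neg_iff_add_eq_0)
    then show ?thesis using that
      by (simp add: pole_part_poly A B Pt_def Qt_def divide_simps)
  qed
  \<comment> \<open>The two fractions agree on the real line; cleared of denominators, this is a
    polynomial identity at infinitely many points and so holds in the whole plane.\<close>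
  have pq_eq: "p * (A * B) = (Pt * A + Qt * B) * q"
  proof (rule poly_eq_on_reals)
    fix x
    have f1: "poly p (of_real x) / poly q (of_real x) = poly (Pt * A + Qt * B) (of_real x) / poly (A * B) (of_real x)"
      using pq h[of x] split[OF real_ne[of x]] by (simp add: rational_repr_def c_def)
    have f2: "poly q (of_real x) \<noteq> 0" using pq by (simp add: rational_repr_def)
    have f3: "poly (A * B) (of_real x) \<noteq> 0"
      using real_ne[of x] by (auto simp: A B eq_neg_iff_add_eq_0)
    show "poly (p * (A * B)) (of_real x) = poly ((Pt * A + Qt * B) * q) (of_real x)"
      using f1 unfolding frac_eq_eq[OF f2 f3] by (simp only: poly_mult)
  qed
  show ?thesis
  proof (cases "poly q c = 0")
    case True
    then have c: "c \<notin> path_image \<Gamma>" "winding_number \<Gamma> c = 1" using \<Gamma>z Im_c s by auto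
    have zc: "z \<noteq> c" using z Im_c s by auto
    have "((\<lambda>w. pole_part c u1 u2 u3 w / (z - w) + pole_part (- c) v1 v2 v3 w / (z - w)) has_contour_integral
        2 * of_real pi * \<i> * pole_part c u1 u2 u3 z + 0) \<Gamma>"
      by (intro has_contour_integral_add contour_integral_upper_pole[OF path c z zc]
          contour_integral_lower_pole[OF path _ z]) (use Im_c s in auto)
    moreover have "pole_part c u1 u2 u3 w / (z - w) + pole_part (- c) v1 v2 v3 w / (z - w) =
        poly p w / poly q w / (z - w)" if w: "w \<in> path_image \<Gamma>" for w
    proof -
      have Imw: "Im w > 0" using w path(3) by auto
      then have q: "poly q w \<noteq> 0" using \<Gamma>z w by blast
      have ne: "w \<noteq> c" "w \<noteq> - c" using w c Imw Im_c s by auto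
      have g1: "poly (A * B) w \<noteq> 0" using ne by (auto simp: A B eq_neg_iff_add_eq_0)
      have g2: "poly p w * poly (A * B) w = poly (Pt * A + Qt * B) w * poly q w"
        using arg_cong[OF pq_eq, of "\<lambda>p. poly p w"] by (simp only: poly_mult)
      have "poly p w / poly q w = pole_part c u1 u2 u3 w + pole_part (- c) v1 v2 v3 w"
        unfolding split[OF ne] frac_eq_eq[OF q g1] by (rule g2)
      then show ?thesis by (simp add: add_divide_distrib)
    qed
    ultimately show ?thesis unfolding c_def[symmetric]
      by (auto intro: has_contour_integral_eq)
  next
    case False
    have oq: "order c q = 0" using False q0 by (simp add: order_root)
    have "poly A c \<noteq> 0" using Im_c by (simp add: A)
    then have oA: "order c A = 0" by (rule order_0I)
    have "B dvd (Pt * A + Qt * B) * q" by (metis dvd_mult dvd_triv_right pq_eq)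
    then have "B dvd Pt * A + Qt * B"
      unfolding B_def using q0 oq by (rule linear_power_dvd_mult)
    then have "B dvd Pt * A" by (simp add: dvd_add_left_iff)
    then have "B dvd Pt"
      unfolding B_def using AB0(1) oA by (rule linear_power_dvd_mult)
    have "Pt = 0"
    proof (rule ccontr)
      assume "Pt \<noteq> 0"
      then have "degree B \<le> degree Pt" using \<open>B dvd Pt\<close> by (rule dvd_imp_degree_le[rotated])
      moreover have "degree B = 3" by (simp add: B_def degree_power_eq)
      ultimately show False using degree_pole_poly[of c u1 u2 u3] by (simp add: Pt_def)
    qed
    then have u: "u1 = 0" "u2 = 0" "u3 = 0" using pole_poly_eq_0 by (auto simp: Pt_def)
    have pA: "p * A = Qt * q" using pq_eq AB0 \<open>Pt = 0\<close> by (simp add: mult_ac)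
    have "((\<lambda>w. pole_part (- c) v1 v2 v3 w / (z - w)) has_contour_integral 0) \<Gamma>"
      by (rule contour_integral_lower_pole[OF path _ z]) (use Im_c s in auto)
    moreover have "pole_part (- c) v1 v2 v3 w / (z - w) = poly p w / poly q w / (z - w)"
      if w: "w \<in> path_image \<Gamma>" for w
    proof -
      have Imw: "Im w > 0" using w path(3) by auto
      then have q: "poly q w \<noteq> 0" using \<Gamma>z w by blast
      have ne: "w \<noteq> - c" using Imw Im_c s by auto
      have g1: "poly A w \<noteq> 0" using ne by (auto simp: A eq_neg_iff_add_eq_0)
      have g2: "poly p w * poly A w = poly Qt w * poly q w"
        using arg_cong[OF pA, of "\<lambda>p. poly p w"] by (simp only: poly_mult)
      have "poly p w / poly q w = poly Qt w / poly A w"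
        unfolding frac_eq_eq[OF q g1] by (rule g2)
      then show ?thesis using pole_part_poly[OF ne] by (simp add: Qt_def A)
    qed
    ultimately have "((\<lambda>w. poly p w / poly q w / (z - w)) has_contour_integral 0) \<Gamma>"
      by (rule has_contour_integral_eq)
    then show ?thesis by (simp add: u pole_part_def)
  qed
qed

text \<open>Uniqueness for \<open>THE\<close> is the content of \<open>pi_plus_contour\<close>.
  Existence needs one admissible choice: the common denominator (w + c)^3 (w - c)^3 and a circle
  around c of radius s/2, which stays in the upper half plane.\<close>

lemma pi_plus_eval:
  assumes s: "s > 0" and h: "\<And>x. h x = pole_part (\<i> * of_real s) u1 u2 u3 (of_real x) +
      pole_part (- (\<i> * of_real s)) v1 v2 v3 (of_real x)"
  shows "pi_plus h \<xi> = pole_part (\<i> * of_real s) u1 u2 u3 (of_real \<xi>)"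
proof -
  define c where "c = \<i> * complex_of_real s"
  let ?P = "pole_part c u1 u2 u3"
  have Im_c: "Im c = s" "c \<noteq> 0" using s by (auto simp: c_def)
  have lim: "((\<lambda>u. 1 / (2 * of_real pi * \<i>) * contour_integral \<Gamma>
      (\<lambda>\<eta>. (poly p \<eta> / poly q \<eta>) / (of_real \<xi> + \<i> * of_real u - \<eta>))) \<longlongrightarrow> ?P (of_real \<xi>)) (at_left 0)"
    if "rational_repr p q h" "upper_contour q \<Gamma>" for p q \<Gamma>
  proof (rule Lim_transform_eventually)
    have "of_real \<xi> - c \<noteq> 0" using s by (simp add: c_def complex_eq_iff)
    then have "isCont (\<lambda>u. ?P (of_real \<xi> + \<i> * of_real u)) 0"
      unfolding pole_part_def by (intro continuous_intros) simp_all
    then show "((\<lambda>u. ?P (of_real \<xi> + \<i> * of_real u)) \<longlongrightarrow> ?P (of_real \<xi>)) (at_left 0)"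
      unfolding isCont_def using tendsto_mono[OF at_le[of "{..<0}" UNIV "0::real"]] by fastforce
    show "\<forall>\<^sub>F u in at_left 0. ?P (of_real \<xi> + \<i> * of_real u) = 1 / (2 * of_real pi * \<i>) * contour_integral \<Gamma>
      (\<lambda>\<eta>. (poly p \<eta> / poly q \<eta>) / (of_real \<xi> + \<i> * of_real u - \<eta>))"
    proof (rule eventually_at_leftI[of "- 1"])
      fix u :: real assume "u \<in> {- 1<..<0}"
      then have "Im (of_real \<xi> + \<i> * of_real u) \<le> 0" by simp
      from contour_integral_unique[OF pi_plus_contour[OF s h that this]]
      show "?P (of_real \<xi> + \<i> * of_real u) = 1 / (2 * of_real pi * \<i>) * contour_integral \<Gamma>
      (\<lambda>\<eta>. (poly p \<eta> / poly q \<eta>) / (of_real \<xi> + \<i> * of_real u - \<eta>))"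
        by (simp add: c_def)
    qed simp
  qed
  define A where "A = [:c, 1:] ^ 3"
  define B where "B = [:- c, 1:] ^ 3"
  define p where "p = pole_poly c u1 u2 u3 * A + pole_poly (- c) v1 v2 v3 * B"
  have A: "poly A w = (w + c) ^ 3" and B: "poly B w = (w - c) ^ 3" for w
    by (auto simp: A_def B_def add.commute)
  have dA: "degree A = 3" and dB: "degree B = 3" by (auto simp: A_def B_def degree_power_eq)
  have real_ne: "of_real x \<noteq> c" "of_real x \<noteq> - c" for x
    using s by (auto simp: c_def complex_eq_iff)
  have "rational_repr p (A * B) h"
    unfolding rational_repr_def
  proof (intro conjI allI)
    have "degree p \<le> 5" unfolding p_def
      by (intro degree_add_le order_trans[OF degree_mult_le])
        (use degree_pole_poly[of c u1 u2 u3] degree_pole_poly[of "- c" v1 v2 v3] dA dB in auto)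
    moreover have "degree (A * B) = 6"
      using dA dB by (subst degree_mult_eq) (auto simp: A_def B_def)
    ultimately show "degree p < degree (A * B)" by simp
    fix x
    have ne: "of_real x - c \<noteq> 0" "of_real x + c \<noteq> 0" using real_ne[of x] by (auto simp: eq_neg_iff_add_eq_0)
    then show "poly (A * B) (of_real x) \<noteq> 0" by (simp add: A B)
    show "h x = poly p (of_real x) / poly (A * B) (of_real x)"
      unfolding h c_def[symmetric] p_def using ne real_ne[of x]
      by (simp add: pole_part_poly A B divide_simps)
  qed
  moreover have "upper_contour (A * B) (circlepath c (s / 2))"
    unfolding upper_contour_def
  proof (intro conjI allI impI)
    have "Im z > 0" if "dist c z = s / 2" for z
    proof -
      have "\<bar>Im c - Im z\<bar> \<le> s / 2" using abs_Im_le_cmod[of "c - z"] that by (simp add: dist_norm)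
      then show ?thesis using Im_c(1) s by linarith
    qed
    then show "path_image (circlepath c (s / 2)) \<subseteq> {z. Im z > 0}"
      using s by (auto simp: path_image_circlepath sphere_def)
    fix z assume "poly (A * B) z = 0 \<and> Im z > 0"
    then have "z = c" using Im_c s by (auto simp: A B add_eq_0_iff2)
    then show "z \<notin> path_image (circlepath c (s / 2))" "winding_number (circlepath c (s / 2)) z = 1"
      using s by (auto simp: path_image_circlepath winding_number_circlepath_centre)
  qed auto
  ultimately have ex: "\<exists>p q \<Gamma>. rational_repr p q h \<and> upper_contour q \<Gamma> \<and>
     ((\<lambda>u. 1 / (2 * of_real pi * \<i>) * contour_integral \<Gamma>
         (\<lambda>\<eta>. (poly p \<eta> / poly q \<eta>) / (of_real \<xi> + \<i> * of_real u - \<eta>))) \<longlongrightarrow> ?P (of_real \<xi>)) (at_left 0)"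
    using lim by blast
  show ?thesis
    unfolding pi_plus_def c_def[symmetric]
  proof (rule the_equality, rule ex)
    fix w assume "\<exists>p q \<Gamma>. rational_repr p q h \<and> upper_contour q \<Gamma> \<and>
     ((\<lambda>u. 1 / (2 * of_real pi * \<i>) * contour_integral \<Gamma>
         (\<lambda>\<eta>. (poly p \<eta> / poly q \<eta>) / (of_real \<xi> + \<i> * of_real u - \<eta>))) \<longlongrightarrow> w) (at_left 0)"
    then obtain p q \<Gamma> where "rational_repr p q h" "upper_contour q \<Gamma>"
      and w: "((\<lambda>u. 1 / (2 * of_real pi * \<i>) * contour_integral \<Gamma>
         (\<lambda>\<eta>. (poly p \<eta> / poly q \<eta>) / (of_real \<xi> + \<i> * of_real u - \<eta>))) \<longlongrightarrow> w) (at_left 0)" by blast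
    then show "w = ?P (of_real \<xi>)" by (intro tendsto_unique[OF trivial_limit_at_left_real w] lim)
  qed
qed

section \<open>Integrals of rational functions over the real line\<close>

lemma tendsto_inverse_shift:
  "((\<lambda>t. 1 / (of_real t - \<i> * of_real r)) \<longlongrightarrow> 0) at_top" (is ?A)
  "((\<lambda>t. 1 / (of_real t - \<i> * of_real r)) \<longlongrightarrow> 0) at_bot" (is ?B)
proof -
  have b: "norm (1 / (of_real t - \<i> * of_real r)) \<le> 1 / \<bar>t\<bar>" if "t \<noteq> 0" for t :: real
    using abs_Re_le_cmod[of "of_real t - \<i> * of_real r"] that by (simp add: norm_divide frac_le)
  have "((\<lambda>t::real. 1 / \<bar>t\<bar>) \<longlongrightarrow> 0) at_top" "((\<lambda>t::real. 1 / \<bar>t\<bar>) \<longlongrightarrow> 0) at_bot" by real_asymp+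
  moreover have "\<forall>\<^sub>F t in at_top. norm (1 / (of_real t - \<i> * of_real r)) \<le> 1 / \<bar>t\<bar>"
    using eventually_gt_at_top[of 0] by eventually_elim (rule b, simp)
  moreover have "\<forall>\<^sub>F t in at_bot. norm (1 / (of_real t - \<i> * of_real r)) \<le> 1 / \<bar>t\<bar>"
    using eventually_gt_at_bot[of 0] by eventually_elim (rule b, simp)
  ultimately show ?A ?B by (auto intro: Lim_null_comparison)
qed

lemma arctan_limits:
  assumes "r > (0::real)"
  shows "((\<lambda>t. arctan (t / r) / r) \<longlongrightarrow> - (pi / 2) / r) at_bot"
    and "((\<lambda>t. arctan (t / r) / r) \<longlongrightarrow> pi / 2 / r) at_top"
proof -
  have f: "filterlim (\<lambda>t. t / r) at_bot at_bot" "filterlim (\<lambda>t. t / r) at_top at_top"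
    using assms by real_asymp+
  show "((\<lambda>t. arctan (t / r) / r) \<longlongrightarrow> - (pi / 2) / r) at_bot"
    by (rule tendsto_divide[OF filterlim_compose[OF tendsto_arctan_at_bot f(1)] tendsto_const])
      (use assms in simp)
  show "((\<lambda>t. arctan (t / r) / r) \<longlongrightarrow> pi / 2 / r) at_top"
    by (rule tendsto_divide[OF filterlim_compose[OF tendsto_arctan_at_top f(2)] tendsto_const])
      (use assms in simp)
qed

lemma arctan_derivative:
  assumes "r > (0::real)"
  shows "((\<lambda>t. arctan (t / r) / r) has_real_derivative 1 / (t\<^sup>2 + r\<^sup>2)) (at t)"
proof -
  have "inverse (1 + (t / r)\<^sup>2) * (1 / r) / r = 1 / (t\<^sup>2 + r\<^sup>2)"
    using assms by (simp add: divide_simps power2_eq_square)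
  then show ?thesis using assms by (auto intro!: derivative_eq_intros)
qed

text \<open>The comparison function 1/(t^2 + r^2) has the bounded primitive arctan(t/r)/r, so f is
  integrable, and the fundamental theorem with limits at both ends gives the value.\<close>

lemma real_line_FTC:
  fixes F f :: "real \<Rightarrow> complex"
  assumes r: "r > 0" and F: "\<And>t. (F has_vector_derivative f t) (at t)" and f: "continuous_on UNIV f"
    and b: "\<And>t. norm (f t) \<le> C * (1 / (t\<^sup>2 + r\<^sup>2))" and lim: "(F \<longlongrightarrow> A) at_bot" "(F \<longlongrightarrow> B) at_top"
  shows "has_bochner_integral lborel f (B - A)"
proof -
  note g = arctan_derivative[OF r]
  have "set_integrable lborel (einterval (-\<infinity>) \<infinity>) (\<lambda>t. 1 / (t\<^sup>2 + r\<^sup>2))"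
  proof (rule interval_integral_FTC_nonneg(1)[where F = "\<lambda>t. arctan (t / r) / r"
        and A = "- (pi / 2) / r" and B = "pi / 2 / r"])
    show "isCont (\<lambda>t. 1 / (t\<^sup>2 + r\<^sup>2)) t" for t
      using r by (intro continuous_intros) (auto simp: add_nonneg_eq_0_iff)
    have "((\<lambda>t. arctan (t / r) / r) \<longlongrightarrow> - (pi / 2) / r) at_bot"
      by (rule arctan_limits[OF r])
    then show "(((\<lambda>t. arctan (t / r) / r) \<circ> real_of_ereal) \<longlongrightarrow> - (pi / 2) / r) (at_right (- \<infinity>))"
      by (simp add: ereal_tendsto_simps)
    have "((\<lambda>t. arctan (t / r) / r) \<longlongrightarrow> pi / 2 / r) at_top"
      by (rule arctan_limits[OF r])
    then show "(((\<lambda>t. arctan (t / r) / r) \<circ> real_of_ereal) \<longlongrightarrow> pi / 2 / r) (at_left \<infinity>)"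
      by (simp add: ereal_tendsto_simps)
  qed (use g in auto)
  then have gi: "integrable lborel (\<lambda>t. 1 / (t\<^sup>2 + r\<^sup>2))"
    by (simp add: set_integrable_def)
  have fi: "integrable lborel f"
  proof (rule Bochner_Integration.integrable_bound[OF integrable_mult_right[OF gi, of C]])
    show "f \<in> borel_measurable lborel" using borel_measurable_continuous_onI[OF f] by simp
    show "AE t in lborel. norm (f t) \<le> norm (C * (1 / (t\<^sup>2 + r\<^sup>2)))"
      by (intro AE_I2 order_trans[OF b]) (simp only: real_norm_def abs_ge_self)
  qed
  have "(LBINT x=-\<infinity>..\<infinity>. f x) = B - A"
    by (rule interval_integral_FTC_integrable[where F = F])
      (use F f fi lim in \<open>auto simp: ereal_tendsto_simps set_integrable_def continuous_on_eq_continuous_at\<close>)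
  then have "(LINT t|lborel. f t) = B - A"
    by (simp add: interval_lebesgue_integral_def set_lebesgue_integral_def)
  then show ?thesis using fi by (simp add: has_bochner_integral_iff)
qed

lemma real_shift_nonzero: "r \<noteq> 0 \<Longrightarrow> of_real t - \<i> * of_real r \<noteq> 0"
  by (auto simp: complex_eq_iff)

lemma norm_real_shift: "(norm (of_real t - \<i> * of_real r))\<^sup>2 = t\<^sup>2 + r\<^sup>2"
  by (simp add: cmod_power2)

lemma integral_inverse_square:
  assumes r: "r \<noteq> (0::real)"
  shows "has_bochner_integral lborel (\<lambda>t. 1 / (of_real t - \<i> * of_real r)\<^sup>2) 0"
proof -
  note nz = real_shift_nonzero[OF r]
  have "has_bochner_integral lborel (\<lambda>t. 1 / (of_real t - \<i> * of_real r)\<^sup>2) (0 - 0)"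
  proof (rule real_line_FTC[where r = "\<bar>r\<bar>" and C = 1])
    show "((\<lambda>t. - (1 / (of_real t - \<i> * of_real r))) has_vector_derivative 1 / (of_real t - \<i> * of_real r)\<^sup>2) (at t)" for t
    proof -
      have "((\<lambda>z. - (1 / (z - \<i> * of_real r))) has_field_derivative 1 / (of_real t - \<i> * of_real r)\<^sup>2) (at (of_real t))"
        using nz by (auto intro!: derivative_eq_intros simp: power2_eq_square)
      then show ?thesis by (rule has_vector_derivative_real_field)
    qed
    show "continuous_on UNIV (\<lambda>t. 1 / (of_real t - \<i> * of_real r)\<^sup>2)"
      using nz by (intro continuous_intros) auto
    show "norm (1 / (of_real t - \<i> * of_real r)\<^sup>2) \<le> 1 * (1 / (t\<^sup>2 + \<bar>r\<bar>\<^sup>2))" for t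
      by (simp add: norm_divide norm_power norm_real_shift)
    show "((\<lambda>t. - (1 / (of_real t - \<i> * of_real r))) \<longlongrightarrow> 0) at_bot"
      "((\<lambda>t. - (1 / (of_real t - \<i> * of_real r))) \<longlongrightarrow> 0) at_top"
      using tendsto_minus[OF tendsto_inverse_shift(1)[of r]] tendsto_minus[OF tendsto_inverse_shift(2)[of r]]
      by auto
  qed (use r in auto)
  then show ?thesis by simp
qed

lemma integral_inverse_cube:
  assumes r: "r > (0::real)"
  shows "has_bochner_integral lborel (\<lambda>t. 1 / (of_real t - \<i> * of_real r) ^ 3) 0"
proof -
  have nz: "of_real t - \<i> * of_real r \<noteq> 0" for t using real_shift_nonzero r by auto
  have "has_bochner_integral lborel (\<lambda>t. 1 / (of_real t - \<i> * of_real r) ^ 3) (- (0\<^sup>2 / 2) - - (0\<^sup>2 / 2))"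
  proof (rule real_line_FTC[where r = r and C = "1 / r"])
    show "((\<lambda>t. - ((1 / (of_real t - \<i> * of_real r))\<^sup>2 / 2)) has_vector_derivative 1 / (of_real t - \<i> * of_real r) ^ 3) (at t)" for t
    proof -
      have "((\<lambda>z. - 1 / (2 * (z - c)\<^sup>2)) has_field_derivative 1 / (w - c) ^ 3) (at w)" if "w - c \<noteq> 0" for w c :: complex
        using that by (auto intro!: derivative_eq_intros simp: divide_simps power2_eq_square power3_eq_cube)
      from has_vector_derivative_real_field[OF this[OF nz]] show ?thesis by (simp add: power_divide mult.commute)
    qed
    show "continuous_on UNIV (\<lambda>t. 1 / (of_real t - \<i> * of_real r) ^ 3)"
      using nz by (intro continuous_intros) auto
    show "norm (1 / (of_real t - \<i> * of_real r) ^ 3) \<le> 1 / r * (1 / (t\<^sup>2 + r\<^sup>2))" for t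
    proof -
      let ?n = "norm (of_real t - \<i> * of_real r)"
      have "r \<le> ?n" using abs_Im_le_cmod[of "of_real t - \<i> * of_real r"] by simp
      moreover have "?n ^ 3 = ?n * (t\<^sup>2 + r\<^sup>2)"
        using norm_real_shift[of t r] by (simp add: power3_eq_cube power2_eq_square)
      moreover have "t\<^sup>2 + r\<^sup>2 > 0" using r by (simp add: add_nonneg_pos)
      ultimately show ?thesis using r
        by (simp add: norm_divide norm_power divide_simps mult_right_mono)
    qed
    show "((\<lambda>t. - ((1 / (of_real t - \<i> * of_real r))\<^sup>2 / 2)) \<longlongrightarrow> - (0\<^sup>2 / 2)) at_bot"
      "((\<lambda>t. - ((1 / (of_real t - \<i> * of_real r))\<^sup>2 / 2)) \<longlongrightarrow> - (0\<^sup>2 / 2)) at_top"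
      by (intro tendsto_intros tendsto_inverse_shift; simp)+
  qed (use r in auto)
  then show ?thesis by simp
qed

lemma integral_inverse_quadratic:
  assumes r: "r > (0::real)"
  shows "has_bochner_integral lborel (\<lambda>t. 1 / ((of_real t - \<i> * of_real r) * (of_real t + \<i> * of_real r)))
    (complex_of_real (pi / r))"
proof -
  have prod: "(of_real t - \<i> * of_real r) * (of_real t + \<i> * of_real r) = complex_of_real (t\<^sup>2 + r\<^sup>2)" for t
    by (simp add: algebra_simps power2_eq_square)
  have pos: "t\<^sup>2 + r\<^sup>2 > 0" for t :: real using r by (simp add: add_nonneg_pos)
  have "has_bochner_integral lborel (\<lambda>t. complex_of_real (1 / (t\<^sup>2 + r\<^sup>2)))
      (complex_of_real (pi / 2 / r) - complex_of_real (- (pi / 2) / r))"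
  proof (rule real_line_FTC[where r = r and C = 1])
    show "((\<lambda>t. complex_of_real (arctan (t / r) / r)) has_vector_derivative complex_of_real (1 / (t\<^sup>2 + r\<^sup>2))) (at t)" for t
      using arctan_derivative[OF r]
      by (intro has_vector_derivative_of_real) (simp add: has_real_derivative_iff_has_vector_derivative)
    show "continuous_on UNIV (\<lambda>t. complex_of_real (1 / (t\<^sup>2 + r\<^sup>2)))"
      using pos by (intro continuous_intros) (auto simp: less_le)
    show "norm (complex_of_real (1 / (t\<^sup>2 + r\<^sup>2))) \<le> 1 * (1 / (t\<^sup>2 + r\<^sup>2))" for t
      using pos[of t] by (simp only: norm_of_real) simp
    show "((\<lambda>t. complex_of_real (arctan (t / r) / r)) \<longlongrightarrow> complex_of_real (- (pi / 2) / r)) at_bot"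
      by (rule tendsto_of_real[OF arctan_limits(1)[OF r]])
    show "((\<lambda>t. complex_of_real (arctan (t / r) / r)) \<longlongrightarrow> complex_of_real (pi / 2 / r)) at_top"
      by (rule tendsto_of_real[OF arctan_limits(2)[OF r]])
  qed (use r in auto)
  moreover have "complex_of_real (pi / 2 / r) - complex_of_real (- (pi / 2) / r) = complex_of_real (pi / r)"
    by (simp add: field_simps)
  ultimately show ?thesis by (simp only: prod of_real_divide of_real_1)
qed

text \<open>These are the \<xi>_n-integrands of the two densities up to constant factors. In partial
  fractions the squares and cubes of 1/z and 1/w integrate to 0, and 1/(z w) has the coefficient
  -4/k^2 = 1/r^2 in both cases, hence the equal values.\<close>

lemma residue_integral_pairs:
  assumes r: "r > (0::real)"
  defines "z \<equiv> \<lambda>t. complex_of_real t - \<i> * of_real r" and "w \<equiv> \<lambda>t. complex_of_real t + \<i> * of_real r"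
  shows "has_bochner_integral lborel (\<lambda>t. 2 / (z t * w t ^ 3) + 4 * \<i> * of_real r / ((z t)\<^sup>2 * w t ^ 3))
      (of_real (pi / r ^ 3))"
    and "has_bochner_integral lborel (\<lambda>t. 1 / (2 * ((z t)\<^sup>2 * (w t)\<^sup>2)) - 2 * \<i> * of_real r / (z t ^ 3 * (w t)\<^sup>2))
      (of_real (pi / r ^ 3))"
proof -
  define k where "k = 2 * \<i> * complex_of_real r"
  have k: "k \<noteq> 0" using r by (simp add: k_def)
  have wz: "w t = z t + k" for t by (simp add: w_def z_def k_def)
  have nz: "z t \<noteq> 0" "w t \<noteq> 0" for t
    using real_shift_nonzero[of r t] real_shift_nonzero[of "- r" t] r by (auto simp: z_def w_def)
  have k2: "k\<^sup>2 = - 4 * of_real (r\<^sup>2)" by (simp add: k_def power2_eq_square)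
  have I: "has_bochner_integral lborel (\<lambda>t. 1 / (z t)\<^sup>2) 0" "has_bochner_integral lborel (\<lambda>t. 1 / (w t)\<^sup>2) 0"
    "has_bochner_integral lborel (\<lambda>t. 1 / z t ^ 3) 0"
    "has_bochner_integral lborel (\<lambda>t. 1 / (z t * w t)) (of_real (pi / r))"
    using integral_inverse_square[of r] integral_inverse_square[of "- r"] integral_inverse_cube[OF r]
      integral_inverse_quadratic[OF r] r
    by (simp_all add: z_def w_def)
  \<comment> \<open>With 4 \<i> r = 2 k and z + k = w the integrand is 2/(z^2 w^2); squaring 1/(z w)
    = (1/z - 1/w)/k gives the coefficients.\<close>
  have "has_bochner_integral lborel (\<lambda>t. 2 / k\<^sup>2 * (1 / (z t)\<^sup>2) + 2 / k\<^sup>2 * (1 / (w t)\<^sup>2) + - 4 / k\<^sup>2 * (1 / (z t * w t)))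
      (2 / k\<^sup>2 * 0 + 2 / k\<^sup>2 * 0 + - 4 / k\<^sup>2 * of_real (pi / r))"
    by (intro has_bochner_integral_add has_bochner_integral_mult_right I)
  moreover have "2 / k\<^sup>2 * (1 / (z t)\<^sup>2) + 2 / k\<^sup>2 * (1 / (w t)\<^sup>2) + - 4 / k\<^sup>2 * (1 / (z t * w t)) =
      2 / (z t * w t ^ 3) + 4 * \<i> * of_real r / ((z t)\<^sup>2 * w t ^ 3)" for t
  proof -
    have a: "4 * \<i> * of_real r = 2 * k" by (simp add: k_def)
    show ?thesis unfolding a using k nz[of t] unfolding wz
      by (simp add: divide_simps) algebra
  qed
  moreover have "2 / k\<^sup>2 * 0 + 2 / k\<^sup>2 * 0 + - 4 / k\<^sup>2 * of_real (pi / r) = of_real (pi / r ^ 3)"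
    unfolding k2 using r by (simp add: field_simps power2_eq_square power3_eq_cube)
  ultimately show "has_bochner_integral lborel (\<lambda>t. 2 / (z t * w t ^ 3) + 4 * \<i> * of_real r / ((z t)\<^sup>2 * w t ^ 3))
      (of_real (pi / r ^ 3))" by simp
  \<comment> \<open>For 1/z^2, 1/w^2 and 1/(z w) in this order, 1/(2 z^2 w^2) has the coefficients
    1/2, 1/2, -1 over k^2, and -k/(z^3 w^2) has 2, 1, -3 over k^2 besides -1/k for 1/z^3.\<close>
  have "has_bochner_integral lborel (\<lambda>t. 5 / (2 * k\<^sup>2) * (1 / (z t)\<^sup>2) + 3 / (2 * k\<^sup>2) * (1 / (w t)\<^sup>2) +
        - 1 / k * (1 / z t ^ 3) + - 4 / k\<^sup>2 * (1 / (z t * w t)))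
      (5 / (2 * k\<^sup>2) * 0 + 3 / (2 * k\<^sup>2) * 0 + - 1 / k * 0 + - 4 / k\<^sup>2 * of_real (pi / r))"
    by (intro has_bochner_integral_add has_bochner_integral_mult_right I)
  moreover have "5 / (2 * k\<^sup>2) * (1 / (z t)\<^sup>2) + 3 / (2 * k\<^sup>2) * (1 / (w t)\<^sup>2) +
        - 1 / k * (1 / z t ^ 3) + - 4 / k\<^sup>2 * (1 / (z t * w t)) =
      1 / (2 * ((z t)\<^sup>2 * (w t)\<^sup>2)) - 2 * \<i> * of_real r / (z t ^ 3 * (w t)\<^sup>2)" for t
  proof -
    have a: "2 * \<i> * of_real r = k" by (simp add: k_def)
    show ?thesis unfolding a using k nz[of t] unfolding wz
      by (simp add: divide_simps) algebra
  qed
  moreover have "5 / (2 * k\<^sup>2) * 0 + 3 / (2 * k\<^sup>2) * 0 + - 1 / k * 0 + - 4 / k\<^sup>2 * of_real (pi / r) = of_real (pi / r ^ 3)"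
    unfolding k2 using r by (simp add: field_simps power2_eq_square power3_eq_cube)
  ultimately show "has_bochner_integral lborel (\<lambda>t. 1 / (2 * ((z t)\<^sup>2 * (w t)\<^sup>2)) - 2 * \<i> * of_real r / (z t ^ 3 * (w t)\<^sup>2))
      (of_real (pi / r ^ 3))" by simp
qed

section \<open>Coordinates adapted to the boundary\<close>

lemma inc_simps [simp]: "inc 1 = 1" "inc 2 = 2" "inc 3 = 3"
  by (simp_all add: inc_def)

lemma inc_neq_4 [simp]: "inc i \<noteq> 4" "4 \<noteq> inc i"
  using exhaust_3[of i] by auto

lemma inc_inject [simp]: "inc i = inc j \<longleftrightarrow> i = j"
  using exhaust_3[of i] exhaust_3[of j] by auto

lemma index_cases:
  fixes k :: 4
  obtains "k = 4" | i where "k = inc i"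
  using exhaust_4[of k] inc_simps by metis

lemma join_nth [simp]: "join y t $ 4 = t" "join y t $ inc i = y $ i"
proof -
  show "join y t $ 4 = t" by (simp add: join_def axis_def)
  have "(\<Sum>j\<in>UNIV. y $ j * (if inc i = inc j then 1 else 0)) = y $ i"
    by (simp add: if_distrib cong: if_cong)
  then show "join y t $ inc i = y $ i" by (simp add: join_def axis_def eq_commute)
qed

lemma tang_join [simp]: "tang (join y t) = y"
  by (simp add: tang_def vec_eq_iff)

lemma join_eqI: "(x :: real^4) $ 4 = t \<Longrightarrow> tang x = y \<Longrightarrow> x = join y t"
  by (auto simp: vec_eq_iff tang_def) (metis index_cases join_nth)

lemma sum_UNIV_4_split: "(\<Sum>k\<in>UNIV. f k) = (\<Sum>i\<in>UNIV. f (inc i)) + f (4::4)"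
  by (simp add: sum_4 sum_3)

text \<open>Near the boundary the local data of a flat frame depend on x_n alone, so their
  tangential derivatives drop out.\<close>

lemma partial_of_last:
  fixes x :: "real^4"
  assumes T: "open T" "x \<in> T" "\<And>y :: real^4. y \<in> T \<Longrightarrow> f y = F (y $ 4)"
    and F: "(F has_vector_derivative F') (at (x $ 4))"
  shows "partial k f x = (if k = 4 then F' else 0)"
proof -
  have "((\<lambda>y :: real^4. y $ 4) has_derivative (\<lambda>v. v $ 4)) (at x)"
    by (rule bounded_linear_imp_has_derivative[OF bounded_linear_vec_nth])
  from has_derivative_compose[OF this F[unfolded has_vector_derivative_def]]
  have "partial k (\<lambda>y :: real^4. F (y $ 4)) x = ((axis k 1 :: real^4) $ 4) *\<^sub>R F'" by (rule partialI)
  then show ?thesis using partial_cong[OF T] by (auto simp: axis_def)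
qed

lemma has_vector_derivative_partial:
  assumes "f differentiable (at x)"
  shows "((\<lambda>r. f (x + r *\<^sub>R axis k 1)) has_vector_derivative partial k f x) (at 0)"
proof -
  have "((\<lambda>r. x + r *\<^sub>R axis k 1) has_derivative (\<lambda>h. h *\<^sub>R axis k 1)) (at 0)"
    by (auto intro!: derivative_eq_intros)
  moreover have "(f has_derivative frechet_derivative f (at x)) (at (x + 0 *\<^sub>R axis k 1))"
    using assms by (simp add: frechet_derivative_works)
  ultimately have "((\<lambda>r. f (x + r *\<^sub>R axis k 1)) has_derivative (\<lambda>h. frechet_derivative f (at x) (h *\<^sub>R axis k 1))) (at 0)"
    by (rule has_derivative_compose)
  then show ?thesis
    using assms by (simp add: has_vector_derivative_def partial_def linear_cmul linear_frechet_derivative)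
qed

section \<open>The metric in a collar\<close>

locale collar_setup =
  fixes X :: "'m::{t2_space,second_countable_topology} spin_mfd" and B :: "'m collar"
    and \<phi> \<psi> :: "real \<Rightarrow> real"
  assumes mfd: "riemannian_spin_mfd X" and collar: "manifold_with_collar X B"
    and flat: "flat_boundary X B" and metric: "collar_metric X B \<phi> \<psi>"
    and deriv_eq: "deriv \<psi> 0 = deriv \<phi> 0"
begin

text \<open>By \<open>deriv_eq\<close> the one parameter through which both profiles enter at first
  order.\<close>

definition slope :: real where "slope = deriv \<phi> 0"

lemma profile_facts:
  "\<phi> 0 = 1" "\<psi> 0 = 1" "lo B < 0" "0 < hi B"
  "t \<in> {lo B<..<hi B} \<Longrightarrow> \<phi> t > 0" "t \<in> {lo B<..<hi B} \<Longrightarrow> \<psi> t > 0"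
  "(\<phi> has_real_derivative slope) (at 0)" "(\<psi> has_real_derivative slope) (at 0)"
proof -
  show b: "lo B < 0" "0 < hi B" using collar by (auto simp: manifold_with_collar_def)
  have m: "smooth_on {lo B<..<hi B} \<phi>" "smooth_on {lo B<..<hi B} \<psi>" "\<phi> 0 = 1" "\<psi> 0 = 1"
    "\<forall>t\<in>{lo B<..<hi B}. \<phi> t > 0 \<and> \<psi> t > 0"
    using metric unfolding collar_metric_def by auto
  then show "\<phi> 0 = 1" "\<psi> 0 = 1" "t \<in> {lo B<..<hi B} \<Longrightarrow> \<phi> t > 0" "t \<in> {lo B<..<hi B} \<Longrightarrow> \<psi> t > 0"
    by auto
  have "\<phi> differentiable (at 0)" "\<psi> differentiable (at 0)"
    using smooth_on_differentiable[OF m(1)] smooth_on_differentiable[OF m(2)] b by auto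
  then show "(\<phi> has_real_derivative slope) (at 0)" "(\<psi> has_real_derivative slope) (at 0)"
    using deriv_eq by (metis slope_def DERIV_deriv_iff_real_differentiable)+
qed

lemma nbhd_facts:
  "open (nbhd B)" "bdry B \<subseteq> nbhd B" "continuous_on (nbhd B) (retr B)"
  "q \<in> nbhd B \<Longrightarrow> retr B q \<in> bdry B" "q \<in> nbhd B \<Longrightarrow> height B q \<in> {lo B<..<hi B}"
  "p \<in> bdry B \<Longrightarrow> retr B p = p" "p \<in> bdry B \<Longrightarrow> height B p = 0"
proof -
  obtain j where j: "homeomorphism (nbhd B) (bdry B \<times> {lo B<..<hi B}) (\<lambda>q. (retr B q, height B q)) j"
    using collar unfolding manifold_with_collar_def by blast
  show "open (nbhd B)" "bdry B \<subseteq> nbhd B" "p \<in> bdry B \<Longrightarrow> retr B p = p" "p \<in> bdry B \<Longrightarrow> height B p = 0"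
    using collar unfolding manifold_with_collar_def by auto
  have "continuous_on (nbhd B) (\<lambda>q. (retr B q, height B q))" using j by (simp add: homeomorphism_def)
  from continuous_on_fst[OF this] show "continuous_on (nbhd B) (retr B)" by simp
  have "(retr B q, height B q) \<in> bdry B \<times> {lo B<..<hi B}" if "q \<in> nbhd B"
    using j that unfolding homeomorphism_def by blast
  then show "q \<in> nbhd B \<Longrightarrow> retr B q \<in> bdry B" "q \<in> nbhd B \<Longrightarrow> height B q \<in> {lo B<..<hi B}" by auto
qed

lemma product_chart_coords:
  assumes \<kappa>: "product_chart X B \<kappa>"
  shows "is_chart \<kappa>" "\<kappa> \<in> atlas X" "cdom \<kappa> \<subseteq> nbhd B"
    and "q \<in> cdom \<kappa> \<Longrightarrow> cmap \<kappa> q $ 4 = height B q"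
    and "q \<in> cdom \<kappa> \<Longrightarrow> retr B q \<in> cdom \<kappa> \<Longrightarrow> tang (cmap \<kappa> (retr B q)) = tang (cmap \<kappa> q)"
    and "p \<in> cdom \<kappa> \<inter> bdry B \<Longrightarrow> cmap \<kappa> p = join (tang (cmap \<kappa> p)) 0"
proof -
  show at: "\<kappa> \<in> atlas X" and nb: "cdom \<kappa> \<subseteq> nbhd B" using \<kappa> by (auto simp: product_chart_def)
  then show "is_chart \<kappa>" using mfd unfolding riemannian_spin_mfd_def oriented_atlas_def by blast
  obtain y where y: "\<And>q. q \<in> cdom \<kappa> \<Longrightarrow> cmap \<kappa> q = join (y (retr B q)) (height B q)"
    using \<kappa> unfolding product_chart_def by blast
  show h: "cmap \<kappa> q $ 4 = height B q" if "q \<in> cdom \<kappa>" for q using y[OF that] by simp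
  show "tang (cmap \<kappa> (retr B q)) = tang (cmap \<kappa> q)" if "q \<in> cdom \<kappa>" "retr B q \<in> cdom \<kappa>"
  proof -
    have "retr B q \<in> bdry B" using that nb nbhd_facts(4) by blast
    then show ?thesis using y[OF that(1)] y[OF that(2)] nbhd_facts(6) by simp
  qed
  show "cmap \<kappa> p = join (tang (cmap \<kappa> p)) 0" if "p \<in> cdom \<kappa> \<inter> bdry B"
    by (rule join_eqI) (use that h nbhd_facts(7) in auto)
qed

text \<open>\<open>collar_metric\<close> describes the metric only at points whose foot on the
  boundary lies in the same chart. This part of the chart is open and contains its boundary points,
  which suffices for first order data there.\<close>

definition tube_part :: "'m chart \<Rightarrow> (real^4) set" where
  "tube_part \<kappa> = cmap \<kappa> ` {q \<in> cdom \<kappa>. retr B q \<in> cdom \<kappa>}"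

lemma tube_part:
  assumes \<kappa>: "product_chart X B \<kappa>"
  shows "open (tube_part \<kappa>)" "tube_part \<kappa> \<subseteq> cimg \<kappa>"
    and "p \<in> cdom \<kappa> \<inter> bdry B \<Longrightarrow> cmap \<kappa> p \<in> tube_part \<kappa>"
    and "tube_chart X B \<kappa> \<Longrightarrow> tube_part \<kappa> = cimg \<kappa>"
proof -
  note c = product_chart_coords[OF \<kappa>]
  have "open (nbhd B \<inter> retr B -` cdom \<kappa>)"
    by (rule continuous_open_preimage[OF nbhd_facts(3,1) chart_facts(1)[OF c(1)]])
  then have "open (cdom \<kappa> \<inter> (nbhd B \<inter> retr B -` cdom \<kappa>))"
    using chart_facts(1)[OF c(1)] by blast
  moreover have "cdom \<kappa> \<inter> (nbhd B \<inter> retr B -` cdom \<kappa>) = {q \<in> cdom \<kappa>. retr B q \<in> cdom \<kappa>}"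
    using c(3) by auto
  ultimately show "open (tube_part \<kappa>)"
    unfolding tube_part_def by (intro chart_open_image[OF c(1)]) auto
  show "tube_part \<kappa> \<subseteq> cimg \<kappa>" by (auto simp: tube_part_def cimg_def)
  show "cmap \<kappa> p \<in> tube_part \<kappa>" if "p \<in> cdom \<kappa> \<inter> bdry B"
    using that nbhd_facts(6) by (auto simp: tube_part_def)
  show "tube_part \<kappa> = cimg \<kappa>" if t: "tube_chart X B \<kappa>"
  proof -
    have "cdom \<kappa> = {q \<in> nbhd B. retr B q \<in> cdom \<kappa>}" using t by (simp add: tube_chart_def)
    then have "{q \<in> cdom \<kappa>. retr B q \<in> cdom \<kappa>} = cdom \<kappa>" by blast
    then show ?thesis by (simp add: tube_part_def cimg_def)
  qed
qed

lemma tube_part_metric: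
  fixes x :: "real^4"
  assumes \<kappa>: "product_chart X B \<kappa>" and x: "x \<in> tube_part \<kappa>"
  shows "x $ 4 \<in> {lo B<..<hi B}"
    and "metric X \<kappa> x $ inc i $ inc j = 1 / \<phi> (x $ 4) * bdry_metric X \<kappa> (tang x) $ i $ j"
    and "metric X \<kappa> x $ inc i $ 4 = 0" "metric X \<kappa> x $ 4 $ inc i = 0"
    and "metric X \<kappa> x $ 4 $ 4 = \<psi> (x $ 4)"
proof -
  note c = product_chart_coords[OF \<kappa>]
  obtain q where q: "q \<in> cdom \<kappa>" "retr B q \<in> cdom \<kappa>" "x = cmap \<kappa> q"
    using x by (auto simp: tube_part_def)
  have h: "x $ 4 = height B q" using c(4)[OF q(1)] q(3) by simp
  show "x $ 4 \<in> {lo B<..<hi B}" using h nbhd_facts(5) c(3) q(1) by auto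
  have "\<forall>\<kappa>. product_chart X B \<kappa> \<longrightarrow> (\<forall>q\<in>cdom \<kappa>. retr B q \<in> cdom \<kappa> \<longrightarrow>
        (let x = cmap \<kappa> q; g = metric X \<kappa> x in
          (\<forall>i j. g $ inc i $ inc j = 1 / \<phi> (height B q) * bdry_metric X \<kappa> (tang x) $ i $ j) \<and>
          (\<forall>i. g $ inc i $ 4 = 0 \<and> g $ 4 $ inc i = 0) \<and>
          g $ 4 $ 4 = \<psi> (height B q)))"
    using metric unfolding collar_metric_def by blast
  then have "(let x = cmap \<kappa> q; g = metric X \<kappa> x in
          (\<forall>i j. g $ inc i $ inc j = 1 / \<phi> (height B q) * bdry_metric X \<kappa> (tang x) $ i $ j) \<and>
          (\<forall>i. g $ inc i $ 4 = 0 \<and> g $ 4 $ inc i = 0) \<and>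
          g $ 4 $ 4 = \<psi> (height B q))"
    using \<kappa> q by blast
  then show "metric X \<kappa> x $ inc i $ inc j = 1 / \<phi> (x $ 4) * bdry_metric X \<kappa> (tang x) $ i $ j"
    "metric X \<kappa> x $ inc i $ 4 = 0" "metric X \<kappa> x $ 4 $ inc i = 0"
    "metric X \<kappa> x $ 4 $ 4 = \<psi> (x $ 4)"
    unfolding Let_def h q(3)[symmetric] by auto
qed

definition profile :: "4 \<Rightarrow> real \<Rightarrow> real" where
  "profile i t = (if i = 4 then \<psi> t else 1 / \<phi> t)"

lemma profile_pos: "t \<in> {lo B<..<hi B} \<Longrightarrow> profile i t > 0"
  using profile_facts by (simp add: profile_def)

lemma profile_0 [simp]: "profile i 0 = 1"
  using profile_facts by (simp add: profile_def)

lemma profile_derivative: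
  "(profile i has_real_derivative (if i = 4 then slope else - slope)) (at 0)"
proof (cases "i = 4")
  case True
  then show ?thesis using profile_facts(8) by (simp add: profile_def[abs_def])
next
  case False
  have "((\<lambda>t. 1 / \<phi> t) has_real_derivative - slope) (at 0)"
    using profile_facts by (auto intro!: derivative_eq_intros)
  then show ?thesis using False by (simp add: profile_def[abs_def])
qed

text \<open>A flat chart is normalised on the boundary only; the retraction preserves the tangential
  coordinates, so the normalisation reaches every point of the tube part.\<close>

lemma flat_metric:
  fixes x :: "real^4"
  assumes \<kappa>: "flat_chart X B \<kappa>" and x: "x \<in> tube_part \<kappa>"
  shows "metric X \<kappa> x $ i $ j = (if i = j then profile i (x $ 4) else 0)"
proof -
  have p: "product_chart X B \<kappa>" using \<kappa> by (simp add: flat_chart_def)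
  note c = product_chart_coords[OF p] and m = tube_part_metric[OF p x]
  obtain q where q: "q \<in> cdom \<kappa>" "retr B q \<in> cdom \<kappa>" "x = cmap \<kappa> q"
    using x by (auto simp: tube_part_def)
  have "retr B q \<in> cdom \<kappa> \<inter> bdry B" using q c(3) nbhd_facts(4) by blast
  then have "bdry_metric X \<kappa> (tang (cmap \<kappa> (retr B q))) = mat 1"
    using \<kappa> unfolding flat_chart_def by blast
  then have "bdry_metric X \<kappa> (tang x) = mat 1" using c(5)[OF q(1,2)] q(3) by simp
  then show ?thesis
    by (cases i rule: index_cases; cases j rule: index_cases) (auto simp: m profile_def mat_def)
qed

section \<open>Nondegeneracy of the metrics and the extrinsic curvature of the boundary\<close>

lemma metric_invertible:
  assumes "\<kappa> \<in> atlas X" "x \<in> cimg \<kappa>"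
  shows "invertible (metric X \<kappa> x)"
proof -
  have pd: "\<And>v. v \<noteq> 0 \<Longrightarrow> v \<bullet> (metric X \<kappa> x *v v) > 0"
    using mfd assms unfolding riemannian_spin_mfd_def riemannian_metric_def by blast
  have "\<forall>v. metric X \<kappa> x *v v = 0 \<longrightarrow> v = 0" using pd by force
  then show ?thesis using matrix_left_invertible_ker invertible_left_inverse by blast
qed

text \<open>A positive definite form stays positive definite on the subspace of tangential vectors
  \<open>join w 0\<close>.\<close>

lemma bdry_metric_invertible:
  assumes \<kappa>: "product_chart X B \<kappa>" and p: "p \<in> cdom \<kappa> \<inter> bdry B"
  shows "invertible (bdry_metric X \<kappa> (tang (cmap \<kappa> p)))"
    and "bdry_metric X \<kappa> (tang (cmap \<kappa> p)) $ i $ j = bdry_metric X \<kappa> (tang (cmap \<kappa> p)) $ j $ i"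
proof -
  note c = product_chart_coords[OF \<kappa>]
  define g where "g = metric X \<kappa> (cmap \<kappa> p)"
  define b where "b = bdry_metric X \<kappa> (tang (cmap \<kappa> p))"
  have bg: "b $ i $ j = g $ inc i $ inc j" for i j
    using c(6)[OF p] by (simp add: b_def g_def bdry_metric_def)
  have xc: "cmap \<kappa> p \<in> cimg \<kappa>" using p by (auto simp: cimg_def)
  have pd: "\<And>v. v \<noteq> 0 \<Longrightarrow> v \<bullet> (g *v v) > 0" and sym: "transpose g = g"
    using mfd c(2) xc unfolding riemannian_spin_mfd_def riemannian_metric_def g_def by blast+
  have "w = 0" if w: "b *v w = 0" for w
  proof (rule ccontr)
    assume "w \<noteq> 0"
    then obtain i where "w $ i \<noteq> 0" by (auto simp: vec_eq_iff)
    then have "join w 0 $ inc i \<noteq> 0" by simp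
    then have "join w 0 \<noteq> 0" by (metis zero_index)
    then have "join w 0 \<bullet> (g *v join w 0) > 0" by (rule pd)
    moreover have "join w 0 \<bullet> (g *v join w 0) = w \<bullet> (b *v w)"
      by (simp add: inner_vec_def matrix_vector_mult_def sum_UNIV_4_split bg)
    ultimately show False using w by simp
  qed
  then show "invertible (bdry_metric X \<kappa> (tang (cmap \<kappa> p)))"
    using matrix_left_invertible_ker invertible_left_inverse unfolding b_def by blast
  have "g $ inc i $ inc j = g $ inc j $ inc i"
    using arg_cong[OF sym, of "\<lambda>g. g $ inc j $ inc i"] by (simp add: transpose_def)
  then show "bdry_metric X \<kappa> (tang (cmap \<kappa> p)) $ i $ j = bdry_metric X \<kappa> (tang (cmap \<kappa> p)) $ j $ i"
    using bg by (simp add: b_def)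
qed

lemma metric_entry_differentiable:
  assumes "\<kappa> \<in> atlas X" "x \<in> cimg \<kappa>"
  shows "(\<lambda>y. metric X \<kappa> y $ i $ j) differentiable (at x)"
proof -
  have "smooth_on (cimg \<kappa>) (metric X \<kappa>)"
    using mfd assms unfolding riemannian_spin_mfd_def riemannian_metric_def by blast
  then have "(metric X \<kappa> has_derivative frechet_derivative (metric X \<kappa>) (at x)) (at x)"
    using smooth_on_differentiable assms(2) frechet_derivative_works by blast
  from bounded_linear.has_derivative[OF bounded_linear_vec_nth
      bounded_linear.has_derivative[OF bounded_linear_vec_nth this]]
  show ?thesis by (auto simp: differentiable_def)
qed

text \<open>The mixed entries vanish on an open set, so only the normal derivative of the tangential
  block survives: \<Gamma>^n_ij = - \<partial>_n g_ij / 2, and 1/\<phi> has slope -\<phi>'(0) at 0.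
  The chart is an arbitrary product chart, since \<open>extrinsic_curv\<close> quantifies over all
  of them.\<close>

lemma second_fund_collar:
  assumes \<kappa>: "product_chart X B \<kappa>" and p: "p \<in> cdom \<kappa> \<inter> bdry B"
  shows "second_fund X \<kappa> (tang (cmap \<kappa> p)) i j = - (slope / 2) * bdry_metric X \<kappa> (tang (cmap \<kappa> p)) $ i $ j"
proof -
  note c = product_chart_coords[OF \<kappa>] and t = tube_part[OF \<kappa>] and m = tube_part_metric[OF \<kappa>]
  define x where "x = cmap \<kappa> p"
  have xj: "x = join (tang x) 0" unfolding x_def by (rule c(6)[OF p])
  then have x4: "x $ 4 = 0" by (metis join_nth(1))
  have xt: "x \<in> tube_part \<kappa>" unfolding x_def by (rule t(3)[OF p])
  have xc: "x \<in> cimg \<kappa>" using xt t(2) by blast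
  define g where "g = metric X \<kappa> x"
  have g: "invertible g" unfolding g_def by (rule metric_invertible[OF c(2) xc])
  \<comment> \<open>Mixed entries 0 and g_nn = \<psi>(0) = 1 make the last row of g, and hence of
    its inverse, a unit vector.\<close>
  have row: "matrix_inv g $ 4 $ l = (if l = 4 then 1 else 0)" for l
  proof -
    have "(g ** matrix_inv g) $ 4 $ l = matrix_inv g $ 4 $ l"
      using m(4)[OF xt] m(5)[OF xt] x4 profile_facts(2)
      by (simp add: matrix_matrix_mult_def sum_UNIV_4_split g_def)
    then show ?thesis using matrix_inv_right_left(1)[OF g] by (auto simp: mat_def)
  qed
  have z: "partial k (\<lambda>y. metric X \<kappa> y $ inc i $ 4) x = 0" for k i
    using partial_cong[OF t(1) xt, of "\<lambda>y. metric X \<kappa> y $ inc i $ 4" "\<lambda>y. 0"] m(3)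
    by (simp add: partial_const)
  have d: "partial 4 (\<lambda>y. metric X \<kappa> y $ inc i $ inc j) x = - slope * bdry_metric X \<kappa> (tang x) $ i $ j"
  proof (rule vector_derivative_unique_at)
    show "((\<lambda>r. metric X \<kappa> (x + r *\<^sub>R axis 4 1) $ inc i $ inc j) has_vector_derivative
        partial 4 (\<lambda>y. metric X \<kappa> y $ inc i $ inc j) x) (at 0)"
      by (rule has_vector_derivative_partial[OF metric_entry_differentiable[OF c(2) xc]])
    have l: "(x + r *\<^sub>R axis 4 1) $ 4 = r" "tang (x + r *\<^sub>R axis 4 1) = tang x" for r
      using x4 by (auto simp: axis_def tang_def vec_eq_iff)
    have op: "open ((\<lambda>r. x + r *\<^sub>R axis 4 1) -` tube_part \<kappa>)"
      by (rule open_vimage[OF t(1)]) (intro continuous_intros)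
    have "((\<lambda>r. 1 / \<phi> r * bdry_metric X \<kappa> (tang x) $ i $ j) has_vector_derivative
        - slope * bdry_metric X \<kappa> (tang x) $ i $ j) (at 0)"
      using profile_derivative[of 1] DERIV_cmult_right[of "\<lambda>t. 1 / \<phi> t" "- slope" 0 UNIV "bdry_metric X \<kappa> (tang x) $ i $ j"]
      by (simp add: profile_def[abs_def] has_real_derivative_iff_has_vector_derivative)
    then show "((\<lambda>r. metric X \<kappa> (x + r *\<^sub>R axis 4 1) $ inc i $ inc j) has_vector_derivative
        - slope * bdry_metric X \<kappa> (tang x) $ i $ j) (at 0)"
    proof (rule has_vector_derivative_transform_within_open[OF _ op])
      show "0 \<in> (\<lambda>r. x + r *\<^sub>R axis 4 1) -` tube_part \<kappa>" using xt by simp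
      show "1 / \<phi> r * bdry_metric X \<kappa> (tang x) $ i $ j = metric X \<kappa> (x + r *\<^sub>R axis 4 1) $ inc i $ inc j"
        if "r \<in> (\<lambda>r. x + r *\<^sub>R axis 4 1) -` tube_part \<kappa>" for r
        using m(2)[of "x + r *\<^sub>R axis 4 1"] that l by simp
    qed
  qed
  have "christoffel X \<kappa> x 4 (inc i) (inc j) = slope / 2 * bdry_metric X \<kappa> (tang x) $ i $ j"
  proof -
    have "christoffel X \<kappa> x 4 (inc i) (inc j) = (\<Sum>l\<in>UNIV. if l = 4 then
        (partial (inc i) (\<lambda>y. metric X \<kappa> y $ inc j $ l) x + partial (inc j) (\<lambda>y. metric X \<kappa> y $ inc i $ l) x
          - partial l (\<lambda>y. metric X \<kappa> y $ inc i $ inc j) x) / 2 else 0)"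
      unfolding christoffel_def g_def[symmetric] row by (rule sum.cong) auto
    then show ?thesis by (simp add: z d)
  qed
  then show ?thesis by (simp add: second_fund_def x_def[symmetric] xj[symmetric])
qed

text \<open>K_ij is -slope/2 times the boundary metric, so its trace is three times that factor in
  every product chart, which also makes the \<open>THE\<close> well defined.\<close>

lemma extrinsic_curv_bdry:
  assumes p: "p \<in> bdry B"
  shows "extrinsic_curv X B p = - (3 / 2) * slope"
proof -
  have val: "(\<Sum>i\<in>UNIV. \<Sum>j\<in>UNIV. second_fund X \<kappa> y i j * matrix_inv (bdry_metric X \<kappa> y) $ i $ j) =
      - (3 / 2) * slope" if \<kappa>: "product_chart X B \<kappa>" "p \<in> cdom \<kappa>" and y: "y = tang (cmap \<kappa> p)" for \<kappa> y
  proof -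
    have p': "p \<in> cdom \<kappa> \<inter> bdry B" using p \<kappa>(2) by blast
    define b where "b = bdry_metric X \<kappa> y"
    have b: "invertible b" "\<And>i j. b $ i $ j = b $ j $ i"
      using bdry_metric_invertible[OF \<kappa>(1) p'] by (auto simp: b_def y)
    have "(\<Sum>i\<in>UNIV. \<Sum>j\<in>UNIV. second_fund X \<kappa> y i j * matrix_inv b $ i $ j) =
        - (slope / 2) * (\<Sum>i\<in>UNIV. \<Sum>j\<in>UNIV. b $ j $ i * matrix_inv b $ i $ j)"
      unfolding sum_distrib_left
      by (intro sum.cong refl) (simp add: y second_fund_collar[OF \<kappa>(1) p'] b_def[unfolded y, symmetric] b(2))
    also have "(\<Sum>i\<in>UNIV. \<Sum>j\<in>UNIV. b $ j $ i * matrix_inv b $ i $ j) = (\<Sum>j\<in>UNIV. (b ** matrix_inv b) $ j $ j)"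
      by (subst sum.swap) (simp add: matrix_matrix_mult_def)
    also have "\<dots> = 3" by (simp add: matrix_inv_right_left(1)[OF b(1)] mat_def)
    finally show ?thesis by (simp add: b_def)
  qed
  obtain \<kappa> where \<kappa>: "product_chart X B \<kappa>" "p \<in> cdom \<kappa>"
    using collar p unfolding manifold_with_collar_def tube_chart_def by blast
  show ?thesis unfolding extrinsic_curv_def
  proof (rule the_equality)
    show "\<forall>\<kappa>. product_chart X B \<kappa> \<and> p \<in> cdom \<kappa> \<longrightarrow> (let y = tang (cmap \<kappa> p) in
       - (3 / 2) * slope = (\<Sum>i\<in>UNIV. \<Sum>j\<in>UNIV. second_fund X \<kappa> y i j * matrix_inv (bdry_metric X \<kappa> y) $ i $ j))"
      unfolding Let_def by (intro allI impI, elim conjE, rule val[symmetric]) auto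
    fix k assume k: "\<forall>\<kappa>. product_chart X B \<kappa> \<and> p \<in> cdom \<kappa> \<longrightarrow> (let y = tang (cmap \<kappa> p) in
       k = (\<Sum>i\<in>UNIV. \<Sum>j\<in>UNIV. second_fund X \<kappa> y i j * matrix_inv (bdry_metric X \<kappa> y) $ i $ j))"
    show "k = - (3 / 2) * slope"
      using k[THEN spec[of _ \<kappa>], THEN mp, OF conjI[OF \<kappa>]] val[OF \<kappa> refl] by (simp only: Let_def)
  qed
qed

text \<open>The total volume stays an unevaluated factor, the same one as in the integrals of the
  residue forms.\<close>

lemma I_Gr_b_value:
  assumes "bdry_volume X B \<mu>"
  shows "I_Gr_b X B \<mu> = - 3 * slope * measure \<mu> (space \<mu>)"
proof -
  have "space \<mu> = bdry B" using assms by (simp add: bdry_volume_def)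
  then have "(LINT p|\<mu>. extrinsic_curv X B p) = (LINT p|\<mu>. - (3 / 2) * slope)"
    by (intro Bochner_Integration.integral_cong) (auto simp: extrinsic_curv_bdry)
  then show ?thesis by (simp add: I_Gr_b_def)
qed

end

section \<open>Flat frames\<close>

lemma smooth_on_matrix:
  fixes f :: "'a::real_normed_vector \<Rightarrow> real^'n^'m"
  assumes "open S" "\<And>i j. smooth_on S (\<lambda>x. f x $ i $ j)"
  shows "smooth_on S f"
proof -
  have 1: "smooth_on S (\<lambda>x. \<Sum>i\<in>UNIV. \<Sum>j\<in>UNIV. (f x $ i $ j) *\<^sub>R (axis i (axis j 1) :: real^'n^'m))"
    by (intro smooth_on_sum assms bounded_linear.smooth_on_bounded_linear[OF bounded_linear_scaleR_left])
  have rep: "(\<Sum>i\<in>UNIV. \<Sum>j\<in>UNIV. (M $ i $ j) *\<^sub>R axis i (axis j 1)) = M" for M :: "real^'n^'m"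
  proof -
    have "(\<Sum>i\<in>UNIV. \<Sum>j\<in>UNIV. (M $ i $ j) *\<^sub>R (axis i (axis j 1) :: real^'n^'m)) $ k $ l =
        (\<Sum>i\<in>UNIV. \<Sum>j\<in>UNIV. if i = k then if j = l then M $ i $ j else 0 else 0)" for k l
      unfolding sum_component by (intro sum.cong) (auto simp: axis_def)
    moreover have "(\<Sum>i\<in>UNIV. \<Sum>j\<in>UNIV. if i = k then if j = l then M $ i $ j else 0 else 0) =
        (\<Sum>i\<in>UNIV. if i = k then M $ i $ l else 0)" for k l
      by (intro sum.cong) auto
    ultimately show ?thesis by (simp add: vec_eq_iff)
  qed
  show ?thesis using 1 unfolding rep .
qed

context collar_setup
begin

text \<open>The metric is indexed by charts, and the spin structure hands out frames on restricted
  charts. A restriction is a different index, but its transition map is the identity on an open set,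
  so the Jacobian is the identity.\<close>

lemma metric_subchart:
  assumes \<kappa>: "\<kappa> \<in> atlas X" "\<kappa>' \<in> atlas X" "cdom \<kappa> \<subseteq> cdom \<kappa>'"
    and eq: "\<And>q. q \<in> cdom \<kappa> \<Longrightarrow> cmap \<kappa> q = cmap \<kappa>' q" and x: "x \<in> cimg \<kappa>"
  shows "metric X \<kappa> x = metric X \<kappa>' x"
proof -
  have ch: "is_chart \<kappa>" using \<kappa>(1) mfd unfolding riemannian_spin_mfd_def oriented_atlas_def by blast
  note c = chart_facts[OF ch]
  define q where "q = cinv \<kappa> x"
  have q: "q \<in> cdom \<kappa>" "cmap \<kappa> q = x" "cmap \<kappa>' q = x" using c(7,8)[OF x] eq by (auto simp: q_def)
  have "trans_map \<kappa> \<kappa>' y = y" if "y \<in> cimg \<kappa>" for y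
    using c(7,8)[OF that] eq by (simp add: trans_map_def)
  then have "frechet_derivative (trans_map \<kappa> \<kappa>') (at x) = frechet_derivative (\<lambda>y. y) (at x)"
    by (intro frechet_derivative_cong(1)[OF c(2) x])
  moreover have "frechet_derivative (\<lambda>y::real^4. y) (at x) = (\<lambda>y. y)"
    using frechet_derivative_at[OF has_derivative_ident] by metis
  ultimately have "trans_jac \<kappa> \<kappa>' q = mat 1"
    by (simp add: trans_jac_def jacobian_def q(2) matrix_id_mat_1[unfolded id_def])
  moreover have "metric X \<kappa> (cmap \<kappa> q) =
      transpose (trans_jac \<kappa> \<kappa>' q) ** metric X \<kappa>' (cmap \<kappa>' q) ** trans_jac \<kappa> \<kappa>' q"
    using mfd \<kappa> q(1) unfolding riemannian_spin_mfd_def riemannian_metric_def by blast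
  ultimately show ?thesis by (simp add: q transpose_mat matrix_mul_lid matrix_mul_rid)
qed

text \<open>\<open>res11\<close> and \<open>res21\<close> quantify over flat frames, so without one
  at p the descriptions would be void. The tube part of a tube chart is the whole chart: there the
  metric is diagonal everywhere, and the normalised coordinate frame is orthonormal everywhere, as
  \<open>on_frame\<close> asks.\<close>

lemma flat_frame_exists:
  assumes p: "p \<in> bdry B"
  obtains a where "flat_frame X B a" "p \<in> fdom a"
proof -
  obtain \<kappa> where \<kappa>: "tube_chart X B \<kappa>" "flat_chart X B \<kappa>" "p \<in> cdom \<kappa>"
    using flat p unfolding flat_boundary_def by blast
  have pc: "product_chart X B \<kappa>" using \<kappa>(2) by (simp add: flat_chart_def)
  note c = product_chart_coords[OF pc]
  have g: "metric X \<kappa> x $ i $ j = (if i = j then profile i (x $ 4) else 0)" "x $ 4 \<in> {lo B<..<hi B}"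
    if "x \<in> cimg \<kappa>" for x :: "real^4" and i j
    using flat_metric[OF \<kappa>(2)] tube_part_metric(1)[OF pc] tube_part(4)[OF pc \<kappa>(1)] that by auto
  have gpos: "metric X \<kappa> x $ i $ i > 0" if "x \<in> cimg \<kappa>" for x i
    using g[OF that] profile_pos by simp
  define E where "E x = (\<chi> i j. if i = j then 1 / sqrt (metric X \<kappa> x $ i $ i) else 0)" for x
  have "on_frame X \<kappa> E"
    unfolding on_frame_def
  proof (intro conjI ballI)
    have op: "open (cimg \<kappa>)" by (rule chart_facts(2)[OF c(1)])
    have gs: "smooth_on (cimg \<kappa>) (metric X \<kappa>)"
      using mfd c(2) unfolding riemannian_spin_mfd_def riemannian_metric_def by blast
    show "smooth_on (cimg \<kappa>) E"
    proof (rule smooth_on_matrix[OF op])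
      fix i j
      have gi: "smooth_on (cimg \<kappa>) (\<lambda>x. metric X \<kappa> x $ i $ i)"
        by (intro bounded_linear.smooth_on_bounded_linear[OF bounded_linear_vec_nth] op gs)
      have "smooth_on (cimg \<kappa>) (\<lambda>x. (metric X \<kappa> x $ i $ i) powr (- (1 / 2)))"
        by (rule smooth_on_compose[OF op _ _ gi smooth_on_powr]) (use gpos in auto)
      moreover have "(metric X \<kappa> x $ i $ i) powr (- (1 / 2)) = 1 / sqrt (metric X \<kappa> x $ i $ i)" if "x \<in> cimg \<kappa>" for x
        using gpos[OF that, of i] powr_minus_divide[of _ "1 / 2"] powr_half_sqrt by (metis less_imp_le)
      ultimately have "smooth_on (cimg \<kappa>) (\<lambda>x. 1 / sqrt (metric X \<kappa> x $ i $ i))"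
        using smooth_on_cong[OF op, of "\<lambda>x. (metric X \<kappa> x $ i $ i) powr (- (1 / 2))"
            "\<lambda>x. 1 / sqrt (metric X \<kappa> x $ i $ i)"] by blast
      then show "smooth_on (cimg \<kappa>) (\<lambda>x. E x $ i $ j)"
        by (cases "i = j") (auto simp: E_def smooth_on_const)
    qed
    fix x assume x: "x \<in> cimg \<kappa>"
    have "(transpose (E x) ** metric X \<kappa> x ** E x) $ i $ j = (mat 1 :: real^4^4) $ i $ j" for i j
    proof -
      have "(transpose (E x) ** metric X \<kappa> x) $ i $ k = (if k = i then sqrt (metric X \<kappa> x $ i $ i) else 0)" for k
      proof -
        have "(transpose (E x) ** metric X \<kappa> x) $ i $ k = (\<Sum>l\<in>UNIV. transpose (E x) $ i $ l * metric X \<kappa> x $ l $ k)"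
          by (simp add: matrix_matrix_mult_def)
        also have "\<dots> = (\<Sum>l\<in>UNIV. if l = i then (1 / sqrt (metric X \<kappa> x $ i $ i)) * metric X \<kappa> x $ l $ k else 0)"
          by (rule sum.cong) (auto simp: transpose_def E_def)
        also have "\<dots> = (1 / sqrt (metric X \<kappa> x $ i $ i)) * metric X \<kappa> x $ i $ k" by simp
        also have "\<dots> = (if k = i then sqrt (metric X \<kappa> x $ i $ i) else 0)"
          using g(1)[OF x, of i k] gpos[OF x, of i] by (auto simp: real_div_sqrt)
        finally show ?thesis .
      qed
      note row = this
      have "(transpose (E x) ** metric X \<kappa> x ** E x) $ i $ j = (\<Sum>k\<in>UNIV. (transpose (E x) ** metric X \<kappa> x) $ i $ k * E x $ k $ j)"
        by (simp add: matrix_matrix_mult_def[of "transpose (E x) ** metric X \<kappa> x"])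
      also have "\<dots> = (\<Sum>k\<in>UNIV. if k = i then sqrt (metric X \<kappa> x $ i $ i) * E x $ k $ j else 0)"
        by (rule sum.cong) (auto simp: row)
      also have "\<dots> = sqrt (metric X \<kappa> x $ i $ i) * E x $ i $ j" by simp
      also have "\<dots> = (mat 1 :: real^4^4) $ i $ j" using gpos[OF x, of i] by (auto simp: E_def mat_def)
      finally show ?thesis .
    qed
    then show "transpose (E x) ** metric X \<kappa> x ** E x = mat 1" by (simp add: vec_eq_iff)
    have "det (E x) = (\<Prod>i\<in>UNIV. E x $ i $ i)" by (rule det_diagonal) (simp add: E_def)
    also have "\<dots> > 0" using gpos[OF x] by (intro prod_pos) (simp add: E_def)
    finally show "det (E x) > 0" .
  qed
  moreover have "\<forall>\<kappa>\<in>atlas X. \<forall>E. on_frame X \<kappa> E \<longrightarrow> (\<forall>q\<in>cdom \<kappa>.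
        \<exists>a\<in>spin_frames X. q \<in> fdom a \<and> fdom a \<subseteq> cdom \<kappa> \<and>
          (\<forall>q'\<in>fdom a. fmap a q' = cmap \<kappa> q') \<and> (\<forall>x\<in>fimg a. frame a x = E x))"
    using mfd unfolding riemannian_spin_mfd_def spin_structure_def by blast
  ultimately have "\<exists>a\<in>spin_frames X. p \<in> fdom a \<and> fdom a \<subseteq> cdom \<kappa> \<and>
          (\<forall>q'\<in>fdom a. fmap a q' = cmap \<kappa> q') \<and> (\<forall>x\<in>fimg a. frame a x = E x)"
    using c(2) \<kappa>(3) by blast
  then obtain a where a: "a \<in> spin_frames X" "p \<in> fdom a" "fdom a \<subseteq> cdom \<kappa>"
    "\<And>q. q \<in> fdom a \<Longrightarrow> fmap a q = cmap \<kappa> q" "\<And>x. x \<in> fimg a \<Longrightarrow> frame a x = E x"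
    by blast
  have at: "fchart a \<in> atlas X" by (rule spin_mfd_facts(2)[OF mfd a(1)])
  have sub: "metric X (fchart a) x = metric X \<kappa> x" if "x \<in> fimg a" for x
    by (rule metric_subchart[OF at c(2) a(3,4) that])
  \<comment> \<open>The lifted frame lives on a smaller chart, to which product form and flatness
    must be carried over.\<close>
  have pca: "product_chart X B (fchart a)"
    using pc at a(3,4) unfolding product_chart_def by (metis subset_iff)
  have "flat_chart X B (fchart a)"
    unfolding flat_chart_def
  proof (intro conjI ballI pca)
    fix q assume q: "q \<in> fdom a \<inter> bdry B"
    have "bdry_metric X \<kappa> (tang (cmap \<kappa> q)) = mat 1"
      using \<kappa>(2) q a(3) unfolding flat_chart_def by blast
    moreover have "join (tang (fmap a q)) 0 = fmap a q" using product_chart_coords(6)[OF pca q] by simp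
    moreover have "fmap a q \<in> fimg a" using q by (auto simp: cimg_def)
    ultimately show "bdry_metric X (fchart a) (tang (fmap a q)) = mat 1"
      using a(4) q by (simp add: bdry_metric_def sub)
  qed
  moreover have "frame a x = (\<chi> i j. if i = j then 1 / sqrt (metric X (fchart a) x $ i $ i) else 0)"
    if "x \<in> fimg a" for x
    using a(5)[OF that] by (simp only: E_def sub[OF that])
  ultimately have "flat_frame X B a" unfolding flat_frame_def using a(1) by blast
  then show ?thesis using that a(2) by blast
qed

end

section \<open>A nilpotent basis of the Clifford plane\<close>

lemma cl_vec_add: "cl_vec c (v + w) = cl_vec c v + cl_vec c w"
  by (simp add: cl_vec_def scaleR_add_left sum.distrib)

lemma cl_vec_scaleR: "cl_vec c (r *\<^sub>R v) = r *\<^sub>R cl_vec c v"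
  by (simp add: cl_vec_def scaleR_sum_right)

lemma cl_vec_axis: "cl_vec c (axis k 1) = c k"
  by (simp add: cl_vec_def axis_def if_distrib[of "\<lambda>x. x *\<^sub>R _"] cong: if_cong)

lemma cl_vec_anticommute:
  assumes "clifford_gens c"
  shows "cl_vec c v ** cl_vec c w + cl_vec c w ** cl_vec c v = cscale (- 2 * of_real (v \<bullet> w)) (mat 1)"
proof -
  have "cl_vec c (v + w) ** cl_vec c (v + w) = cl_vec c v ** cl_vec c v + cl_vec c w ** cl_vec c w +
      (cl_vec c v ** cl_vec c w + cl_vec c w ** cl_vec c v)"
    by (simp add: cl_vec_add matmul.add_left matmul.add_right)
  then have "cl_vec c v ** cl_vec c w + cl_vec c w ** cl_vec c v =
      cscale (- of_real ((v + w) \<bullet> (v + w))) (mat 1) - cscale (- of_real (v \<bullet> v)) (mat 1) - cscale (- of_real (w \<bullet> w)) (mat 1)"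
    unfolding cl_vec_sq[OF assms] by (simp add: algebra_simps)
  also have "\<dots> = cscale (- of_real ((v + w) \<bullet> (v + w)) - - of_real (v \<bullet> v) - - of_real (w \<bullet> w)) (mat 1)"
    by (simp only: cscale.diff_left)
  also have "- of_real ((v + w) \<bullet> (v + w)) - - of_real (v \<bullet> v) - - of_real (w \<bullet> w) = (- 2 * of_real (v \<bullet> w) :: complex)"
    by (simp add: inner_add_left inner_add_right inner_commute)
  finally show ?thesis .
qed

text \<open>
  For \<open>x\<^sub>n = 0\<close> one has \<open>\<i> c(\<xi>) / |\<xi>|\<^sup>2 = U / (\<xi>\<^sub>n - \<i> |\<xi>'|) + V / (\<xi>\<^sub>n + \<i> |\<xi>'|)\<close>, where the residues
  \<open>U\<close> (\<open>pole_up\<close>) and \<open>V\<close> (\<open>pole_down\<close>) are nilpotent with \<open>U V + V U = 1\<close>. In terms of them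
  \<open>\<sigma>\<^bsub>-2\<^esub>\<close> has no mixed products, and \<open>\<pi>\<^sup>+\<close> just keeps the \<open>U\<close>-part.
\<close>

definition cliff_tangent :: "(4 \<Rightarrow> complex^4^4) \<Rightarrow> real^3 \<Rightarrow> complex^4^4" where
  "cliff_tangent c y = cl_vec c (join ((1 / norm y) *\<^sub>R y) 0)"

definition pole_up :: "(4 \<Rightarrow> complex^4^4) \<Rightarrow> real^3 \<Rightarrow> complex^4^4" where
  "pole_up c y = cscale (1 / 2) (cliff_tangent c y + cscale \<i> (c 4))"

definition pole_down :: "(4 \<Rightarrow> complex^4^4) \<Rightarrow> real^3 \<Rightarrow> complex^4^4" where
  "pole_down c y = cscale (1 / 2) (cscale \<i> (c 4) - cliff_tangent c y)"

text \<open>U V + V U = 1 and the two nilpotencies give U V U = U and V U V = V; by cyclicity of the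
  trace, U V has half the trace of the identity.\<close>

lemma clifford_plane:
  fixes N M :: "complex^4^4"
  assumes NN: "N ** N = cscale (- 1) (mat 1)" and MM: "M ** M = cscale (- 1) (mat 1)"
    and NM: "N ** M + M ** N = 0"
  defines "U \<equiv> cscale (1 / 2) (N + cscale \<i> M)" and "V \<equiv> cscale (1 / 2) (cscale \<i> M - N)"
  shows "U ** U = 0" "V ** V = 0" "U ** V ** U = U" "V ** U ** V = V"
    "trace (U ** V) = 2" "M = cscale (- \<i>) (U + V)"
proof -
  have MN: "M ** N = - (N ** M)" using NM by (simp add: eq_neg_iff_add_eq_0 add.commute)
  note expand = matmul.add_left matmul.add_right matmul.diff_left matmul.diff_right matmul_cscale_left
    matmul_cscale_right cscale_cscale NN MM MN
  show UU: "U ** U = 0"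
    unfolding U_def by (simp add: expand vec_eq_iff algebra_simps)
  show VV: "V ** V = 0"
    unfolding V_def by (simp add: expand vec_eq_iff algebra_simps)
  have sum: "U ** V + V ** U = mat 1"
    unfolding U_def V_def by (simp add: expand vec_eq_iff algebra_simps)
  have "U ** V = mat 1 - V ** U" "V ** U = mat 1 - U ** V" using sum by (simp_all add: eq_diff_eq add.commute)
  then have "U ** V ** U = (mat 1 - V ** U) ** U" "V ** U ** V = (mat 1 - U ** V) ** V" by simp_all
  then show "U ** V ** U = U" "V ** U ** V = V"
    by (simp_all only: matmul.diff_left matrix_mul_assoc[symmetric] UU VV matmul.zero_right
        matrix_mul_lid diff_zero)
  have "trace (U ** V) + trace (V ** U) = 4"
    using arg_cong[OF sum, of trace] by (simp add: trace_add trace_I)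
  moreover have "trace (U ** V) = trace (V ** U)" by (rule trace_mul_sym)
  ultimately show "trace (U ** V) = 2" by simp
  show "M = cscale (- \<i>) (U + V)"
    unfolding U_def V_def by (simp add: vec_eq_iff algebra_simps)
qed

lemma pole_matrices:
  assumes c: "clifford_gens c" and y: "y \<noteq> 0"
  shows "pole_up c y ** pole_up c y = 0" "pole_down c y ** pole_down c y = 0"
    "pole_up c y ** pole_down c y ** pole_up c y = pole_up c y"
    "pole_down c y ** pole_up c y ** pole_down c y = pole_down c y"
    "trace (pole_up c y ** pole_down c y) = 2"
    "c 4 = cscale (- \<i>) (pole_up c y + pole_down c y)"
proof -
  define v where "v = join ((1 / norm y) *\<^sub>R y) 0"
  have "v \<bullet> v = ((1 / norm y) *\<^sub>R y) \<bullet> ((1 / norm y) *\<^sub>R y)"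
    by (simp add: v_def inner_vec_def sum_UNIV_4_split)
  also have "\<dots> = 1" using y by (simp add: dot_square_norm power2_eq_square)
  finally have "v \<bullet> v = 1" .
  then have NN: "cliff_tangent c y ** cliff_tangent c y = cscale (- 1) (mat 1)"
    by (simp add: cliff_tangent_def v_def[symmetric] cl_vec_sq[OF c])
  have MM: "c 4 ** c 4 = cscale (- 1) (mat 1)"
    using cl_vec_sq[OF c, of "axis 4 1"] by (simp add: cl_vec_axis inner_axis_axis)
  have "v \<bullet> axis 4 1 = 0" by (simp add: v_def inner_axis)
  then have NM: "cliff_tangent c y ** c 4 + c 4 ** cliff_tangent c y = 0"
    using cl_vec_anticommute[OF c, of v "axis 4 1"]
    by (simp add: cl_vec_axis cliff_tangent_def v_def[symmetric] cscale.zero_left)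
  note P = clifford_plane[OF NN MM NM, folded pole_up_def pole_down_def]
  show "pole_up c y ** pole_up c y = 0" "pole_down c y ** pole_down c y = 0"
    "pole_up c y ** pole_down c y ** pole_up c y = pole_up c y"
    "pole_down c y ** pole_up c y ** pole_down c y = pole_down c y"
    "trace (pole_up c y ** pole_down c y) = 2"
    "c 4 = cscale (- \<i>) (pole_up c y + pole_down c y)" by (fact P)+
qed

text \<open>f and g are to be the square roots of \<phi> and \<psi>. The left sides are then the
  tangential and normal coefficients of \<i> c(v)/|v|^2, whose denominator vanishes at \<eta> =
  \<plusminus> \<i> \<rho> f g.\<close>

lemma resolvent_partial_fractions:
  fixes f g \<rho> \<eta> :: real
  assumes "f > 0" "g > 0" "\<rho> > 0"
  shows "\<i> * of_real (f * \<rho>) / of_real (f\<^sup>2 * \<rho>\<^sup>2 + \<eta>\<^sup>2 / g\<^sup>2) =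
      of_real g / 2 * (1 / (of_real \<eta> - \<i> * of_real (\<rho> * (f * g))) - 1 / (of_real \<eta> + \<i> * of_real (\<rho> * (f * g))))"
    and "\<i> * of_real (\<eta> / g) / of_real (f\<^sup>2 * \<rho>\<^sup>2 + \<eta>\<^sup>2 / g\<^sup>2) =
      \<i> * of_real g / 2 * (1 / (of_real \<eta> - \<i> * of_real (\<rho> * (f * g))) + 1 / (of_real \<eta> + \<i> * of_real (\<rho> * (f * g))))"
proof -
  define s where "s = \<rho> * (f * g)"
  define z where "z = complex_of_real \<eta> - \<i> * of_real s"
  define w where "w = complex_of_real \<eta> + \<i> * of_real s"
  have s: "s > 0" using assms by (simp add: s_def)
  have zw: "z \<noteq> 0" "w \<noteq> 0" using s by (auto simp: z_def w_def complex_eq_iff)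
  have prod: "z * w = of_real (\<eta>\<^sup>2 + s\<^sup>2)" by (simp add: z_def w_def algebra_simps power2_eq_square)
  have pos: "\<eta>\<^sup>2 + s\<^sup>2 > 0" using s by (simp add: add_nonneg_pos)
  have den: "f\<^sup>2 * \<rho>\<^sup>2 + \<eta>\<^sup>2 / g\<^sup>2 = (\<eta>\<^sup>2 + s\<^sup>2) / g\<^sup>2"
    using assms by (simp add: s_def power_mult_distrib field_simps)
  have 1: "1 / z - 1 / w = 2 * \<i> * of_real s / (z * w)" "1 / z + 1 / w = 2 * of_real \<eta> / (z * w)"
    using zw by (simp_all add: divide_simps) (simp_all add: z_def w_def algebra_simps)
  show "\<i> * of_real (f * \<rho>) / of_real (f\<^sup>2 * \<rho>\<^sup>2 + \<eta>\<^sup>2 / g\<^sup>2) =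
      of_real g / 2 * (1 / (of_real \<eta> - \<i> * of_real (\<rho> * (f * g))) - 1 / (of_real \<eta> + \<i> * of_real (\<rho> * (f * g))))"
    unfolding s_def[symmetric] z_def[symmetric] w_def[symmetric] 1 prod den
    using assms pos by (simp add: s_def power2_eq_square)
  show "\<i> * of_real (\<eta> / g) / of_real (f\<^sup>2 * \<rho>\<^sup>2 + \<eta>\<^sup>2 / g\<^sup>2) =
      \<i> * of_real g / 2 * (1 / (of_real \<eta> - \<i> * of_real (\<rho> * (f * g))) + 1 / (of_real \<eta> + \<i> * of_real (\<rho> * (f * g))))"
    unfolding s_def[symmetric] z_def[symmetric] w_def[symmetric] 1 prod den
    using assms pos by (simp add: power2_eq_square)
qed

section \<open>Integration over the unit sphere\<close>

text \<open>
  Only the values of \<open>J\<close> on the unit sphere carry mass, but without measurability of \<open>J\<close> on the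
  whole space the Bochner integral would be \<open>0\<close>. This is why the residue integrals below are
  computed for all \<open>\<xi>' \<noteq> 0\<close>.
\<close>

lemma sphere_measure_integral:
  fixes J :: "real^3 \<Rightarrow> complex"
  assumes J: "\<And>y. y \<noteq> 0 \<Longrightarrow> J y = k / of_real (norm y) ^ 3"
  shows "(LINT y|sphere_measure. J y) = k * of_real (Omega 3)"
proof -
  let ?D = "density lborel (\<lambda>x::real^3. of_nat DIM(real^3) * indicator (ball 0 1) x) :: (real^3) measure"
  have dm: "(\<lambda>x::real^3. of_nat DIM(real^3) * indicator (ball 0 1) x :: ennreal) \<in> borel_measurable lborel"
    by (intro borel_measurable_times_ennreal borel_measurable_const borel_measurable_indicator) auto
  have "J = (\<lambda>y. if y = 0 then J 0 else k / of_real (norm y) ^ 3)" using J by auto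
  moreover have "(\<lambda>y::real^3. if y = 0 then J 0 else k / of_real (norm y) ^ 3) \<in> borel_measurable borel"
    by measurable
  ultimately have Jm: "J \<in> borel_measurable borel" by simp
  have nm: "(\<lambda>x::real^3. x /\<^sub>R norm x) \<in> borel_measurable ?D" by measurable
  have "(LINT y|sphere_measure. J y) = (LINT x|?D. J (x /\<^sub>R norm x))"
    unfolding sphere_measure_def by (rule integral_distr[OF nm Jm])
  also have "\<dots> = (LINT x|?D. k)"
  proof (rule integral_cong_AE)
    show "(\<lambda>x. J (x /\<^sub>R norm x)) \<in> borel_measurable ?D" using measurable_compose[OF nm Jm] .
    have "AE x in lborel. x \<noteq> (0 :: real^3)" by (rule AE_lborel_singleton)
    then have "AE x in ?D. x \<noteq> 0" by (subst AE_density[OF dm]) auto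
    then show "AE x in ?D. J (x /\<^sub>R norm x) = k" by eventually_elim (simp add: J)
  qed simp
  also have "\<dots> = measure ?D (space ?D) *\<^sub>R k" by simp
  also have "measure ?D (space ?D) = Omega 3"
  proof -
    have "emeasure ?D (space ?D) = (\<integral>\<^sup>+x. 3 * indicator (ball 0 1) (x::real^3) \<partial>lborel)"
      by (subst emeasure_density[OF dm]) (auto simp: indicator_def)
    also have "\<dots> = 3 * emeasure lborel (ball 0 1 :: (real^3) set)"
      by (subst nn_integral_cmult_indicator) auto
    also have "\<dots> = 3 * ennreal (unit_ball_vol 3)"
      using emeasure_ball[of 1 "0::real^3"] by simp
    also have "\<dots> = ennreal (3 * unit_ball_vol 3)"
      by (simp add: ennreal_mult' unit_ball_vol_nonneg)
    finally have "measure ?D (space ?D) = 3 * unit_ball_vol 3"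
      by (simp add: measure_def unit_ball_vol_nonneg)
    also have "\<dots> = Omega 3"
    proof -
      \<comment> \<open>The sphere has three times the volume of the ball; \<Gamma>(5/2) = (3/2)
        \<Gamma>(3/2) turns this into \<Omega>_3.\<close>
      have G: "Gamma (3 / 2 + 1 :: real) = 3 / 2 * Gamma (3 / 2)" by (rule Gamma_plus1) (auto simp: nonpos_Ints_def)
      have G0: "Gamma (3 / 2 :: real) > 0" by (rule Gamma_real_pos) simp
      have V: "unit_ball_vol 3 = pi powr (3 / 2) / Gamma (3 / 2 + 1)" by (simp add: unit_ball_vol_def)
      have O: "Omega 3 = 2 * pi powr (3 / 2) / Gamma (3 / 2)" by (simp add: Omega_def)
      show ?thesis unfolding V O G using G0 by (simp add: field_simps)
    qed
    finally show ?thesis .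
  qed
  finally show ?thesis by (simp add: scaleR_conv_of_real mult.commute)
qed

section \<open>The symbols at a boundary point\<close>

lemma cliff_anticomm:
  assumes "clifford_gens c" "i \<noteq> j"
  shows "c i ** c j = - (c j ** c i)"
  using assms by (simp add: clifford_gens_def eq_neg_iff_add_eq_0)

lemma cliff_sq:
  assumes "clifford_gens c"
  shows "c i ** c i = cscale (- 1) (mat 1)"
  using cl_vec_sq[OF assms, of "axis i 1"] by (simp add: cl_vec_axis inner_axis_axis)

lemma pi_plus_mat_eval:
  assumes s: "s > 0" and h: "\<And>\<eta>. h \<eta> = cscale (pole_part (\<i> * of_real s) u1 u2 u3 (of_real \<eta>)) U +
      cscale (pole_part (- (\<i> * of_real s)) v1 v2 v3 (of_real \<eta>)) V"
  shows "pi_plus_mat h t = cscale (pole_part (\<i> * of_real s) u1 u2 u3 (of_real t)) U"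
proof -
  have m: "pole_part c w1 w2 w3 z * k = pole_part c (w1 * k) (w2 * k) (w3 * k) z" for c w1 w2 w3 z k
    by (simp add: pole_part_def algebra_simps)
  have "pi_plus (\<lambda>\<eta>. h \<eta> $ i $ j) t = pole_part (\<i> * of_real s) u1 u2 u3 (of_real t) * U $ i $ j" for i j
    unfolding m by (rule pi_plus_eval[OF s, where ?v1.0 = "v1 * V $ i $ j" and ?v2.0 = "v2 * V $ i $ j" and ?v3.0 = "v3 * V $ i $ j"])
      (simp add: h m)
  then show ?thesis by (simp add: pi_plus_mat_def vec_eq_iff)
qed

lemma has_vector_derivative_cscale:
  "(f has_vector_derivative f') F \<Longrightarrow> ((\<lambda>t. cscale (f t) U) has_vector_derivative cscale f' U) F"
  by (rule bounded_linear.has_vector_derivative[OF cscale.bounded_linear_left])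

text \<open>The square of \<open>pole_up\<close> is 0, which removes the term with poles on the same
  side; the mixed product has trace 2.\<close>

lemma trace_pole_products:
  assumes c: "clifford_gens c" and y: "y \<noteq> 0"
  shows "trace (cscale f (pole_up c y) ** (cscale g (pole_up c y) + cscale h (pole_down c y))) = 2 * f * h"
proof -
  have tr: "trace (cscale z M) = z * trace M" for z and M :: "complex^4^4"
    by (simp add: trace_def sum_distrib_left)
  show ?thesis
    by (simp add: matmul.add_right matmul_cscale_left matmul_cscale_right cscale_cscale pole_matrices[OF c y]
        cscale.zero_right tr)
qed

text \<open>The first two identities bring the traces into the form of
  \<open>residue_integral_pairs\<close>, the last two bring \<sigma>_(-2) into the form of
  \<open>pole_part\<close>.\<close>

lemma residue_algebra:
  fixes z w n :: complex and s r :: real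
  shows "2 * (of_real s * (1 / 2 / z + \<i> * n / z\<^sup>2)) * (2 / w ^ 3) =
      of_real s * (2 / (z * w ^ 3) + 4 * \<i> * n / (z\<^sup>2 * w ^ 3))" (is ?P1)
    and "2 * (0 / z + - \<i> * of_real s / 4 / z\<^sup>2 + - of_real (s * r) / z ^ 3) * (- 1 / w\<^sup>2) =
      \<i> * of_real s * (1 / (2 * (z\<^sup>2 * w\<^sup>2)) - 2 * \<i> * of_real r / (z ^ 3 * w\<^sup>2))" (is ?P2)
    and "\<i> * of_real s * (- 1 / 4 / z\<^sup>2 + \<i> * of_real r / z ^ 3) =
      0 / z + - \<i> * of_real s / 4 / z\<^sup>2 + - of_real (s * r) / z ^ 3" (is ?P3)
    and "\<i> * of_real s * (- 1 / 4 / z\<^sup>2 - \<i> * of_real r / z ^ 3) =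
      0 / z + - \<i> * of_real s / 4 / z\<^sup>2 + of_real (s * r) / z ^ 3" (is ?P4)
proof -
  \<comment> \<open>In terms of the reciprocals these are polynomial identities modulo \<i>^2 = -1,
    which hold even where z or w is 0.\<close>
  define a where "a = 1 / z"
  define b where "b = 1 / w"
  have i: "\<i> * \<i> = (- 1 :: complex)" by simp
  have e: "x / z = x * a" "x / z\<^sup>2 = x * a\<^sup>2" "x / z ^ 3 = x * a ^ 3" "x / w\<^sup>2 = x * b\<^sup>2" "x / w ^ 3 = x * b ^ 3"
    "x / (z * w ^ 3) = x * (a * b ^ 3)" "x / (z\<^sup>2 * w ^ 3) = x * (a\<^sup>2 * b ^ 3)"
    "x / (2 * (z\<^sup>2 * w\<^sup>2)) = x / 2 * (a\<^sup>2 * b\<^sup>2)" "x / (z ^ 3 * w\<^sup>2) = x * (a ^ 3 * b\<^sup>2)" for x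
    by (simp_all add: a_def b_def power_divide)
  show ?P1
    unfolding e by algebra
  show ?P2
    unfolding e of_real_mult using i by algebra
  show ?P3
    unfolding e of_real_mult using i by algebra
  show ?P4
    unfolding e of_real_mult using i by algebra
qed

locale flat_point = collar_setup X B \<phi> \<psi>
  for X :: "'m::{t2_space,second_countable_topology} spin_mfd" and B \<phi> \<psi> +
  fixes a :: "'m spin_frame" and p :: 'm and D P :: "('m \<Rightarrow> complex^4) \<Rightarrow> ('m \<Rightarrow> complex^4)"
  assumes ff: "flat_frame X B a" and pa: "p \<in> fdom a" and pb: "p \<in> bdry B"
    and D: "dirac_operator X D" and P: "parametrix X D P"
begin

definition x0 :: "real^4" where "x0 = fmap a p"

definition T :: "(real^4) set" where "T = tube_part (fchart a)"

lemma frame_facts: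
  shows "a \<in> spin_frames X" "flat_chart X B (fchart a)" "product_chart X B (fchart a)" "clifford_gens (cliff X)"
    and "open T" "T \<subseteq> fimg a" "x0 \<in> T" "x0 $ 4 = 0"
proof -
  show a: "a \<in> spin_frames X" and f: "flat_chart X B (fchart a)" using ff by (auto simp: flat_frame_def)
  then show pc: "product_chart X B (fchart a)" by (simp add: flat_chart_def)
  show "clifford_gens (cliff X)" by (rule spin_mfd_facts(4)[OF mfd a])
  show "open T" "T \<subseteq> fimg a" "x0 \<in> T"
    using tube_part[OF pc] pa pb by (auto simp: T_def x0_def)
  show "x0 $ 4 = 0" using product_chart_coords(4)[OF pc pa] nbhd_facts(7)[OF pb] by (simp add: x0_def)
qed

lemma height_range: "x \<in> T \<Longrightarrow> (x :: real^4) $ 4 \<in> {lo B<..<hi B}"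
  unfolding T_def by (rule tube_part_metric(1)[OF frame_facts(3)])

lemma local_metric:
  fixes x :: "real^4"
  assumes "x \<in> T"
  shows "metric X (fchart a) x $ i $ j = (if i = j then profile i (x $ 4) else 0)"
  using flat_metric[OF frame_facts(2)] assms by (simp add: T_def)

lemma local_frame:
  fixes x :: "real^4"
  assumes "x \<in> T"
  shows "frame a x $ i $ j = (if i = j then 1 / sqrt (profile i (x $ 4)) else 0)"
proof -
  have "x \<in> fimg a" using assms frame_facts(6) by blast
  then have "frame a x = (\<chi> i j. if i = j then 1 / sqrt (metric X (fchart a) x $ i $ i) else 0)"
    using ff unfolding flat_frame_def by blast
  then show ?thesis using local_metric[OF assms] by simp
qed

section \<open>First order data at the boundary point: Christoffel symbols, connection form, zeroth
  order term of D\<close>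

definition metric_slope :: "4 \<Rightarrow> real" where
  "metric_slope i = (if i = 4 then slope else - slope)"

lemma partial_local_metric:
  "partial k (\<lambda>y. metric X (fchart a) y $ i $ j) x0 = (if k = 4 \<and> i = j then metric_slope i else 0)"
proof (cases "i = j")
  case True
  have "partial k (\<lambda>y. metric X (fchart a) y $ i $ j) x0 = (if k = 4 then metric_slope i else 0)"
    by (rule partial_of_last[OF frame_facts(5,7), where F = "profile i"])
      (use True local_metric profile_derivative frame_facts(8) in
        \<open>auto simp: metric_slope_def has_real_derivative_iff_has_vector_derivative\<close>)
  then show ?thesis using True by simp
next
  case False
  then show ?thesis
    using partial_cong[OF frame_facts(5,7), of "\<lambda>y. metric X (fchart a) y $ i $ j" "\<lambda>_. 0"] local_metric
    by (simp add: partial_const)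
qed

lemma inverse_sqrt_profile_derivative:
  "((\<lambda>t. 1 / sqrt (profile i t)) has_real_derivative - metric_slope i / 2) (at 0)"
proof -
  have "(profile i has_real_derivative metric_slope i) (at 0)"
    using profile_derivative[of i] by (simp add: metric_slope_def)
  then show ?thesis by (auto intro!: derivative_eq_intros)
qed

lemma partial_local_frame:
  "partial k (\<lambda>y. frame a y $ i $ j) x0 = (if k = 4 \<and> i = j then - metric_slope i / 2 else 0)"
proof (cases "i = j")
  case True
  have "partial k (\<lambda>y. frame a y $ i $ j) x0 = (if k = 4 then - metric_slope i / 2 else 0)"
    by (rule partial_of_last[OF frame_facts(5,7), where F = "\<lambda>t. 1 / sqrt (profile i t)"])
      (use True local_frame inverse_sqrt_profile_derivative[of i] frame_facts(8) in
        \<open>auto simp: has_real_derivative_iff_has_vector_derivative\<close>)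
  then show ?thesis using True by simp
next
  case False
  then show ?thesis
    using partial_cong[OF frame_facts(5,7), of "\<lambda>y. frame a y $ i $ j" "\<lambda>_. 0"] local_frame
    by (simp add: partial_const)
qed

lemma frame_metric_x0: "metric X (fchart a) x0 = mat 1" "frame a x0 = mat 1"
  using local_metric[OF frame_facts(7)] local_frame[OF frame_facts(7)] frame_facts(8)
  by (auto simp: vec_eq_iff mat_def)

lemma sum_mat_1:
  "(\<Sum>k\<in>UNIV. f k * (mat 1 :: real^'n^'n) $ k $ j) = f j"
  "(\<Sum>k\<in>UNIV. (mat 1 :: real^'n^'n) $ k $ j * f k) = f j"
proof -
  have "(\<Sum>k\<in>UNIV. f k * (mat 1 :: real^'n^'n) $ k $ j) = (\<Sum>k\<in>UNIV. if k = j then f k else 0)"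
    by (rule sum.cong) (auto simp: mat_def)
  then show "(\<Sum>k\<in>UNIV. f k * (mat 1 :: real^'n^'n) $ k $ j) = f j" by simp
  then show "(\<Sum>k\<in>UNIV. (mat 1 :: real^'n^'n) $ k $ j * f k) = f j" by (simp add: mult.commute)
qed

lemma christoffel_x0: "christoffel X (fchart a) x0 k i j =
  ((if i = 4 \<and> j = k then metric_slope j else 0) + (if j = 4 \<and> i = k then metric_slope i else 0)
    - (if k = 4 \<and> i = j then metric_slope i else 0)) / 2"
proof -
  have "matrix_inv (mat 1 :: real^4^4) = mat 1"
    using matrix_inv_right_left(1)[of "mat 1 :: real^4^4"] by (auto simp: invertible_def matrix_mul_lid)
  then have "christoffel X (fchart a) x0 k i j = (\<Sum>l\<in>UNIV. if k = l then
      ((if i = 4 \<and> j = l then metric_slope j else 0) + (if j = 4 \<and> i = l then metric_slope i else 0)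
        - (if l = 4 \<and> i = j then metric_slope i else 0)) / 2 else 0)"
    unfolding christoffel_def frame_metric_x0 partial_local_metric
    by (intro sum.cong) (auto simp: mat_def)
  then show ?thesis by simp
qed

lemma conn_form_x0: "conn_form X a x0 j l m =
  ((if l = 4 \<and> j = m then metric_slope j else 0) - (if m = 4 \<and> j = l then metric_slope j else 0)) / 2"
proof -
  define w where "w p = (\<Sum>k\<in>UNIV. (mat 1 :: real^4^4) $ k $ j *
      (partial k (\<lambda>y. frame a y $ p $ l) x0 +
            (\<Sum>r\<in>UNIV. christoffel X (fchart a) x0 p k r * (mat 1 :: real^4^4) $ r $ l)))" for p
  have "conn_form X a x0 j l m = (\<Sum>p\<in>UNIV. \<Sum>q\<in>UNIV. (mat 1 :: real^4^4) $ p $ q * (mat 1 :: real^4^4) $ q $ m * w p)"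
    by (simp add: conn_form_def w_def frame_metric_x0)
  also have "\<dots> = (\<Sum>p\<in>UNIV. w p * (mat 1 :: real^4^4) $ p $ m)"
  proof (rule sum.cong)
    fix p :: 4
    have "(\<Sum>q\<in>UNIV. (mat 1 :: real^4^4) $ p $ q * (mat 1 :: real^4^4) $ q $ m * w p) =
        w p * (\<Sum>q\<in>UNIV. (mat 1 :: real^4^4) $ p $ q * (mat 1 :: real^4^4) $ q $ m)"
      by (simp add: sum_distrib_left mult_ac)
    then show "(\<Sum>q\<in>UNIV. (mat 1 :: real^4^4) $ p $ q * (mat 1 :: real^4^4) $ q $ m * w p) = w p * (mat 1 :: real^4^4) $ p $ m"
      by (simp add: sum_mat_1)
  qed simp
  also have "\<dots> = w m" by (rule sum_mat_1)
  also have "w m = partial j (\<lambda>y. frame a y $ m $ l) x0 + christoffel X (fchart a) x0 m j l"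
    by (simp only: w_def sum_mat_1)
  \<comment> \<open>The derivative of the normalisation factor of the frame cancels the Christoffel
    term with j = 4 and l = m; what remains is antisymmetric in l and m.\<close>
  also have "\<dots> = ((if l = 4 \<and> j = m then metric_slope j else 0) - (if m = 4 \<and> j = l then metric_slope j else 0)) / 2"
    unfolding partial_local_frame christoffel_x0 by (auto simp: field_simps)
  finally show ?thesis .
qed

abbreviation "c \<equiv> cliff X"

lemma dirac_alpha_local:
  fixes x :: "real^4"
  assumes "x \<in> T"
  shows "dirac_alpha X a x k = (1 / sqrt (profile k (x $ 4))) *\<^sub>R c k"
proof -
  have "dirac_alpha X a x k = (\<Sum>j\<in>UNIV. if k = j then (1 / sqrt (profile k (x $ 4))) *\<^sub>R c j else 0)"
    unfolding dirac_alpha_def local_frame[OF assms] by (intro sum.cong) auto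
  then show ?thesis by simp
qed

text \<open>Each tangential j contributes -slope/4 times c_4, because c_j c_4 c_j - c_j c_j c_4 = 2
  c_4; j = 4 contributes nothing, and there are three tangential directions.\<close>

lemma dirac_beta_x0: "dirac_beta X a x0 = (- (3 / 4) * slope) *\<^sub>R c 4"
proof -
  define w where "w j l m = c j ** (c l ** c m)" for j l m
  have "dirac_beta X a x0 = (\<Sum>j\<in>UNIV. \<Sum>l\<in>UNIV. \<Sum>m\<in>UNIV.
      (if l = 4 then if m = j then (metric_slope j / 8) *\<^sub>R w j l m else 0 else 0) -
      (if m = 4 then if l = j then (metric_slope j / 8) *\<^sub>R w j l m else 0 else 0))"
    unfolding dirac_beta_def conn_form_x0 w_def by (intro sum.cong) auto
  also have "\<dots> = (\<Sum>j\<in>UNIV. (metric_slope j / 8) *\<^sub>R (w j 4 j - w j j 4))"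
  proof (rule sum.cong)
    fix j :: 4
    have "(\<Sum>l\<in>UNIV. \<Sum>m\<in>UNIV. (if l = 4 then if m = j then (metric_slope j / 8) *\<^sub>R w j l m else 0 else 0)) =
        (\<Sum>l\<in>UNIV. if l = 4 then (metric_slope j / 8) *\<^sub>R w j l j else 0)"
      by (intro sum.cong) auto
    moreover have "(\<Sum>l\<in>UNIV. \<Sum>m\<in>UNIV. (if m = 4 then if l = j then (metric_slope j / 8) *\<^sub>R w j l m else 0 else 0)) =
        (\<Sum>l\<in>UNIV. if l = j then (metric_slope j / 8) *\<^sub>R w j l 4 else 0)"
      by (intro sum.cong) auto
    ultimately show "(\<Sum>l\<in>UNIV. \<Sum>m\<in>UNIV.
      (if l = 4 then if m = j then (metric_slope j / 8) *\<^sub>R w j l m else 0 else 0) -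
      (if m = 4 then if l = j then (metric_slope j / 8) *\<^sub>R w j l m else 0 else 0)) =
      (metric_slope j / 8) *\<^sub>R (w j 4 j - w j j 4)"
      by (simp add: sum_subtractf scaleR_diff_right)
  qed simp
  also have "\<dots> = (\<Sum>j\<in>UNIV. if j = (4::4) then 0 else (- slope / 4) *\<^sub>R c 4)"
  proof (rule sum.cong)
    fix j :: 4
    show "(metric_slope j / 8) *\<^sub>R (w j 4 j - w j j 4) = (if j = 4 then 0 else (- slope / 4) *\<^sub>R c 4)"
    proof (cases "j = 4")
      case False
      have 1: "w j j 4 = - c 4"
        by (simp add: w_def matrix_mul_assoc cliff_sq[OF frame_facts(4)] matmul_cscale_left vec_eq_iff)
      have 2: "w j 4 j = - w j j 4"
        unfolding w_def using cliff_anticomm[OF frame_facts(4), of 4 j] False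
        by (simp add: matmul.minus_right)
      have "w j 4 j - w j j 4 = (2::real) *\<^sub>R c 4" unfolding 2 1 by (simp add: scaleR_2)
      then show ?thesis using False by (simp add: metric_slope_def)
    qed simp
  qed simp
  also have "\<dots> = (- (3 / 4) * slope) *\<^sub>R c 4"
  proof -
    have "(\<Sum>j\<in>UNIV. if j = (4::4) then 0 else v) = v + v + v" for v :: "complex^4^4"
      by (simp add: sum_4)
    then show ?thesis by (simp only: scaleR_add_left[symmetric]) simp
  qed
  finally show ?thesis .
qed

section \<open>The symbols of order -1 and -2 and their projections\<close>

definition amp :: "real \<Rightarrow> real" where "amp r = sqrt (\<psi> r)"

text \<open>At height r the tangential covector y has length sqrt(\<phi>(r)) |y|, and \<eta> is
  weighted by 1/sqrt(\<psi>(r)); so the squared length of (y, \<eta>) vanishes at \<plusminus> \<i>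
  times this number.\<close>

definition pole_at :: "real^3 \<Rightarrow> real \<Rightarrow> real" where "pole_at y r = norm y * (sqrt (\<phi> r) * sqrt (\<psi> r))"

definition leading :: "real^3 \<Rightarrow> real \<Rightarrow> real \<Rightarrow> complex^4^4" where
  "leading y \<eta> r = cscale (of_real (amp r) / (of_real \<eta> - \<i> * of_real (pole_at y r))) (pole_up c y) +
     cscale (of_real (amp r) / (of_real \<eta> + \<i> * of_real (pole_at y r))) (pole_down c y)"

lemma pole_at_pos: "y \<noteq> 0 \<Longrightarrow> r \<in> {lo B<..<hi B} \<Longrightarrow> pole_at y r > 0"
  using profile_facts by (simp add: pole_at_def)

lemma pole_at_0 [simp]: "pole_at y 0 = norm y" "amp 0 = 1"
  using profile_facts by (simp_all add: pole_at_def amp_def)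

lemma join_nonzero: "y \<noteq> 0 \<Longrightarrow> join y t \<noteq> 0"
  by (metis join_nth(2) vec_eq_iff zero_index)

text \<open>In the orthonormal frame the covector (y, \<eta>) becomes (sqrt(\<phi>) y,
  \<eta>/sqrt(\<psi>)); partial fractions then regroup its two Clifford components into the
  residues.\<close>

lemma dirac_resolvent_local:
  fixes x :: "real^4"
  assumes x: "x \<in> T" and y: "y \<noteq> 0"
  shows "dirac_resolvent X a x (join y \<eta>) = leading y \<eta> (x $ 4)"
proof -
  define r where "r = x $ 4"
  define f where "f = sqrt (\<phi> r)"
  define g where "g = sqrt (\<psi> r)"
  define \<rho> where "\<rho> = norm y"
  have r: "r \<in> {lo B<..<hi B}" using height_range[OF x] by (simp add: r_def)
  then have fg: "f > 0" "g > 0" using profile_facts by (auto simp: f_def g_def)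
  have rho: "\<rho> > 0" using y by (simp add: \<rho>_def)
  define v where "v = transpose (frame a x) *v join y \<eta>"
  have v: "v = join (f *\<^sub>R y) (\<eta> / g)"
  proof -
    have "v $ k = (1 / sqrt (profile k r)) * join y \<eta> $ k" for k
    proof -
      have "v $ k = (\<Sum>j\<in>UNIV. if j = k then (1 / sqrt (profile k r)) * join y \<eta> $ j else 0)"
        unfolding v_def matrix_vector_mult_def transpose_def vec_lambda_beta local_frame[OF x] r_def[symmetric]
        by (intro sum.cong) auto
      then show ?thesis by simp
    qed
    then have "v $ 4 = \<eta> / g" "v $ inc i = (f *\<^sub>R y) $ i" for i
      by (simp_all add: profile_def f_def g_def real_sqrt_divide)
    then show ?thesis by (intro join_eqI) (auto simp: tang_def vec_eq_iff)
  qed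
  have vv: "v \<bullet> v = f\<^sup>2 * \<rho>\<^sup>2 + \<eta>\<^sup>2 / g\<^sup>2"
  proof -
    have "v \<bullet> v = (f *\<^sub>R y) \<bullet> (f *\<^sub>R y) + (\<eta> / g) * (\<eta> / g)"
      by (simp add: v inner_vec_def sum_UNIV_4_split)
    then show ?thesis by (simp add: \<rho>_def dot_square_norm power2_eq_square)
  qed
  have cv: "cl_vec c v = (f * \<rho>) *\<^sub>R cliff_tangent c y + (\<eta> / g) *\<^sub>R c 4"
  proof -
    have "v = (f * \<rho>) *\<^sub>R join ((1 / norm y) *\<^sub>R y) 0 + (\<eta> / g) *\<^sub>R axis 4 1"
    proof -
      have "v $ k = ((f * \<rho>) *\<^sub>R join ((1 / norm y) *\<^sub>R y) 0 + (\<eta> / g) *\<^sub>R axis 4 1) $ k" for k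
        using rho by (cases k rule: index_cases) (auto simp: v axis_def \<rho>_def)
      then show ?thesis by (simp add: vec_eq_iff)
    qed
    then show ?thesis by (simp only: cl_vec_add cl_vec_scaleR cl_vec_axis cliff_tangent_def)
  qed
  have pole: "pole_at y r = \<rho> * (f * g)" "amp r = g"
    by (simp_all add: pole_at_def \<rho>_def f_def g_def amp_def)
  define N where "N = complex_of_real (v \<bullet> v)"
  define z where "z = complex_of_real \<eta> - \<i> * of_real (\<rho> * (f * g))"
  define w where "w = complex_of_real \<eta> + \<i> * of_real (\<rho> * (f * g))"
  have pf: "\<i> * of_real (f * \<rho>) / N = of_real g / 2 * (1 / z - 1 / w)"
    "\<i> * of_real (\<eta> / g) / N = \<i> * of_real g / 2 * (1 / z + 1 / w)"
    unfolding N_def vv z_def w_def by (rule resolvent_partial_fractions[OF fg rho])+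
  have "dirac_resolvent X a x (join y \<eta>) = cscale (\<i> / N) ((f * \<rho>) *\<^sub>R cliff_tangent c y + (\<eta> / g) *\<^sub>R c 4)"
    unfolding dirac_resolvent_def Let_def v_def[symmetric] N_def cv ..
  also have "\<dots> = cscale (\<i> * of_real (f * \<rho>) / N) (cliff_tangent c y) + cscale (\<i> * of_real (\<eta> / g) / N) (c 4)"
    by (simp only: cscale.add_right cscale.scaleR_right cscale_of_real[symmetric] times_divide_eq_left)
  also have "\<dots> = cscale (of_real g / z) (pole_up c y) + cscale (of_real g / w) (pole_down c y)"
    unfolding pf pole_up_def pole_down_def by (simp add: vec_eq_iff algebra_simps)
  finally show ?thesis
    by (simp add: leading_def r_def[symmetric] pole z_def w_def)
qed

lemma hsymbol_leading:
  fixes x :: "real^4"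
  assumes x: "x \<in> T" and y: "y \<noteq> 0"
  shows "hsymbol a P (- 1) x (join y \<eta>) = leading y \<eta> (x $ 4)"
proof -
  have "hsymbol a P (- 1) x (join y \<eta>) = dirac_inverse_symbol X a (- 1) x (join y \<eta>)"
    by (rule hsymbol_parametrix[OF mfd frame_facts(1) D P _ join_nonzero[OF y]]) (use x frame_facts(6) in blast)
  also have "\<dots> = dirac_resolvent X a x (join y \<eta>)"
    by (simp add: dirac_inverse_symbol_def inverse_symbol_def)
  finally show ?thesis by (simp only: dirac_resolvent_local[OF x y])
qed

text \<open>At 0 the amplitude sqrt(\<psi>) has derivative slope/2 and the pole position q
  sqrt(\<phi>) sqrt(\<psi>) has derivative q slope. Both signs of q are allowed, which covers both
  poles.\<close>

lemma pole_coefficient_derivative: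
  fixes q :: real
  assumes q: "q \<noteq> 0"
  shows "((\<lambda>r. of_real (amp r) / (of_real t - \<i> * of_real (q * (sqrt (\<phi> r) * sqrt (\<psi> r))))) has_vector_derivative
    of_real slope * (1 / 2 / (of_real t - \<i> * of_real q) + \<i> * of_real q / (of_real t - \<i> * of_real q)\<^sup>2)) (at 0)"
proof -
  have nz: "complex_of_real t - \<i> * of_real q \<noteq> 0" by (rule real_shift_nonzero[OF q])
  have "(amp has_real_derivative slope / 2) (at 0)"
    unfolding amp_def using profile_facts by (auto intro!: derivative_eq_intros)
  then have 1: "((\<lambda>r. complex_of_real (amp r)) has_vector_derivative of_real (slope / 2)) (at 0)"
    by (intro has_vector_derivative_of_real) (simp add: has_real_derivative_iff_has_vector_derivative)
  have "((\<lambda>r. q * (sqrt (\<phi> r) * sqrt (\<psi> r))) has_real_derivative q * slope) (at 0)"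
    using profile_facts by (auto intro!: derivative_eq_intros)
  then have "((\<lambda>r. complex_of_real (q * (sqrt (\<phi> r) * sqrt (\<psi> r)))) has_vector_derivative of_real (q * slope)) (at 0)"
    by (intro has_vector_derivative_of_real) (simp add: has_real_derivative_iff_has_vector_derivative)
  then have f: "((\<lambda>r. of_real t - \<i> * complex_of_real (q * (sqrt (\<phi> r) * sqrt (\<psi> r)))) has_vector_derivative
      0 - \<i> * of_real (q * slope)) (at 0)"
    by (intro has_vector_derivative_diff has_vector_derivative_const has_vector_derivative_mult_right)
  have g: "(inverse has_field_derivative - (inverse (of_real t - \<i> * of_real q))\<^sup>2)
      (at (of_real t - \<i> * complex_of_real (q * (sqrt (\<phi> 0) * sqrt (\<psi> 0)))))"
    using DERIV_inverse[OF nz] profile_facts by (simp add: numeral_2_eq_2)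
  have 2: "((\<lambda>r. inverse (of_real t - \<i> * complex_of_real (q * (sqrt (\<phi> r) * sqrt (\<psi> r))))) has_vector_derivative
      (0 - \<i> * of_real (q * slope)) * - (inverse (of_real t - \<i> * of_real q))\<^sup>2) (at 0)"
    using field_vector_diff_chain_at[OF f g] by (simp only: o_def)
  define Z where "Z = complex_of_real t - \<i> * of_real q"
  have Z: "of_real t - \<i> * complex_of_real (q * (sqrt (\<phi> 0) * sqrt (\<psi> 0))) = Z"
    using profile_facts by (simp add: Z_def)
  have amp: "amp 0 = 1" using profile_facts by (simp add: amp_def)
  have eq: "of_real (amp 0) * ((0 - \<i> * of_real (q * slope)) * - (inverse Z)\<^sup>2) + of_real (slope / 2) * inverse Z =
      of_real slope * (1 / 2 / Z + \<i> * of_real q / Z\<^sup>2)"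
    unfolding amp divide_inverse power_inverse[symmetric] by (simp add: distrib_left mult_ac)
  have "((\<lambda>r. of_real (amp r) * inverse (of_real t - \<i> * complex_of_real (q * (sqrt (\<phi> r) * sqrt (\<psi> r)))))
      has_vector_derivative of_real slope * (1 / 2 / Z + \<i> * of_real q / Z\<^sup>2)) (at 0)"
    using has_vector_derivative_mult[OF 1 2] unfolding Z Z_def[symmetric] eq .
  then show ?thesis unfolding Z_def divide_inverse[of "complex_of_real (amp _)"] .
qed

definition slope_up :: "real^3 \<Rightarrow> real \<Rightarrow> complex" where
  "slope_up y t = of_real slope * (1 / 2 / (of_real t - \<i> * of_real (norm y)) +
     \<i> * of_real (norm y) / (of_real t - \<i> * of_real (norm y))\<^sup>2)"

definition slope_down :: "real^3 \<Rightarrow> real \<Rightarrow> complex" where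
  "slope_down y t = of_real slope * (1 / 2 / (of_real t + \<i> * of_real (norm y)) -
     \<i> * of_real (norm y) / (of_real t + \<i> * of_real (norm y))\<^sup>2)"

lemma leading_coefficients_derivative:
  assumes y: "y \<noteq> 0"
  shows "((\<lambda>r. of_real (amp r) / (of_real t - \<i> * of_real (pole_at y r))) has_vector_derivative slope_up y t) (at 0)"
    and "((\<lambda>r. of_real (amp r) / (of_real t + \<i> * of_real (pole_at y r))) has_vector_derivative slope_down y t) (at 0)"
  using pole_coefficient_derivative[of "norm y" t] pole_coefficient_derivative[of "- norm y" t] y
  by (simp_all add: pole_at_def slope_up_def slope_down_def)

lemma leading_derivative:
  assumes y: "y \<noteq> 0"
  shows "(leading y \<eta> has_vector_derivative cscale (slope_up y \<eta>) (pole_up c y) + cscale (slope_down y \<eta>) (pole_down c y)) (at 0)"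
  unfolding leading_def
  by (intro has_vector_derivative_add has_vector_derivative_cscale leading_coefficients_derivative[OF y])

lemma vderiv_hsymbol:
  assumes y: "y \<noteq> 0"
  shows "vderiv (\<lambda>\<eta>. hsymbol a P (- 1) x0 (join y \<eta>)) = (\<lambda>t.
      cscale (- 1 / (of_real t - \<i> * of_real (norm y))\<^sup>2) (pole_up c y) +
      cscale (- 1 / (of_real t + \<i> * of_real (norm y))\<^sup>2) (pole_down c y))"
    and "vderiv (vderiv (\<lambda>\<eta>. hsymbol a P (- 1) x0 (join y \<eta>))) = (\<lambda>t.
      cscale (2 / (of_real t - \<i> * of_real (norm y)) ^ 3) (pole_up c y) +
      cscale (2 / (of_real t + \<i> * of_real (norm y)) ^ 3) (pole_down c y))"
proof -
  have d1: "((\<lambda>t. 1 / (of_real t - b)) has_vector_derivative - 1 / (of_real t - b)\<^sup>2) (at t)"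
    and d2: "((\<lambda>t. - 1 / (of_real t - b)\<^sup>2) has_vector_derivative 2 / (of_real t - b) ^ 3) (at t)"
    if "of_real t - b \<noteq> 0" for b :: complex and t
  proof -
    have "((\<lambda>z. 1 / (z - b)) has_field_derivative - 1 / (of_real t - b)\<^sup>2) (at (of_real t))"
      using that by (auto intro!: derivative_eq_intros simp: power2_eq_square)
    then show "((\<lambda>t. 1 / (of_real t - b)) has_vector_derivative - 1 / (of_real t - b)\<^sup>2) (at t)"
      by (rule has_vector_derivative_real_field)
    have "((\<lambda>z. - 1 / (z - b)\<^sup>2) has_field_derivative 2 / (of_real t - b) ^ 3) (at (of_real t))"
      using that by (auto intro!: derivative_eq_intros simp: divide_simps power2_eq_square power3_eq_cube)
    then show "((\<lambda>t. - 1 / (of_real t - b)\<^sup>2) has_vector_derivative 2 / (of_real t - b) ^ 3) (at t)"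
      by (rule has_vector_derivative_real_field)
  qed
  have nz: "of_real t - \<i> * of_real (norm y) \<noteq> 0" "of_real t - - (\<i> * of_real (norm y)) \<noteq> 0" for t
    using real_shift_nonzero[of "norm y" t] real_shift_nonzero[of "- norm y" t] y by auto
  have h: "hsymbol a P (- 1) x0 (join y \<eta>) = cscale (1 / (of_real \<eta> - \<i> * of_real (norm y))) (pole_up c y) +
     cscale (1 / (of_real \<eta> - - (\<i> * of_real (norm y)))) (pole_down c y)" for \<eta>
    using hsymbol_leading[OF frame_facts(7) y] frame_facts(8) by (simp add: leading_def)
  have "((\<lambda>\<eta>. hsymbol a P (- 1) x0 (join y \<eta>)) has_vector_derivative
      cscale (- 1 / (of_real t - \<i> * of_real (norm y))\<^sup>2) (pole_up c y) +
      cscale (- 1 / (of_real t - - (\<i> * of_real (norm y)))\<^sup>2) (pole_down c y)) (at t)" for t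
    unfolding h by (intro has_vector_derivative_add has_vector_derivative_cscale d1 nz)
  then show v1: "vderiv (\<lambda>\<eta>. hsymbol a P (- 1) x0 (join y \<eta>)) = (\<lambda>t.
      cscale (- 1 / (of_real t - \<i> * of_real (norm y))\<^sup>2) (pole_up c y) +
      cscale (- 1 / (of_real t + \<i> * of_real (norm y))\<^sup>2) (pole_down c y))"
    by (auto simp: vderiv_def fun_eq_iff vector_derivative_at)
  have "((\<lambda>t. cscale (- 1 / (of_real t - \<i> * of_real (norm y))\<^sup>2) (pole_up c y) +
      cscale (- 1 / (of_real t - - (\<i> * of_real (norm y)))\<^sup>2) (pole_down c y)) has_vector_derivative
      cscale (2 / (of_real t - \<i> * of_real (norm y)) ^ 3) (pole_up c y) +
      cscale (2 / (of_real t - - (\<i> * of_real (norm y))) ^ 3) (pole_down c y)) (at t)" for t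
    by (intro has_vector_derivative_add has_vector_derivative_cscale d2 nz)
  then show "vderiv (vderiv (\<lambda>\<eta>. hsymbol a P (- 1) x0 (join y \<eta>))) = (\<lambda>t.
      cscale (2 / (of_real t - \<i> * of_real (norm y)) ^ 3) (pole_up c y) +
      cscale (2 / (of_real t + \<i> * of_real (norm y)) ^ 3) (pole_down c y))"
    unfolding v1 by (auto simp: vderiv_def fun_eq_iff vector_derivative_at)
qed

text \<open>The pole moves with the height, so \<pi>+ is evaluated at every height near 0 before the
  normal derivative is taken; it keeps the \<open>pole_up\<close> term, whose coefficient alone
  depends on r.\<close>

lemma normal_derivative_pi_plus:
  assumes y: "y \<noteq> 0"
  shows "vderiv (\<lambda>r. pi_plus_mat (\<lambda>\<eta>. hsymbol a P (- 1) (x0 + r *\<^sub>R axis 4 1) (join y \<eta>)) t) 0 =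
    cscale (slope_up y t) (pole_up c y)"
proof -
  let ?S = "(\<lambda>r. x0 + r *\<^sub>R axis 4 1) -` T"
  have op: "open ?S" by (rule open_vimage[OF frame_facts(5)]) (intro continuous_intros)
  have "pi_plus_mat (\<lambda>\<eta>. hsymbol a P (- 1) (x0 + r *\<^sub>R axis 4 1) (join y \<eta>)) t =
      cscale (of_real (amp r) / (of_real t - \<i> * of_real (pole_at y r))) (pole_up c y)" if "r \<in> ?S" for r
  proof -
    have x: "x0 + r *\<^sub>R axis 4 1 \<in> T" using that by simp
    have r: "(x0 + r *\<^sub>R axis 4 1) $ 4 = r" using frame_facts(8) by (simp add: axis_def)
    have "pole_at y r > 0" using pole_at_pos[OF y] height_range[OF x] r by simp
    from pi_plus_mat_eval[OF this, of "\<lambda>\<eta>. hsymbol a P (- 1) (x0 + r *\<^sub>R axis 4 1) (join y \<eta>)" "of_real (amp r)" 0 0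
        "pole_up c y" "of_real (amp r)" 0 0 "pole_down c y" t]
    show ?thesis by (simp add: hsymbol_leading[OF x y] r leading_def pole_part_def frame_facts(8))
  qed
  then have "((\<lambda>r. pi_plus_mat (\<lambda>\<eta>. hsymbol a P (- 1) (x0 + r *\<^sub>R axis 4 1) (join y \<eta>)) t) has_vector_derivative
      cscale (slope_up y t) (pole_up c y)) (at 0)"
    by (intro has_vector_derivative_transform_within_open[OF has_vector_derivative_cscale[OF
          leading_coefficients_derivative(1)[OF y]] op]) (use frame_facts(7) in auto)
  then show ?thesis unfolding vderiv_def by (rule vector_derivative_at)
qed

text \<open>Tangential derivatives of \<sigma>_(-1) vanish, so \<sigma>_(-2) = - S c_4 (L - (3/4)
  slope S), with S = \<sigma>_(-1) and L its normal derivative. Writing c_4 = - \<i> (U + V),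
  nilpotency leaves only U V U = U and V U V = V.\<close>

lemma hsymbol_subleading:
  assumes y: "y \<noteq> 0"
  defines "z \<equiv> \<lambda>t. complex_of_real t - \<i> * of_real (norm y)" and "w \<equiv> \<lambda>t. complex_of_real t + \<i> * of_real (norm y)"
  shows "hsymbol a P (- 2) x0 (join y t) =
    cscale (\<i> * of_real slope * (- 1 / 4 / (z t)\<^sup>2 + \<i> * of_real (norm y) / z t ^ 3)) (pole_up c y) +
    cscale (\<i> * of_real slope * (- 1 / 4 / (w t)\<^sup>2 - \<i> * of_real (norm y) / w t ^ 3)) (pole_down c y)"
proof -
  let ?U = "pole_up c y" and ?V = "pole_down c y"
  note PM = pole_matrices[OF frame_facts(4) y]
  define L where "L = cscale (slope_up y t) ?U + cscale (slope_down y t) ?V"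
  define S where "S = cscale (1 / z t) ?U + cscale (1 / w t) ?V"
  have res: "dirac_resolvent X a x (join y t) = leading y t (x $ 4)" if "x \<in> T" for x
    by (rule dirac_resolvent_local[OF that y])
  have res0: "dirac_resolvent X a x0 (join y t) = S"
    unfolding res[OF frame_facts(7)] frame_facts(8) by (simp add: leading_def S_def z_def w_def)
  have part: "partial k (\<lambda>x. dirac_resolvent X a x (join y t)) x0 = (if k = 4 then L else 0)" for k
    by (rule partial_of_last[OF frame_facts(5,7), where F = "leading y t"], erule res)
      (use leading_derivative[OF y] frame_facts(8) in \<open>auto simp: L_def\<close>)
  have alpha4: "dirac_alpha X a x0 4 = c 4"
    using dirac_alpha_local[OF frame_facts(7), of 4] frame_facts(8) by simp
  have fo: "first_order (dirac_alpha X a) (dirac_beta X a) (\<lambda>x. dirac_resolvent X a x (join y t)) x0 =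
      c 4 ** (L - (3 / 4 * slope) *\<^sub>R S)"
  proof -
    have "(\<Sum>k\<in>UNIV. dirac_alpha X a x0 k ** (if k = 4 then L else 0)) =
        (\<Sum>k\<in>UNIV. if k = 4 then dirac_alpha X a x0 k ** L else 0)"
      by (intro sum.cong) (auto simp: matmul.zero_right)
    then have "(\<Sum>k\<in>UNIV. dirac_alpha X a x0 k ** (if k = 4 then L else 0)) = c 4 ** L"
      by (simp add: alpha4)
    then show ?thesis
      by (simp add: first_order_def part res0 dirac_beta_x0 matmul.diff_right matmul.minus_left matmul.scaleR_left
          matmul.scaleR_right)
  qed
  \<comment> \<open>The simple poles combine as 1/2 - 3/4 = -1/4: the derivative of the amplitude
    minus the zeroth order term of D.\<close>
  define g1 where "g1 = of_real slope * (- 1 / 4 / z t + \<i> * of_real (norm y) / (z t)\<^sup>2)"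
  define g2 where "g2 = of_real slope * (- 1 / 4 / w t - \<i> * of_real (norm y) / (w t)\<^sup>2)"
  have bracket: "L - (3 / 4 * slope) *\<^sub>R S = cscale g1 ?U + cscale g2 ?V"
  proof -
    have "(3 / 4 * slope) *\<^sub>R S = cscale (of_real (3 / 4 * slope)) S"
      using cscale_of_real[of 1 "3 / 4 * slope" S] by simp
    moreover have "slope_up y t - of_real (3 / 4 * slope) * (1 / z t) = g1"
      "slope_down y t - of_real (3 / 4 * slope) * (1 / w t) = g2"
    proof -
      have "of_real slope * (1 / 2 / Z + Y) - of_real (3 / 4 * slope) * (1 / Z) = of_real slope * (- 1 / 4 / Z + Y)"
        for Z Y :: complex
        unfolding divide_inverse[of _ Z] by (simp add: algebra_simps)
      from this[of "z t"] this[of "w t" "- (\<i> * of_real (norm y) / (w t)\<^sup>2)"]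
      show "slope_up y t - of_real (3 / 4 * slope) * (1 / z t) = g1"
        "slope_down y t - of_real (3 / 4 * slope) * (1 / w t) = g2"
        unfolding slope_up_def slope_down_def g1_def g2_def z_def w_def by simp_all
    qed
    ultimately show ?thesis
      unfolding L_def S_def by (auto simp: vec_eq_iff algebra_simps)
  qed
  have Sc: "S ** c 4 = cscale (- \<i> / z t) (?U ** ?V) + cscale (- \<i> / w t) (?V ** ?U)"
    unfolding S_def PM(6)
    by (simp add: matmul.add_left matmul.add_right matmul_cscale_left matmul_cscale_right cscale_cscale PM(1,2)
        cscale.zero_right cscale.add_right)
  have "S ** (c 4 ** (cscale g1 ?U + cscale g2 ?V)) = (S ** c 4) ** (cscale g1 ?U + cscale g2 ?V)"
    by (simp add: matrix_mul_assoc)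
  also have "\<dots> = cscale (- \<i> / z t * g1) ?U + cscale (- \<i> / w t * g2) ?V"
  proof -
    have "?U ** ?V ** ?V = 0" "?V ** ?U ** ?U = 0"
      by (simp_all add: matrix_mul_assoc[symmetric] PM(1,2) matmul.zero_right)
    then show ?thesis unfolding Sc
      by (simp add: matmul.add_left matmul.add_right matmul_cscale_left matmul_cscale_right cscale_cscale PM(3,4)
        cscale.zero_right mult.commute)
  qed
  finally have fin: "S ** (c 4 ** (cscale g1 ?U + cscale g2 ?V)) =
    cscale (- \<i> / z t * g1) ?U + cscale (- \<i> / w t * g2) ?V" .
  have prod: "- (S ** (c 4 ** (L - (3 / 4 * slope) *\<^sub>R S))) = cscale (\<i> * (g1 / z t)) ?U + cscale (\<i> * (g2 / w t)) ?V"
    unfolding bracket fin by (simp add: vec_eq_iff)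
  have distribute: "s * (- 1 / 4 / Z + n / Z\<^sup>2) / Z = s * (- 1 / 4 / Z\<^sup>2 + n / Z ^ 3)"
    "s * (- 1 / 4 / Z - n / Z\<^sup>2) / Z = s * (- 1 / 4 / Z\<^sup>2 - n / Z ^ 3)" for s n Z :: complex
    unfolding divide_inverse[of _ Z] divide_inverse[of _ "Z\<^sup>2"] divide_inverse[of _ "Z ^ 3"] power_inverse[symmetric]
    by algebra+
  have "hsymbol a P (- 2) x0 (join y t) = dirac_inverse_symbol X a (- 2) x0 (join y t)"
    by (rule hsymbol_parametrix[OF mfd frame_facts(1) D P _ join_nonzero[OF y]]) (use frame_facts(6,7) in blast)
  also have "\<dots> = - (S ** (c 4 ** (L - (3 / 4 * slope) *\<^sub>R S)))"
    by (simp add: dirac_inverse_symbol_def inverse_symbol_def numeral_2_eq_2 res0 fo[unfolded res0])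
  also have "\<dots> = cscale (\<i> * (g1 / z t)) ?U + cscale (\<i> * (g2 / w t)) ?V" by (rule prod)
  also have "\<i> * (g1 / z t) = \<i> * of_real slope * (- 1 / 4 / (z t)\<^sup>2 + \<i> * of_real (norm y) / z t ^ 3)"
    unfolding g1_def mult.assoc distribute(1)[symmetric] by simp
  also have "\<i> * (g2 / w t) = \<i> * of_real slope * (- 1 / 4 / (w t)\<^sup>2 - \<i> * of_real (norm y) / w t ^ 3)"
    unfolding g2_def mult.assoc distribute(2)[symmetric] by simp
  finally show ?thesis .
qed

text \<open>The integral over \<xi>_n is \<pi> slope / |\<xi>'|^3 for all \<xi>' \<noteq> 0; the
  sphere contributes \<Omega>_3 and the definition the factor -1/2.\<close>

lemma res11_density_value: "res11_density a P P x0 = of_real (- (pi / 2) * slope * Omega 3)"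
proof -
  define J where "J y = (LINT t|lborel.
     trace (vderiv (\<lambda>r. pi_plus_mat (\<lambda>\<eta>. hsymbol a P (- 1) (x0 + r *\<^sub>R axis 4 1) (join y \<eta>)) t) 0 **
            vderiv (vderiv (\<lambda>\<eta>. hsymbol a P (- 1) x0 (join y \<eta>))) t))" for y
  have "J y = of_real (slope * pi) / of_real (norm y) ^ 3" if y: "y \<noteq> 0" for y
  proof -
    have n: "norm y > 0" using y by simp
    have "J y = (LINT t|lborel. of_real slope * (2 / ((of_real t - \<i> * of_real (norm y)) * (of_real t + \<i> * of_real (norm y)) ^ 3) +
      4 * \<i> * of_real (norm y) / ((of_real t - \<i> * of_real (norm y))\<^sup>2 * (of_real t + \<i> * of_real (norm y)) ^ 3)))"
      unfolding J_def normal_derivative_pi_plus[OF y] vderiv_hsymbol(2)[OF y]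
        trace_pole_products[OF frame_facts(4) y] slope_up_def
      by (intro Bochner_Integration.integral_cong refl residue_algebra)
    also have "\<dots> = of_real slope * of_real (pi / norm y ^ 3)"
      using has_bochner_integral_mult_right[OF residue_integral_pairs(1)[OF n], of "of_real slope"]
      by (intro has_bochner_integral_integral_eq) simp
    finally show ?thesis by simp
  qed
  from sphere_measure_integral[OF this]
  have "(LINT y|sphere_measure. J y) = of_real (slope * pi) * of_real (Omega 3)" .
  then show ?thesis unfolding res11_density_def J_def by simp
qed

lemma res21_density_value: "res21_density a P P x0 = of_real (pi * slope * Omega 3)"
proof -
  define J where "J y = (LINT t|lborel.
     trace (pi_plus_mat (\<lambda>\<eta>. hsymbol a P (- 2) x0 (join y \<eta>)) t **
            vderiv (\<lambda>\<eta>. hsymbol a P (- 1) x0 (join y \<eta>)) t))" for y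
  have "J y = \<i> * of_real (slope * pi) / of_real (norm y) ^ 3" if y: "y \<noteq> 0" for y
  proof -
    have n: "norm y > 0" using y by simp
    \<comment> \<open>The coefficient 0 is that of the simple pole: \<sigma>_(-2) has poles of order
      two and three only.\<close>
    have pp: "pi_plus_mat (\<lambda>\<eta>. hsymbol a P (- 2) x0 (join y \<eta>)) t =
        cscale (pole_part (\<i> * of_real (norm y)) 0 (- \<i> * of_real slope / 4) (- of_real (slope * norm y)) (of_real t)) (pole_up c y)" for t
      by (rule pi_plus_mat_eval[OF n, where V = "pole_down c y" and ?v1.0 = 0 and
            ?v2.0 = "- \<i> * of_real slope / 4" and ?v3.0 = "of_real (slope * norm y)"])
        (simp only: hsymbol_subleading[OF y] pole_part_def residue_algebra diff_minus_eq_add)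
    have "J y = (LINT t|lborel. \<i> * of_real slope * (1 / (2 * ((of_real t - \<i> * of_real (norm y))\<^sup>2 * (of_real t + \<i> * of_real (norm y))\<^sup>2)) -
        2 * \<i> * of_real (norm y) / ((of_real t - \<i> * of_real (norm y)) ^ 3 * (of_real t + \<i> * of_real (norm y))\<^sup>2)))"
      unfolding J_def pp vderiv_hsymbol(1)[OF y] trace_pole_products[OF frame_facts(4) y] pole_part_def
      by (intro Bochner_Integration.integral_cong refl residue_algebra)
    also have "\<dots> = \<i> * of_real slope * of_real (pi / norm y ^ 3)"
      using has_bochner_integral_mult_right[OF residue_integral_pairs(2)[OF n], of "\<i> * of_real slope"]
      by (intro has_bochner_integral_integral_eq) simp
    finally show ?thesis by simp
  qed
  from sphere_measure_integral[OF this]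
  have "(LINT y|sphere_measure. J y) = \<i> * of_real (slope * pi) * of_real (Omega 3)" .
  \<comment> \<open>The factor \<i> carried by \<sigma>_(-2) meets the factor -\<i> of the
    definition, so the density is real.\<close>
  then have "res21_density a P P x0 = - \<i> * (\<i> * of_real (slope * pi) * of_real (Omega 3))"
    unfolding res21_density_def J_def by simp
  moreover have "- \<i> * (\<i> * z * w) = z * w" for z w :: complex
    by (simp add: mult.assoc)
  ultimately show ?thesis by (simp add: mult_ac)
qed

end

context collar_setup
begin

text \<open>Every flat frame at p gives the same number and at least one exists, so both
  descriptions are determined; the values do not depend on p.\<close>

lemma residue_values:
  assumes D: "dirac_operator X D" and P: "parametrix X D P" and p: "p \<in> bdry B"
  shows "res11 X B P P p = of_real (- (pi / 2) * slope * Omega 3)"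
    and "res21 X B P P p = of_real (pi * slope * Omega 3)"
proof -
  have pt: "flat_point X B \<phi> \<psi> a p D P" if "flat_frame X B a" "p \<in> fdom a" for a
    by unfold_locales (use that D P p in auto)
  have v: "res11_density a P P (fmap a p) = of_real (- (pi / 2) * slope * Omega 3)"
    "res21_density a P P (fmap a p) = of_real (pi * slope * Omega 3)"
    if "flat_frame X B a" "p \<in> fdom a" for a
    using flat_point.res11_density_value[OF pt[OF that]] flat_point.res21_density_value[OF pt[OF that]]
      flat_point.x0_def[OF pt[OF that]] by simp_all
  obtain a where a: "flat_frame X B a" "p \<in> fdom a" using flat_frame_exists[OF p] .
  show "res11 X B P P p = of_real (- (pi / 2) * slope * Omega 3)"
    unfolding res11_def by (rule the_equality) (use a v in auto)
  show "res21 X B P P p = of_real (pi * slope * Omega 3)"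
    unfolding res21_def by (rule the_equality) (use a v in auto)
qed

end

theorem theorem3p6:
  fixes X :: "'m::{t2_space,second_countable_topology} spin_mfd"
    and B :: "'m collar"
    and \<phi> \<psi> :: "real \<Rightarrow> real"
    and D Dinv :: "('m \<Rightarrow> complex^4) \<Rightarrow> ('m \<Rightarrow> complex^4)"
    and \<mu> :: "'m measure"
  assumes "riemannian_spin_mfd X"
    and "manifold_with_collar X B"
    and "flat_boundary X B"
    and "collar_metric X B \<phi> \<psi>"
    and "deriv \<psi> 0 = deriv \<phi> 0"
    and "dirac_operator X D"
    and "parametrix X D Dinv"
    and "bdry_volume X B \<mu>"
  shows "(LINT p|\<mu>. res11 X B Dinv Dinv p) = complex_of_real (pi / 6 * Omega 3 * I_Gr_b X B \<mu>)
       \<and> (LINT p|\<mu>. res21 X B Dinv Dinv p) = complex_of_real (- (pi / 3) * Omega 3 * I_Gr_b X B \<mu>)"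
proof -
  interpret collar_setup X B \<phi> \<psi> by unfold_locales (fact assms)+
  have sp: "space \<mu> = bdry B" using assms(8) by (simp add: bdry_volume_def)
  have "(LINT p|\<mu>. res11 X B Dinv Dinv p) = (LINT p|\<mu>. complex_of_real (- (pi / 2) * slope * Omega 3))"
    "(LINT p|\<mu>. res21 X B Dinv Dinv p) = (LINT p|\<mu>. complex_of_real (pi * slope * Omega 3))"
    by (intro Bochner_Integration.integral_cong; simp add: sp residue_values[OF assms(6,7)])+
  \<comment> \<open>\<open>I_Gr_b\<close> is -3 slope times the volume, and -\<pi>/2 and \<pi>
    divided by -3 are \<pi>/6 and -\<pi>/3.\<close>
  then show ?thesis
    unfolding I_Gr_b_value[OF assms(8)] by (simp add: scaleR_conv_of_real)
qed

end
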